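(* Let $(\mathfrak g,\mathfrak l,\mathfrak u,\delta)$ be a nondegenerate (finite-dimensional) Lie bialgebra with a splitting. Let $(\mathfrak a,\delta)$ be a finite-dimensional Lie bialgebra equipped with a Lie bialgebra inclusion $\mathfrak g\subset\mathfrak a$, and let $Z\in\wedge^3(\mathfrak a)^{\mathfrak a}$ with $\mathrm{Alt}((\delta\otimes\mathrm{id}^{\otimes2})(Z))=0$. Then the map $\rho\mapsto\rho_{|L^*}+\sigma_{\mathfrak l}^{\mathfrak g}$ takes Poisson-Lie dynamical $r$-matrices for $(G^*,\mathfrak a,Z)$ (whose restriction $\rho_{|L^*}$ to $L^*$ is defined) to Poisson-Lie dynamical $r$-matrices for $(L^*,\mathfrak a,Z)$.
   Context: The base field is $\mathbb C$; Lie bialgebras are finite dimensional. Formal groups. For a Lie algebra $\mathfrak x$ with formal group $X$, $\mathbb C[[X]]:=U(\mathfrak x)^*$ is the algebra of functions on $X$. For $\xi\in\mathfrak x$: $(\mathbf L_\xi f)(x)=\frac{d}{d\epsilon}|_{\epsilon=0}f(e^{-\epsilon\xi}x)$, $(\mathbf R_\xi f)(x)=\frac{d}{d\epsilon}|_{\epsilon=0}f(xe^{\epsilon\xi})$; one also allows $\xi\in\mathfrak x\otimes\mathbb C[[X]]$ (extend linearly over functions). Doubles and dressing action. For a Lie bialgebra $\mathfrak h$, $\mathfrak h^*$ is the dual Lie bialgebra, and $\mathfrak d(\mathfrak h)=\mathfrak h\oplus\mathfrak h^*$ is the double: $\mathfrak h,\mathfrak h^*$ are Lie subalgebras and the canonical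 symmetric pairing $\langle-,-\rangle$ is invariant. $H^*$ is the formal group of $\mathfrak h^*$. For $a\in\mathfrak h$, $\mathrm{dress}^L_a$ is the derivation of $\mathbb C[[H^*]]$ given by $(\mathrm{dress}^L_af)(x)=-\big(\mathbf R_{(\mathrm{Ad}(x^{-1})(a))_{\mathfrak h^*}}f\big)(x)$, where $(\cdot)_{\mathfrak h^*}$ is the projection along $\mathfrak h$. It extends to localizations. PL dynamical $r$-matrices. Let $(\mathfrak a,\delta)$ be a Lie bialgebra, $\mathfrak h\subset\mathfrak a$ a Lie subbialgebra, $Z\in\wedge^3(\mathfrak a)^{\mathfrak a}$ with $\mathrm{Alt}((\delta\otimes\mathrm{id}^{\otimes2})(Z))=0$. For $f\in\mathbb C[[H^*]]$ set $d^L(f)=-\sum_ie_i\otimes\mathbf L_{\varepsilon^i}(f)$, with $(e_i),(\varepsilon^i)$ dual bases of $\mathfrak h,\mathfrak h^*$; for $\rho=\sum a_\alpha\otimes b_\alpha\otimes\ell_\alpha$, $d^L\rho=\sum a_\alpha\otimes b_\alpha\otimes d^L(\ell_\alpha)$. $\mathrm{Alt}(x)=x+x^{2,3,1}+x^{3,1,2}$, $\mathrm{CYB}(\rho)=[\rho^{1,2},\rho^{1,3}]+[\rho^{1,2},\rho^{2,3}]+[\rho^{1,3},\rho^{2,3}]$. A PL dynamical $r$-matrix for $(H^*,\mathfrak a,Z)$ is $\rho\in\wedge^2(\mathfrak a)\otimes\mathbb C[[H^*]][1/\mathbf P]$ (some nonzero $\mathbf P\in\mathbb C[[H^*]]$)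 such that (a) $\mathrm{dress}^L_a(\rho)+[a\otimes1+1\otimes a,\rho]=0$ for all $a\in\mathfrak h$; (b) $\mathrm{CYB}(\rho)+\mathrm{Alt}(d^L\rho)+\mathrm{Alt}((\delta\otimes\mathrm{id})(\rho))=Z$. Splittings. A Lie bialgebra with a splitting is a Lie bialgebra $(\mathfrak g,\delta)$ with a Lie subbialgebra $\mathfrak l$ and a decomposition $\mathfrak g=\mathfrak l\oplus\mathfrak u$ with $[\mathfrak l,\mathfrak u]\subset\mathfrak u$ and $\delta(\mathfrak u)\subset(\mathfrak l\otimes\mathfrak u)\oplus(\mathfrak u\otimes\mathfrak l)\oplus(\mathfrak u\otimes\mathfrak u)$. Then $\mathfrak l^*$ is a Lie subalgebra and $\mathfrak u^*$ an ideal of $\mathfrak g^*=\mathfrak l^*\oplus\mathfrak u^*$; $L^*\subset G^*$ are the formal groups of $\mathfrak l^*\subset\mathfrak g^*$, and $\rho\mapsto\rho_{|L^*}$ is induced by the restriction map $\mathbb C[[G^*]]\to\mathbb C[[L^*]]$ (it is defined if $\rho\in\wedge^2(\mathfrak a)\otimes\mathbb C[[G^*]][1/\mathbf P]$ with $\mathbf P_{|L^*}\ne0$). The splitting is nondegenerate if for generic $\lambda\in\mathfrak l^*$ the form $(u,v)\mapsto\lambda([u,v]_{\mathfrak l})$ on $\mathfrak u$ is nondegenerate ($z\mapsto z_{\mathfrak l}$ is the projection along $\mathfrak u$). The element $\sigma_{\mathfrak l}^{\mathfrak g}$. For $x\in L^*$ and $u,v\in\mathfrak u$ put $\omega_x(u,v)=\langle(\mathrm{Ad}(x^{-1})(u))_{\mathfrak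 g},(\mathrm{Ad}(x^{-1})(v))_{\mathfrak g^*}\rangle$, computed in $\mathfrak d(\mathfrak g)=\mathfrak g\oplus\mathfrak g^*$; this is an antisymmetric $\mathbb C[[L^*]]$-valued form on $\mathfrak u$. Fix a linear isomorphism $i:\mathfrak u\to\mathfrak u^*$, put $a(x)(u)=i^{-1}(\omega_x(u,-))$ and $P_{\mathfrak l}^{\mathfrak g}(x)=\det a(x)\in\mathbb C[[L^*]]$, which is nonzero. Then $\sigma_{\mathfrak l}^{\mathfrak g}=\sum_\alpha a_\alpha\otimes b_\alpha\otimes\ell_\alpha\in\wedge^2(\mathfrak u)\otimes\mathbb C[[L^*]][1/P_{\mathfrak l}^{\mathfrak g}]$ is uniquely determined by $\sum_\alpha a_\alpha\otimes\omega_x(v,b_\alpha)\ell_\alpha(x)=v\otimes1$ for all $v\in\mathfrak u$. *)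

theory Defs
  imports
    Complex_Main
    "HOL-Library.Function_Algebras"
    "HOL-Library.Product_Plus"
    "HOL-Library.Poly_Mapping"
    "HOL-Computational_Algebra.Fraction_Field"
    "Jordan_Normal_Form.Determinant"
begin

section \<open>Complex vector spaces\<close>

class complex_space = ab_group_add +
  fixes cscale :: "complex \<Rightarrow> 'a \<Rightarrow> 'a"  (infixr "*\<^sub>C" 75)
  assumes cscale_add_right: "c *\<^sub>C (x + y) = c *\<^sub>C x + c *\<^sub>C y"
    and cscale_add_left: "(c + d) *\<^sub>C x = c *\<^sub>C x + d *\<^sub>C x"
    and cscale_cscale: "c *\<^sub>C d *\<^sub>C x = (c * d) *\<^sub>C x"
    and cscale_one: "1 *\<^sub>C x = x"

global_interpretation cvec: vector_space "cscale :: complex \<Rightarrow> 'a::complex_space \<Rightarrow> 'a"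
  by unfold_locales (simp_all add: cscale_add_right cscale_add_left cscale_cscale cscale_one)

class fd_complex_space = complex_space +
  assumes finite_dim: "\<exists>B. finite B \<and> (\<forall>x. \<exists>f. x = (\<Sum>b\<in>B. f b *\<^sub>C b))"

class complex_idom = complex_space + idom +
  assumes cscale_mult_left: "(c *\<^sub>C x) * y = c *\<^sub>C (x * y)"

instantiation complex :: complex_space
begin
definition "c *\<^sub>C (x::complex) = c * x"
instance by standard (simp_all add: cscale_complex_def algebra_simps)
end

instantiation "fun" :: (type, complex_space) complex_space
begin
definition "c *\<^sub>C (f :: 'a \<Rightarrow> 'b) = (\<lambda>x. c *\<^sub>C f x)"
instance
  by standard (simp_all add: cscale_fun_def fun_eq_iff cscale_add_right cscale_add_left
      cscale_cscale cscale_one)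
end

instantiation fract :: (complex_idom) complex_space
begin
definition "c *\<^sub>C (q :: 'a fract) = to_fract (c *\<^sub>C 1) * q"
instance
  by standard (simp_all add: cscale_fract_def cscale_add_left cscale_mult_left cscale_cscale
      cscale_one distrib_left distrib_right flip: mult.assoc to_fract_mult)
end

abbreviation clinear :: "('a::complex_space \<Rightarrow> 'b::complex_space) \<Rightarrow> bool" where
  "clinear \<equiv> Vector_Spaces.linear cscale cscale"

lemma clinear_iff:
  "clinear f \<longleftrightarrow> (\<forall>x y. f (x + y) = f x + f y) \<and> (\<forall>c x. f (c *\<^sub>C x) = c *\<^sub>C f x)"
  by (rule linear_iff_module_hom[THEN trans])
     (auto simp: module_hom_iff cvec.module_axioms)

definition cbilinear :: "('a::complex_space \<Rightarrow> 'b::complex_space \<Rightarrow> 'c::complex_space) \<Rightarrow> bool" where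
  "cbilinear f \<longleftrightarrow> (\<forall>x. clinear (f x)) \<and> (\<forall>y. clinear (\<lambda>x. f x y))"

definition cbasis :: "'a::complex_space set" where
  "cbasis = (SOME B. cvec.independent B \<and> cvec.span B = UNIV)"

definition coord :: "'a \<Rightarrow> 'a::complex_space \<Rightarrow> complex" where
  "coord b x = cvec.representation cbasis x b"

lemma cbasis: "cvec.independent (cbasis :: 'a::complex_space set)"
    "cvec.span (cbasis :: 'a set) = UNIV"
proof -
  obtain B :: "'a set" where "cvec.independent B" "cvec.span B = UNIV"
    by (metis cvec.maximal_independent_subset[of UNIV] top.extremum_uniqueI)
  then have "\<exists>B :: 'a set. cvec.independent B \<and> cvec.span B = UNIV" by blast
  from someI_ex[OF this] show "cvec.independent (cbasis :: 'a set)"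
    "cvec.span (cbasis :: 'a set) = UNIV" unfolding cbasis_def by auto
qed

lemma finite_cbasis: "finite (cbasis :: 'a::fd_complex_space set)"
proof -
  obtain B :: "'a set" where B: "finite B" "\<And>x. \<exists>f. x = (\<Sum>b\<in>B. f b *\<^sub>C b)"
    using finite_dim by blast
  have "x \<in> cvec.span B" for x
  proof -
    obtain f where "x = (\<Sum>b\<in>B. f b *\<^sub>C b)" using B(2) by blast
    then show ?thesis by (simp add: cvec.span_sum cvec.span_scale cvec.span_base)
  qed
  with B(1) have "finite B" "cvec.span B = UNIV" by auto
  then show ?thesis
    using cvec.independent_span_bound[of B cbasis] cbasis(1) by auto
qed

subsection \<open>The dual space\<close>

typedef (overloaded) 'a cdual = "{f :: 'a::complex_space \<Rightarrow> complex. clinear f}"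
  morphisms cd_app Cd
  by (rule exI[of _ "\<lambda>_. 0"]) (simp add: clinear_iff)

setup_lifting type_definition_cdual

instantiation cdual :: (complex_space) complex_space
begin
lift_definition zero_cdual :: "'a cdual" is "\<lambda>_. 0" by (simp add: clinear_iff)
lift_definition plus_cdual :: "'a cdual \<Rightarrow> 'a cdual \<Rightarrow> 'a cdual" is "\<lambda>f g x. f x + g x"
  by (simp add: clinear_iff cscale_add_right)
lift_definition minus_cdual :: "'a cdual \<Rightarrow> 'a cdual \<Rightarrow> 'a cdual" is "\<lambda>f g x. f x - g x"
  by (simp add: clinear_iff cscale_complex_def algebra_simps)
lift_definition uminus_cdual :: "'a cdual \<Rightarrow> 'a cdual" is "\<lambda>f x. - f x"
  by (simp add: clinear_iff cscale_complex_def)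
lift_definition cscale_cdual :: "complex \<Rightarrow> 'a cdual \<Rightarrow> 'a cdual" is "\<lambda>c f x. c *\<^sub>C f x"
  by (simp add: clinear_iff cscale_complex_def algebra_simps)
instance
  by standard (transfer; simp add: fun_eq_iff cscale_complex_def algebra_simps)+
end

definition dual_basis :: "'a \<Rightarrow> 'a::complex_space cdual" where
  "dual_basis b = Cd (coord b)"

definition precomp :: "('a::complex_space \<Rightarrow> 'b::complex_space) \<Rightarrow> 'b cdual \<Rightarrow> 'a cdual" where
  "precomp f \<phi> = Cd (\<lambda>x. cd_app \<phi> (f x))"


section \<open>Functions on formal groups\<close>

text \<open>
  A function on words is a linear functional on the free associative algebra on the set
  \<open>'x\<close>.  The product below is dual to the coproduct of the free algebra for which all letters
  are primitive; \<open>splits w\<close> lists the pairs of complementary subwords of a word, so that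
  the coproduct of a word is the sum of the \<open>u \<otimes> v\<close> over its splits.
\<close>

fun splits :: "'x list \<Rightarrow> ('x list \<times> 'x list) list" where
  "splits [] = [([], [])]"
| "splits (x # w) = map (\<lambda>(u, v). (x # u, v)) (splits w) @ map (\<lambda>(u, v). (u, x # v)) (splits w)"

typedef 'x wfun = "UNIV :: ('x list \<Rightarrow> complex) set"
  morphisms wval WFun ..

setup_lifting type_definition_wfun

lemma wfun_eqI: "(\<And>w. wval f w = wval g w) \<Longrightarrow> f = g"
  by (simp add: wval_inject[symmetric] fun_eq_iff)

lemma wval_WFun [simp]: "wval (WFun f) = f"
  by (simp add: WFun_inverse)

instantiation wfun :: (type) complex_space
begin
lift_definition zero_wfun :: "'a wfun" is "\<lambda>_. 0" .
lift_definition plus_wfun :: "'a wfun \<Rightarrow> 'a wfun \<Rightarrow> 'a wfun" is "\<lambda>f g w. f w + g w" .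
lift_definition minus_wfun :: "'a wfun \<Rightarrow> 'a wfun \<Rightarrow> 'a wfun" is "\<lambda>f g w. f w - g w" .
lift_definition uminus_wfun :: "'a wfun \<Rightarrow> 'a wfun" is "\<lambda>f w. - f w" .
lift_definition cscale_wfun :: "complex \<Rightarrow> 'a wfun \<Rightarrow> 'a wfun" is "\<lambda>c f w. c * f w" .
instance
  by standard (transfer; simp add: fun_eq_iff algebra_simps)+
end

lemma wval_simps [simp]:
  "wval 0 w = 0" "wval (f + g) w = wval f w + wval g w" "wval (f - g) w = wval f w - wval g w"
  "wval (- f) w = - wval f w" "wval (c *\<^sub>C f) w = c * wval f w"
  by (transfer; simp)+

lemma wval_sum [simp]: "wval (sum f A) w = (\<Sum>a\<in>A. wval (f a) w)"
  by (induction A rule: infinite_finite_induct) auto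

instantiation wfun :: (type) "{one, times}"
begin
lift_definition one_wfun :: "'a wfun" is "\<lambda>w. if w = [] then 1 else 0" .
lift_definition times_wfun :: "'a wfun \<Rightarrow> 'a wfun \<Rightarrow> 'a wfun" is
  "\<lambda>f g w. \<Sum>(u, v)\<leftarrow>splits w. f u * g v" .
instance ..
end

definition shift :: "'x \<Rightarrow> 'x wfun \<Rightarrow> 'x wfun" where
  "shift x f = WFun (\<lambda>w. wval f (x # w))"

lemma wval_shift [simp]: "wval (shift x f) w = wval f (x # w)"
  by (simp add: shift_def)

lemma wval_one: "wval 1 w = (if w = [] then 1 else 0)"
  by transfer simp

lemma shift_simps [simp]:
  "shift x 0 = 0" "shift x (f + g) = shift x f + shift x g" "shift x (f - g) = shift x f - shift x g"
  "shift x (- f) = - shift x f" "shift x (c *\<^sub>C f) = c *\<^sub>C shift x f" "shift x 1 = 0"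
  by (auto intro!: wfun_eqI simp: wval_one)

lemma wval_times: "wval (f * g) w = (\<Sum>(u, v)\<leftarrow>splits w. wval f u * wval g v)"
  by transfer simp

lemma wval_times_Nil [simp]: "wval (f * g) [] = wval f [] * wval g []"
  by (simp add: wval_times)

lemma wval_times_Cons [simp]:
  "wval (f * g) (x # w) = wval (shift x f * g) w + wval (f * shift x g) w"
  by (simp add: wval_times o_def case_prod_unfold)

lemma shift_times [simp]: "shift x (f * g) = shift x f * g + f * shift x g"
  by (rule wfun_eqI) simp

lemma wfun_distrib: "((f::'x wfun) + g) * h = f * h + g * h"
  by (rule wfun_eqI) (simp add: wval_times case_prod_unfold distrib_right sum_list_addf)

lemma wfun_mult_commute: "(f::'x wfun) * g = g * f"
proof (rule wfun_eqI)
  fix w show "wval (f * g) w = wval (g * f) w"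
    by (induction w arbitrary: f g) simp_all
qed

lemma wfun_distrib': "h * ((f::'x wfun) + g) = h * f + h * g"
  by (simp add: wfun_distrib wfun_mult_commute[of h])

lemma wfun_mult_assoc: "((f::'x wfun) * g) * h = f * (g * h)"
proof (rule wfun_eqI)
  fix w show "wval ((f * g) * h) w = wval (f * (g * h)) w"
    by (induction w arbitrary: f g h)
       (simp_all add: wfun_distrib wfun_distrib' mult.assoc)
qed

lemma wfun_zero_mult: "0 * (f::'x wfun) = 0"
  by (rule wfun_eqI) (simp add: wval_times case_prod_unfold)

lemma wfun_scale_mult: "(c *\<^sub>C (f::'x wfun)) * g = c *\<^sub>C (f * g)"
  by (rule wfun_eqI) (simp add: wval_times case_prod_unfold mult.assoc sum_list_const_mult)

lemma wfun_one_mult: "1 * (f::'x wfun) = f"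
proof (rule wfun_eqI)
  fix w show "wval (1 * f) w = wval f w"
    by (induction w arbitrary: f) (simp_all add: wval_one wfun_zero_mult)
qed

instance wfun :: (type) comm_ring_1
proof
  show "(0::'a wfun) \<noteq> 1"
    by (metis wval_one wval_simps(1) zero_neq_one)
qed (rule wfun_mult_assoc wfun_mult_commute wfun_one_mult wfun_distrib)+

subsection \<open>The ring has no zero divisors\<close>

definition order_ge :: "nat \<Rightarrow> 'x wfun \<Rightarrow> bool" where
  "order_ge n f \<longleftrightarrow> (\<forall>w. length w < n \<longrightarrow> wval f w = 0)"

lemma splits_length: "(u, v) \<in> set (splits w) \<Longrightarrow> length u + length v = length w"
  by (induction w arbitrary: u v) auto

lemma order_ge_mult: "order_ge m (f :: 'x wfun) \<Longrightarrow> order_ge n g \<Longrightarrow> order_ge (m + n) (f * g)"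
  unfolding order_ge_def
proof (intro allI impI)
  fix w :: "'x list" assume *: "\<forall>w. length w < m \<longrightarrow> wval f w = 0" "\<forall>w. length w < n \<longrightarrow> wval g w = 0"
    "length w < m + n"
  have "(\<lambda>(u, v). wval f u * wval g v) p = 0" if "p \<in> set (splits w)" for p
  proof -
    obtain u v where p: "p = (u, v)" by (cases p)
    then have "length u < m \<or> length v < n" using splits_length[of u v w] that *(3) by auto
    then show ?thesis using *(1,2) p by auto
  qed
  then show "wval (f * g) w = 0"
    unfolding wval_times by (metis (no_types, lifting) map_eq_conv sum_list_0)
qed

abbreviation shifts :: "nat \<Rightarrow> 'x \<Rightarrow> 'x wfun \<Rightarrow> 'x wfun" where
  "shifts k x \<equiv> shift x ^^ k"

lemma wval_shifts: "wval (shifts k x f) w = wval f (replicate k x @ w)"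
  by (induction k arbitrary: w) (simp_all add: replicate_app_Cons_same)

lemma shifts_times:
  "shifts k x (f * g) = (\<Sum>i\<le>k. of_nat (k choose i) * (shifts i x f * shifts (k - i) x g))"
proof (induction k)
  case (Suc k)
  have shift_sum: "shift x (sum h A) = (\<Sum>a\<in>A. shift x (h a))" for h and A :: "nat set"
    by (rule wfun_eqI) simp
  have shift_nat: "shift x (of_nat n) = 0" for n
    by (induction n) simp_all
  let ?F = "\<lambda>i. shifts i x f" and ?G = "\<lambda>i. shifts i x g"
  have "shifts (Suc k) x (f * g) = (\<Sum>i\<le>k. of_nat (k choose i) * (?F (Suc i) * ?G (k - i)))
      + (\<Sum>i\<le>k. of_nat (k choose i) * (?F i * ?G (Suc k - i)))"
    by (simp add: Suc shift_sum shift_nat distrib_left sum.distrib Suc_diff_le)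
  also have "(\<Sum>i\<le>k. of_nat (k choose i) * (?F i * ?G (Suc k - i)))
      = ?F 0 * ?G (Suc k) + (\<Sum>i\<le>k. of_nat (k choose Suc i) * (?F (Suc i) * ?G (k - i)))"
  proof -
    have "(\<Sum>i\<le>k. of_nat (k choose i) * (?F i * ?G (Suc k - i)))
       = (\<Sum>i\<le>Suc k. of_nat (k choose i) * (?F i * ?G (Suc k - i)))"
      by (simp add: binomial_eq_0)
    also have "\<dots> = ?F 0 * ?G (Suc k) + (\<Sum>i\<le>k. of_nat (k choose Suc i) * (?F (Suc i) * ?G (k - i)))"
      by (subst sum.atMost_Suc_shift) simp
    finally show ?thesis .
  qed
  also have "(\<Sum>i\<le>k. of_nat (k choose i) * (?F (Suc i) * ?G (k - i)))
      + (?F 0 * ?G (Suc k) + (\<Sum>i\<le>k. of_nat (k choose Suc i) * (?F (Suc i) * ?G (k - i))))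
      = ?F 0 * ?G (Suc k) + (\<Sum>i\<le>k. of_nat (Suc k choose Suc i) * (?F (Suc i) * ?G (k - i)))"
    by (simp add: sum.distrib[symmetric] distrib_right algebra_simps)
  also have "\<dots> = (\<Sum>i\<le>Suc k. of_nat (Suc k choose i) * (?F i * ?G (Suc k - i)))"
    by (subst sum.atMost_Suc_shift) simp
  finally show ?case .
qed simp

definition has_order :: "nat \<Rightarrow> 'x wfun \<Rightarrow> bool" where
  "has_order n f \<longleftrightarrow> order_ge n f \<and> (\<exists>w. length w = n \<and> wval f w \<noteq> 0)"

lemma has_order_exists:
  assumes "f \<noteq> 0" shows "\<exists>n. has_order n f"
proof -
  define n where "n = (LEAST n. \<exists>w. length w = n \<and> wval f w \<noteq> 0)"
  have ex: "\<exists>n w. length w = n \<and> wval f w \<noteq> 0"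
    using assms by (metis wfun_eqI wval_simps(1))
  show ?thesis
    unfolding has_order_def order_ge_def
    using LeastI_ex[OF ex] not_less_Least[of _ "\<lambda>n. \<exists>w. length w = n \<and> wval f w \<noteq> 0"] by blast
qed

lemma order_ge_shifts: "order_ge n f \<Longrightarrow> order_ge (n - k) (shifts k x f)"
  by (auto simp: order_ge_def wval_shifts)

lemma has_order_max_shift:
  assumes "has_order n f"
  obtains a where "a \<le> n" "has_order (n - a) (shifts a x f)"
    "\<And>i. i > a \<Longrightarrow> order_ge (Suc n - i) (shifts i x f)"
proof -
  let ?P = "\<lambda>a. a \<le> n \<and> has_order (n - a) (shifts a x f)"
  define a where "a = (GREATEST a. ?P a)"
  have 0: "?P 0" using assms by simp
  have a: "?P a" unfolding a_def by (rule GreatestI_nat[of ?P 0 n]) (use 0 in auto)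
  have max: "\<not> ?P i" if "i > a" for i
    using Greatest_le_nat[of ?P i n] that unfolding a_def by auto
  have "order_ge (Suc n - i) (shifts i x f)" if i: "i > a" for i
  proof (cases "i \<le> n")
    case True
    then have "\<not> has_order (n - i) (shifts i x f)" using max[OF i] by blast
    moreover have "order_ge (n - i) (shifts i x f)"
      using assms order_ge_shifts by (auto simp: has_order_def)
    ultimately show ?thesis
      unfolding order_ge_def has_order_def using True by (metis Suc_diff_le less_Suc_eq)
  qed (simp add: order_ge_def)
  with a that show thesis by blast
qed

lemma has_order_mult:
  "has_order m f \<Longrightarrow> has_order n g \<Longrightarrow> has_order (m + n) (f * g)"
proof (induction "m + n" arbitrary: m n f g rule: less_induct)
  case less
  have ge: "order_ge m f" "order_ge n g" using less.prems by (auto simp: has_order_def)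
  obtain u v where uv: "length u = m" "wval f u \<noteq> 0" "length v = n" "wval g v \<noteq> 0"
    using less.prems by (auto simp: has_order_def)
  have "\<exists>w. length w = m + n \<and> wval (f * g) w \<noteq> 0"
  proof (cases "m + n = 0")
    case True
    then show ?thesis using uv by (intro exI[of _ "[]"]) auto
  next
    case False
    then have "u \<noteq> [] \<or> v \<noteq> []" using uv by auto
    then obtain x where x: "(\<exists>u'. u = x # u') \<or> (\<exists>v'. v = x # v')"
      by (metis neq_Nil_conv)
    obtain a where a: "a \<le> m" "has_order (m - a) (shifts a x f)"
      "\<And>i. i > a \<Longrightarrow> order_ge (Suc m - i) (shifts i x f)"
      using has_order_max_shift[OF less.prems(1), of x] by blast
    obtain b where b: "b \<le> n" "has_order (n - b) (shifts b x g)"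
      "\<And>i. i > b \<Longrightarrow> order_ge (Suc n - i) (shifts i x g)"
      using has_order_max_shift[OF less.prems(2), of x] by blast
    have "a > 0 \<or> b > 0"
    proof (rule ccontr)
      assume "\<not> (a > 0 \<or> b > 0)"
      then have "order_ge m (shift x f)" "order_ge n (shift x g)"
        using a(3)[of 1] b(3)[of 1] by auto
      with x uv show False by (auto simp: order_ge_def)
    qed
    then have "(m - a) + (n - b) < m + n" using a(1) b(1) by linarith
    from less.hyps[OF this a(2) b(2)]
    have "has_order ((m - a) + (n - b)) (shifts a x f * shifts b x g)" .
    then obtain w where w: "length w = (m - a) + (n - b)"
      "wval (shifts a x f * shifts b x g) w \<noteq> 0"
      by (auto simp: has_order_def)
    have zero: "wval (shifts i x f * shifts (a + b - i) x g) w = 0" if "i \<le> a + b" "i \<noteq> a" for i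
    proof (cases "i > a")
      case True
      have "order_ge ((Suc m - i) + (n - (a + b - i))) (shifts i x f * shifts (a + b - i) x g)"
        by (intro order_ge_mult a order_ge_shifts ge True)
      moreover have "length w < (Suc m - i) + (n - (a + b - i))"
        using True that a b w by linarith
      ultimately show ?thesis by (auto simp: order_ge_def)
    next
      case False
      with that have *: "a + b - i > b" "i < a" by auto
      have "order_ge ((m - i) + (Suc n - (a + b - i))) (shifts i x f * shifts (a + b - i) x g)"
        by (intro order_ge_mult b order_ge_shifts ge *)
      moreover have "length w < (m - i) + (Suc n - (a + b - i))"
        using * that a b w by linarith
      ultimately show ?thesis by (auto simp: order_ge_def)
    qed
    have nat: "wval (of_nat k * h) w = of_nat k * wval h w" for k h
      by (induction k) (simp_all add: distrib_right)
    have "wval (f * g) (replicate (a + b) x @ w) = wval (shifts (a + b) x (f * g)) w"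
      by (simp only: wval_shifts)
    also have "\<dots> = (\<Sum>i\<le>a + b. of_nat (a + b choose i) * wval (shifts i x f * shifts (a + b - i) x g) w)"
      by (simp only: shifts_times wval_sum nat)
    also have "\<dots> = (\<Sum>i\<in>{a}. of_nat (a + b choose i) * wval (shifts i x f * shifts (a + b - i) x g) w)"
      using zero by (intro sum.mono_neutral_right) auto
    also have "\<dots> \<noteq> 0" using w(2) by simp
    finally show ?thesis using w(1) a(1) b(1)
      by (intro exI[of _ "replicate (a + b) x @ w"]) simp
  qed
  then show ?case using order_ge_mult[OF ge] by (auto simp: has_order_def)
qed

instance wfun :: (type) complex_idom
proof
  fix a b :: "'a wfun"
  assume "a \<noteq> 0" "b \<noteq> 0"
  then obtain m n where "has_order m a" "has_order n b" using has_order_exists by blast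
  then have "has_order (m + n) (a * b)" by (rule has_order_mult)
  then show "a * b \<noteq> 0" by (auto simp: has_order_def)
qed (rule wfun_scale_mult)

subsection \<open>Functions on the formal group of a Lie algebra\<close>

text \<open>
  \<open>'x list \<Rightarrow>\<^sub>0 complex\<close> is the free associative algebra on the set \<open>'x\<close>, and
  \<open>env_ideal br\<close> is the two-sided ideal by which one divides it to obtain the enveloping algebra
  of the Lie algebra \<open>('x, br)\<close>: multiplying the relations by words on both sides is built into
  the generators.
\<close>

inductive_set env_ideal :: "('x::complex_space \<Rightarrow> 'x \<Rightarrow> 'x) \<Rightarrow> ('x list \<Rightarrow>\<^sub>0 complex) set"
  for br where
  zero: "0 \<in> env_ideal br"
| plus: "s \<in> env_ideal br \<Longrightarrow> t \<in> env_ideal br \<Longrightarrow> s + t \<in> env_ideal br"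
| rel_add: "Poly_Mapping.single (p @ [x + y] @ q) c
    - Poly_Mapping.single (p @ [x] @ q) c - Poly_Mapping.single (p @ [y] @ q) c \<in> env_ideal br"
| rel_scale: "Poly_Mapping.single (p @ [d *\<^sub>C x] @ q) c
    - Poly_Mapping.single (p @ [x] @ q) (c * d) \<in> env_ideal br"
| rel_bracket: "Poly_Mapping.single (p @ [x, y] @ q) c - Poly_Mapping.single (p @ [y, x] @ q) c
    - Poly_Mapping.single (p @ [br x y] @ q) c \<in> env_ideal br"

definition pairing :: "'x wfun \<Rightarrow> ('x list \<Rightarrow>\<^sub>0 complex) \<Rightarrow> complex" where
  "pairing f s = (\<Sum>w\<in>Poly_Mapping.keys s. Poly_Mapping.lookup s w * wval f w)"

text \<open>\<open>\<complex>[[X]] = U(\<xx>)\<^sup>*\<close>, realised as the linear functionals on the free algebra that factor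
  through \<open>U(\<xx>)\<close>.\<close>

definition formal_functions :: "('x::complex_space \<Rightarrow> 'x \<Rightarrow> 'x) \<Rightarrow> 'x wfun set" where
  "formal_functions br = {f. \<forall>s\<in>env_ideal br. pairing f s = 0}"

lemma pairing_superset:
  "finite A \<Longrightarrow> Poly_Mapping.keys s \<subseteq> A \<Longrightarrow>
    pairing f s = (\<Sum>w\<in>A. Poly_Mapping.lookup s w * wval f w)"
  unfolding pairing_def by (rule sum.mono_neutral_left) (auto simp: in_keys_iff)

lemma pairing_add [simp]: "pairing f (s + t) = pairing f s + pairing f t"
proof -
  let ?A = "Poly_Mapping.keys s \<union> Poly_Mapping.keys t"
  have "Poly_Mapping.keys (s + t) \<subseteq> ?A" by (rule Poly_Mapping.keys_add)
  then show ?thesis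
    by (simp add: pairing_superset[of ?A] lookup_add distrib_right sum.distrib)
qed

lemma pairing_single [simp]: "pairing f (Poly_Mapping.single w c) = c * wval f w"
  by (simp add: pairing_superset[of "{w}"])

lemma pairing_diff [simp]: "pairing f (s - t) = pairing f s - pairing f t"
  using pairing_add[of f "s - t" t] by simp

lemma formal_functions_iff:
  "f \<in> formal_functions br \<longleftrightarrow>
    (\<forall>p q x y. wval f (p @ [x + y] @ q) = wval f (p @ [x] @ q) + wval f (p @ [y] @ q)) \<and>
    (\<forall>p q c x. wval f (p @ [c *\<^sub>C x] @ q) = c * wval f (p @ [x] @ q)) \<and>
    (\<forall>p q x y. wval f (p @ [x, y] @ q) - wval f (p @ [y, x] @ q) = wval f (p @ [br x y] @ q))"
  (is "_ \<longleftrightarrow> ?A \<and> ?B \<and> ?C")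
proof
  assume f: "f \<in> formal_functions br"
  then have *: "pairing f s = 0" if "s \<in> env_ideal br" for s
    using that by (auto simp: formal_functions_def)
  have ?A
  proof (intro allI)
    fix p q x y
    show "wval f (p @ [x + y] @ q) = wval f (p @ [x] @ q) + wval f (p @ [y] @ q)"
      using *[OF env_ideal.rel_add[of p x y q 1]]
      by (simp only: pairing_diff pairing_single mult_1 diff_eq_eq add_0 add.commute)
  qed
  moreover have ?B
  proof (intro allI)
    fix p q c x
    show "wval f (p @ [c *\<^sub>C x] @ q) = c * wval f (p @ [x] @ q)"
      using *[OF env_ideal.rel_scale[of p c x q 1]]
      by (simp only: pairing_diff pairing_single mult_1 diff_eq_eq add_0)
  qed
  moreover have ?C
  proof (intro allI)
    fix p q x y
    show "wval f (p @ [x, y] @ q) - wval f (p @ [y, x] @ q) = wval f (p @ [br x y] @ q)"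
      using *[OF env_ideal.rel_bracket[of p x y q 1]]
      by (simp only: pairing_diff pairing_single mult_1 diff_eq_eq add_0)
  qed
  ultimately show "?A \<and> ?B \<and> ?C" by blast
next
  assume *: "?A \<and> ?B \<and> ?C"
  have "pairing f s = 0" if "s \<in> env_ideal br" for s
    using that
  proof induction
    case zero then show ?case by (simp add: pairing_def)
  next
    case (plus s t) then show ?case by simp
  next
    case (rel_add p x y q c)
    have "wval f (p @ [x + y] @ q) = wval f (p @ [x] @ q) + wval f (p @ [y] @ q)"
      using * by blast
    then show ?case by (simp only: pairing_diff pairing_single distrib_left) simp
  next
    case (rel_scale p d x q c)
    have "wval f (p @ [d *\<^sub>C x] @ q) = d * wval f (p @ [x] @ q)" using * by blast
    then show ?case by (simp only: pairing_diff pairing_single mult.assoc) simp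
  next
    case (rel_bracket p x y q c)
    have "wval f (p @ [x, y] @ q) - wval f (p @ [y, x] @ q) = wval f (p @ [br x y] @ q)"
      using * by blast
    then show ?case
      by (simp only: pairing_diff pairing_single flip: right_diff_distrib) simp
  qed
  then show "f \<in> formal_functions br" by (simp add: formal_functions_def)
qed

text \<open>The infinitesimal left and right translations \<open>f(exp(-\<epsilon>\<xi>) x)\<close> and \<open>f(x exp(\<epsilon>\<xi>))\<close>.\<close>

definition Lop :: "'x \<Rightarrow> 'x wfun \<Rightarrow> 'x wfun" where
  "Lop \<xi> f = WFun (\<lambda>w. - wval f (\<xi> # w))"

definition Rop :: "'x \<Rightarrow> 'x wfun \<Rightarrow> 'x wfun" where
  "Rop \<xi> f = WFun (\<lambda>w. wval f (w @ [\<xi>]))"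

lemma Lop_times: "Lop \<xi> (f * g) = Lop \<xi> f * g + f * Lop \<xi> g"
proof -
  have "Lop \<xi> f = - shift \<xi> f" for f :: "'a wfun"
    by (rule wfun_eqI) (simp add: Lop_def)
  then show ?thesis by simp
qed

lemma Rop_times: "Rop \<xi> (f * g) = Rop \<xi> f * g + f * Rop \<xi> g"
proof (rule wfun_eqI)
  have [simp]: "wval (Rop \<xi> f) w = wval f (w @ [\<xi>])" for f w by (simp add: Rop_def)
  have shift: "shift x (Rop \<xi> f) = Rop \<xi> (shift x f)" for x f by (rule wfun_eqI) simp
  fix w show "wval (Rop \<xi> (f * g)) w = wval (Rop \<xi> f * g + f * Rop \<xi> g) w"
  proof (induction w arbitrary: f g)
    case (Cons x w)
    from Cons[of "shift x f" g] Cons[of f "shift x g"] show ?case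
      by (simp add: shift)
  qed simp
qed

text \<open>The pullback of functions along the morphism of formal groups induced by a Lie algebra
  morphism \<open>j\<close>; for an inclusion it is the restriction of functions.\<close>

definition pullback :: "('y \<Rightarrow> 'x) \<Rightarrow> 'x wfun \<Rightarrow> 'y wfun" where
  "pullback j f = WFun (\<lambda>w. wval f (map j w))"

lemma pullback_times: "pullback j (f * g) = pullback j f * pullback j g"
proof (rule wfun_eqI)
  have shift: "shift y (pullback j f) = pullback j (shift (j y) f)" for y f
    by (rule wfun_eqI) (simp add: pullback_def)
  fix w show "wval (pullback j (f * g)) w = wval (pullback j f * pullback j g) w"
    by (induction w arbitrary: f g) (simp_all add: shift, simp_all add: pullback_def)
qed

subsection \<open>Localizations\<close>

text \<open>
  All functions on words form an integral domain containing \<open>\<complex>[[X]]\<close> as a subring, so the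
  localizations \<open>\<complex>[[X]][1/P]\<close> are subrings of its fraction field.  Derivations are extended
  by the quotient rule; a ring morphism \<open>h\<close> extends to the fractions that have a representative
  whose denominator is not killed by \<open>h\<close>.
\<close>

definition localization :: "'r::idom set \<Rightarrow> 'r \<Rightarrow> 'r fract set" where
  "localization R P = {to_fract f / to_fract P ^ n | f n. f \<in> R}"

definition extend_derivation :: "('r::idom \<Rightarrow> 'r) \<Rightarrow> 'r fract \<Rightarrow> 'r fract" where
  "extend_derivation D q = (THE r. \<forall>f g. g \<noteq> 0 \<longrightarrow> q = to_fract f / to_fract g \<longrightarrow>
     r = to_fract (D f * g - f * D g) / to_fract (g * g))"

definition extend_hom :: "('r::idom \<Rightarrow> 's::idom) \<Rightarrow> 'r fract \<Rightarrow> 's fract" where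
  "extend_hom h q = (THE r. \<forall>f g. h g \<noteq> 0 \<longrightarrow> q = to_fract f / to_fract g \<longrightarrow>
     r = to_fract (h f) / to_fract (h g))"

lemma to_fract_divide_eq_iff:
  "b \<noteq> 0 \<Longrightarrow> d \<noteq> 0 \<Longrightarrow>
    to_fract a / to_fract b = to_fract c / to_fract d \<longleftrightarrow> a * d = c * (b :: 'r::idom)"
  by (subst frac_eq_eq)
     (simp_all only: to_fract_eq_0_iff to_fract_mult[symmetric] to_fract_eq_iff not_False_eq_True)

lemma extend_derivation:
  assumes D: "\<And>f g. D (f * g) = D f * g + f * D g" and g: "g \<noteq> 0"
  shows "extend_derivation D (to_fract f / to_fract g) =
    to_fract (D f * g - f * D g) / to_fract (g * g)"
  unfolding extend_derivation_def
proof (rule the_equality)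
  show "\<forall>f' g'. g' \<noteq> 0 \<longrightarrow> to_fract f / to_fract g = to_fract f' / to_fract g' \<longrightarrow>
      to_fract (D f * g - f * D g) / to_fract (g * g)
      = to_fract (D f' * g' - f' * D g') / to_fract (g' * g')"
  proof (intro allI impI)
    fix f' g' assume g': "g' \<noteq> 0" and "to_fract f / to_fract g = to_fract f' / to_fract g'"
    then have eq: "f * g' = f' * g" using g to_fract_divide_eq_iff by blast
    have "D (f * g') = D (f' * g)" by (simp add: eq)
    then have eq': "D f * g' + f * D g' = D f' * g + f' * D g" by (simp add: D)
    have "(D f * g - f * D g) * (g' * g') - (D f' * g' - f' * D g') * (g * g)
      = g * g' * ((D f * g' + f * D g') - (D f' * g + f' * D g))
        - (f * g' - f' * g) * (g * D g' + g' * D g)"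
      by (simp add: algebra_simps)
    also have "\<dots> = 0" by (simp only: eq eq') simp
    finally show "to_fract (D f * g - f * D g) / to_fract (g * g)
      = to_fract (D f' * g' - f' * D g') / to_fract (g' * g')"
      using g g' by (subst to_fract_divide_eq_iff) (simp_all only: mult_eq_0_iff right_minus_eq simp_thms)
  qed
qed (use g in blast)

lemma extend_hom:
  assumes h: "\<And>f g. h (f * g) = h f * h g" "h 0 = 0" and g: "h g \<noteq> 0"
  shows "extend_hom h (to_fract f / to_fract g) = to_fract (h f) / to_fract (h g)"
  unfolding extend_hom_def
proof (rule the_equality)
  show "\<forall>f' g'. h g' \<noteq> 0 \<longrightarrow> to_fract f / to_fract g = to_fract f' / to_fract g' \<longrightarrow>
      to_fract (h f) / to_fract (h g) = to_fract (h f') / to_fract (h g')"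
  proof (intro allI impI)
    fix f' g' assume g': "h g' \<noteq> 0" and eq: "to_fract f / to_fract g = to_fract f' / to_fract g'"
    have "g \<noteq> 0" "g' \<noteq> 0" using g g' h(2) by auto
    then have "f * g' = f' * g" using eq to_fract_divide_eq_iff by blast
    then have "h f * h g' = h f' * h g" by (metis h(1))
    then show "to_fract (h f) / to_fract (h g) = to_fract (h f') / to_fract (h g')"
      using g g' to_fract_divide_eq_iff by blast
  qed
qed (use g in blast)


section \<open>Tensors\<close>

text \<open>
  An element of \<open>V \<otimes> V \<otimes> R\<close> is represented by its coordinates with respect to the basis
  \<open>cbasis\<close> of \<open>V\<close>: the function \<open>t\<close> represents the sum of the \<open>b \<otimes> c \<otimes> t b c\<close>, and vanishes
  outside of \<open>cbasis\<close>.  \<open>pure2 x y r\<close> represents \<open>x \<otimes> y \<otimes> r\<close>.  A linear operation on tensors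
  is defined by its values \<open>F x y r\<close> on the \<open>x \<otimes> y \<otimes> r\<close>; \<open>ext2 F t\<close> is its value on \<open>t\<close>.
\<close>

definition pure1 :: "'a::complex_space \<Rightarrow> 'r::complex_space \<Rightarrow> 'a \<Rightarrow> 'r" where
  "pure1 x r = (\<lambda>b. coord b x *\<^sub>C r)"

definition pure2 :: "'a::complex_space \<Rightarrow> 'a \<Rightarrow> 'r::complex_space \<Rightarrow> 'a \<Rightarrow> 'a \<Rightarrow> 'r" where
  "pure2 x y r = (\<lambda>b c. (coord b x * coord c y) *\<^sub>C r)"

definition pure3 ::
  "'a::complex_space \<Rightarrow> 'a \<Rightarrow> 'a \<Rightarrow> 'r::complex_space \<Rightarrow> 'a \<Rightarrow> 'a \<Rightarrow> 'a \<Rightarrow> 'r" where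
  "pure3 x y z r = (\<lambda>b c d. (coord b x * coord c y * coord d z) *\<^sub>C r)"

definition pure4 ::
  "'a::complex_space \<Rightarrow> 'a \<Rightarrow> 'a \<Rightarrow> 'a \<Rightarrow> 'r::complex_space \<Rightarrow> 'a \<Rightarrow> 'a \<Rightarrow> 'a \<Rightarrow> 'a \<Rightarrow> 'r" where
  "pure4 x y z u r = (\<lambda>b c d e. (coord b x * coord c y * coord d z * coord e u) *\<^sub>C r)"

definition ext2 ::
  "('a \<Rightarrow> 'a \<Rightarrow> 'r \<Rightarrow> 't::comm_monoid_add) \<Rightarrow> ('a::complex_space \<Rightarrow> 'a \<Rightarrow> 'r) \<Rightarrow> 't" where
  "ext2 F t = (\<Sum>b\<in>cbasis. \<Sum>c\<in>cbasis. F b c (t b c))"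

definition ext3 ::
  "('a \<Rightarrow> 'a \<Rightarrow> 'a \<Rightarrow> 'r \<Rightarrow> 't::comm_monoid_add) \<Rightarrow> ('a::complex_space \<Rightarrow> 'a \<Rightarrow> 'a \<Rightarrow> 'r) \<Rightarrow> 't"
  where "ext3 F t = (\<Sum>b\<in>cbasis. \<Sum>c\<in>cbasis. \<Sum>d\<in>cbasis. F b c d (t b c d))"

text \<open>\<open>\<And>\<^sup>2(V) \<otimes> R\<close> and \<open>\<And>\<^sup>3(V) \<otimes> R\<close>, as antisymmetric tensors\<close>

definition wedge2 :: "'r::ab_group_add set \<Rightarrow> ('a::complex_space \<Rightarrow> 'a \<Rightarrow> 'r) set" where
  "wedge2 R = {t. (\<forall>b\<in>cbasis. \<forall>c\<in>cbasis. t b c \<in> R)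
     \<and> (\<forall>b c. b \<notin> cbasis \<or> c \<notin> cbasis \<longrightarrow> t b c = 0)
     \<and> (\<forall>b c. t b c = - t c b)}"

definition wedge3 :: "'r::ab_group_add set \<Rightarrow> ('a::complex_space \<Rightarrow> 'a \<Rightarrow> 'a \<Rightarrow> 'r) set" where
  "wedge3 R = {t. (\<forall>b\<in>cbasis. \<forall>c\<in>cbasis. \<forall>d\<in>cbasis. t b c d \<in> R)
     \<and> (\<forall>b c d. b \<notin> cbasis \<or> c \<notin> cbasis \<or> d \<notin> cbasis \<longrightarrow> t b c d = 0)
     \<and> (\<forall>b c d. t b c d = - t c b d \<and> t b c d = - t b d c)}"

definition tens :: "'a set \<Rightarrow> 'a set \<Rightarrow> ('a::complex_space \<Rightarrow> 'a \<Rightarrow> complex) set" where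
  "tens S T = cvec.span {pure2 x y 1 | x y. x \<in> S \<and> y \<in> T}"

definition tmap2 :: "('a::complex_space \<Rightarrow> 'b::complex_space) \<Rightarrow>
    ('a \<Rightarrow> 'a \<Rightarrow> 'r::complex_space) \<Rightarrow> 'b \<Rightarrow> 'b \<Rightarrow> 'r" where
  "tmap2 f = ext2 (\<lambda>x y r. pure2 (f x) (f y) r)"

text \<open>The action of a map between coefficient rings\<close>

definition cmap2 :: "('r \<Rightarrow> 's) \<Rightarrow> ('a \<Rightarrow> 'a \<Rightarrow> 'r) \<Rightarrow> 'a \<Rightarrow> 'a \<Rightarrow> 's" where
  "cmap2 D t = (\<lambda>b c. D (t b c))"

definition Alt3 :: "('a \<Rightarrow> 'a \<Rightarrow> 'a \<Rightarrow> 'r::ab_group_add) \<Rightarrow> 'a \<Rightarrow> 'a \<Rightarrow> 'a \<Rightarrow> 'r" where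
  "Alt3 t = (\<lambda>b c d. t b c d + t c d b + t d b c)"

text \<open>On 4-tensors, \<open>Alt\<close> is the total antisymmetrization, as in the definition of Lie quasi-bialgebras.\<close>

definition Alt4 :: "('a \<Rightarrow> 'a \<Rightarrow> 'a \<Rightarrow> 'a \<Rightarrow> complex) \<Rightarrow> 'a \<Rightarrow> 'a \<Rightarrow> 'a \<Rightarrow> 'a \<Rightarrow> complex" where
  "Alt4 t = (\<lambda>b0 b1 b2 b3. let b = (!) [b0, b1, b2, b3] in
     \<Sum>p | p permutes {..<4::nat}. of_int (sign p) * t (b (p 0)) (b (p 1)) (b (p 2)) (b (p 3)))"


section \<open>Lie bialgebras\<close>

definition lie_algebra :: "('a::complex_space \<Rightarrow> 'a \<Rightarrow> 'a) \<Rightarrow> bool" where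
  "lie_algebra br \<longleftrightarrow> cbilinear br \<and> (\<forall>x. br x x = 0) \<and>
     (\<forall>x y z. br x (br y z) + br y (br z x) + br z (br x y) = 0)"

definition ad2 :: "('a::complex_space \<Rightarrow> 'a \<Rightarrow> 'a) \<Rightarrow> 'a \<Rightarrow>
    ('a \<Rightarrow> 'a \<Rightarrow> 'r::complex_space) \<Rightarrow> 'a \<Rightarrow> 'a \<Rightarrow> 'r" where
  "ad2 br a = ext2 (\<lambda>x y r. pure2 (br a x) y r + pure2 x (br a y) r)"

definition ad3 :: "('a::complex_space \<Rightarrow> 'a \<Rightarrow> 'a) \<Rightarrow> 'a \<Rightarrow>
    ('a \<Rightarrow> 'a \<Rightarrow> 'a \<Rightarrow> 'r::complex_space) \<Rightarrow> 'a \<Rightarrow> 'a \<Rightarrow> 'a \<Rightarrow> 'r" where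
  "ad3 br a = ext3 (\<lambda>x y z r. pure3 (br a x) y z r + pure3 x (br a y) z r + pure3 x y (br a z) r)"

text \<open>\<open>\<delta> \<otimes> id\<close> on 2-tensors and \<open>\<delta> \<otimes> id \<otimes> id\<close> on 3-tensors\<close>

definition cob2 :: "('a::complex_space \<Rightarrow> 'a \<Rightarrow> 'a \<Rightarrow> complex) \<Rightarrow>
    ('a \<Rightarrow> 'a \<Rightarrow> 'r::complex_space) \<Rightarrow> 'a \<Rightarrow> 'a \<Rightarrow> 'a \<Rightarrow> 'r" where
  "cob2 \<delta> = ext2 (\<lambda>x y r. ext2 (\<lambda>x' x'' s. pure3 x' x'' y (s *\<^sub>C r)) (\<delta> x))"

definition cob3 :: "('a::complex_space \<Rightarrow> 'a \<Rightarrow> 'a \<Rightarrow> complex) \<Rightarrow>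
    ('a \<Rightarrow> 'a \<Rightarrow> 'a \<Rightarrow> 'r::complex_space) \<Rightarrow> 'a \<Rightarrow> 'a \<Rightarrow> 'a \<Rightarrow> 'a \<Rightarrow> 'r" where
  "cob3 \<delta> = ext3 (\<lambda>x y z r. ext2 (\<lambda>x' x'' s. pure4 x' x'' y z (s *\<^sub>C r)) (\<delta> x))"

definition lie_bialgebra ::
  "('a::fd_complex_space \<Rightarrow> 'a \<Rightarrow> 'a) \<Rightarrow> ('a \<Rightarrow> 'a \<Rightarrow> 'a \<Rightarrow> complex) \<Rightarrow> bool" where
  "lie_bialgebra br \<delta> \<longleftrightarrow> lie_algebra br \<and> clinear \<delta> \<and> (\<forall>x. \<delta> x \<in> wedge2 UNIV) \<and>
     (\<forall>x. Alt3 (cob2 \<delta> (\<delta> x)) = 0) \<and>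
     (\<forall>x y. \<delta> (br x y) = ad2 br x (\<delta> y) - ad2 br y (\<delta> x))"

text \<open>Inclusions of Lie bialgebras (in particular of Lie subbialgebras) are rendered as injective
  morphisms.\<close>

definition lie_bialgebra_inclusion ::
  "('h::fd_complex_space \<Rightarrow> 'h \<Rightarrow> 'h) \<Rightarrow> ('h \<Rightarrow> 'h \<Rightarrow> 'h \<Rightarrow> complex) \<Rightarrow>
   ('a::fd_complex_space \<Rightarrow> 'a \<Rightarrow> 'a) \<Rightarrow> ('a \<Rightarrow> 'a \<Rightarrow> 'a \<Rightarrow> complex) \<Rightarrow> ('h \<Rightarrow> 'a) \<Rightarrow> bool" where
  "lie_bialgebra_inclusion br\<^sub>h \<delta>\<^sub>h br \<delta> \<iota> \<longleftrightarrow>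
     lie_bialgebra br\<^sub>h \<delta>\<^sub>h \<and> lie_bialgebra br \<delta> \<and> clinear \<iota> \<and> inj \<iota> \<and>
     (\<forall>x y. \<iota> (br\<^sub>h x y) = br (\<iota> x) (\<iota> y)) \<and> (\<forall>x. \<delta> (\<iota> x) = tmap2 \<iota> (\<delta>\<^sub>h x))"

subsection \<open>The double and the dressing action\<close>

definition dual_bracket :: "('h::complex_space \<Rightarrow> 'h \<Rightarrow> 'h \<Rightarrow> complex) \<Rightarrow>
    'h cdual \<Rightarrow> 'h cdual \<Rightarrow> 'h cdual" where
  "dual_bracket \<delta> \<phi> \<psi> = Cd (\<lambda>x. ext2 (\<lambda>y z s. s * cd_app \<phi> y * cd_app \<psi> z) (\<delta> x))"

definition double_pairing :: "'h \<times> 'h cdual \<Rightarrow> 'h \<times> 'h::complex_space cdual \<Rightarrow> complex" where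
  "double_pairing = (\<lambda>(x, \<xi>) (y, \<eta>). cd_app \<xi> y + cd_app \<eta> x)"

text \<open>
  The brackets of \<open>x\<close> in the Lie bialgebra with \<open>\<eta>\<close> in its dual are forced by the invariance of
  the pairing: \<open>[x, \<eta>] = (\<eta> \<otimes> id)(\<delta> x) - \<eta> \<circ> ad x\<close>.
\<close>

definition contract :: "('h::complex_space \<Rightarrow> 'h \<Rightarrow> 'h \<Rightarrow> complex) \<Rightarrow> 'h cdual \<Rightarrow> 'h \<Rightarrow> 'h" where
  "contract \<delta> \<eta> x = ext2 (\<lambda>y z s. (s * cd_app \<eta> y) *\<^sub>C z) (\<delta> x)"

definition double_bracket ::
  "('h::complex_space \<Rightarrow> 'h \<Rightarrow> 'h) \<Rightarrow> ('h \<Rightarrow> 'h \<Rightarrow> 'h \<Rightarrow> complex) \<Rightarrow>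
   'h \<times> 'h cdual \<Rightarrow> 'h \<times> 'h cdual \<Rightarrow> 'h \<times> 'h cdual" where
  "double_bracket br \<delta> = (\<lambda>(x, \<xi>) (y, \<eta>).
     (br x y + contract \<delta> \<eta> x - contract \<delta> \<xi> y,
      dual_bracket \<delta> \<xi> \<eta> - precomp (br x) \<eta> + precomp (br y) \<xi>))"

lemma cd_app_linear:
  "cd_app \<phi> 0 = 0" "cd_app \<phi> (x + y) = cd_app \<phi> x + cd_app \<phi> y"
  "cd_app \<phi> (x - y) = cd_app \<phi> x - cd_app \<phi> y" "cd_app \<phi> (c *\<^sub>C x) = c * cd_app \<phi> x"
  "cd_app \<phi> (sum f A) = (\<Sum>a\<in>A. cd_app \<phi> (f a))"
proof -
  interpret module_hom "(*\<^sub>C)" "(*\<^sub>C)" "cd_app \<phi>"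
    using cd_app[of \<phi>] by (simp add: Vector_Spaces.linear_iff_module_hom)
  show "cd_app \<phi> 0 = 0" "cd_app \<phi> (x + y) = cd_app \<phi> x + cd_app \<phi> y"
    "cd_app \<phi> (x - y) = cd_app \<phi> x - cd_app \<phi> y" "cd_app \<phi> (c *\<^sub>C x) = c * cd_app \<phi> x"
    "cd_app \<phi> (sum f A) = (\<Sum>a\<in>A. cd_app \<phi> (f a))"
    by (simp_all add: zero add diff scale sum cscale_complex_def)
qed

lemma cd_app_dual_bracket:
  assumes "clinear \<delta>"
  shows "cd_app (dual_bracket \<delta> \<phi> \<psi>) x =
    (\<Sum>b\<in>cbasis. \<Sum>c\<in>cbasis. \<delta> x b c * cd_app \<phi> b * cd_app \<psi> c)"
  using assms unfolding dual_bracket_def ext2_def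
  by (subst Cd_inverse)
     (auto simp: clinear_iff cscale_fun_def cscale_complex_def sum.distrib distrib_right
        sum_distrib_left mult.assoc)

lemma cd_app_precomp: "clinear f \<Longrightarrow> cd_app (precomp f \<phi>) x = cd_app \<phi> (f x)"
  unfolding precomp_def by (subst Cd_inverse) (auto simp: clinear_iff cd_app_linear cscale_complex_def)

lemma double_pairing_invariant:
  assumes "lie_bialgebra br \<delta>"
  shows "double_pairing (double_bracket br \<delta> p q) r = double_pairing p (double_bracket br \<delta> q r)"
proof -
  obtain x \<xi> y \<eta> z \<zeta> where pqr: "p = (x, \<xi>)" "q = (y, \<eta>)" "r = (z, \<zeta>)"
    by (metis surj_pair)
  have \<delta>: "clinear \<delta>" and br: "clinear (br x)" for x
    using assms by (auto simp: lie_bialgebra_def lie_algebra_def cbilinear_def)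
  have anti: "\<delta> x b c = - \<delta> x c b" for x b c
    using assms unfolding lie_bialgebra_def wedge2_def mem_Collect_eq by blast
  have alt: "br x x = 0" for x using assms by (auto simp: lie_bialgebra_def lie_algebra_def)
  have br': "br (x + y) z = br x z + br y z" "br z (x + y) = br z x + br z y" for x y z
    using assms by (auto simp: lie_bialgebra_def lie_algebra_def cbilinear_def clinear_iff)
  have skew: "br x y = - br y x" for x y
    using alt[of "x + y"]
    by (simp only: br' alt[of x] alt[of y] add_0_left add_0_right eq_neg_iff_add_eq_0 add.commute)
  have app: "cd_app (\<phi> + \<psi>) v = cd_app \<phi> v + cd_app \<psi> v"
    "cd_app (\<phi> - \<psi>) v = cd_app \<phi> v - cd_app \<psi> v" for \<phi> \<psi> :: "'a cdual" and v
    by (transfer; simp)+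
  have contr: "cd_app \<phi> (contract \<delta> \<psi> v) = cd_app (dual_bracket \<delta> \<psi> \<phi>) v" for \<phi> \<psi> v
    by (simp add: contract_def ext2_def cd_app_dual_bracket[OF \<delta>] cd_app_linear)
  have dskew: "cd_app (dual_bracket \<delta> \<psi> \<phi>) v = - cd_app (dual_bracket \<delta> \<phi> \<psi>) v" for \<phi> \<psi> v
  proof -
    have "cd_app (dual_bracket \<delta> \<psi> \<phi>) v =
      (\<Sum>b\<in>cbasis. \<Sum>c\<in>cbasis. - (\<delta> v c b * cd_app \<phi> c * cd_app \<psi> b))"
      unfolding cd_app_dual_bracket[OF \<delta>]
      by (intro sum.cong refl) (subst anti, simp)
    also have "\<dots> = (\<Sum>c\<in>cbasis. \<Sum>b\<in>cbasis. - (\<delta> v c b * cd_app \<phi> c * cd_app \<psi> b))"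
      by (rule sum.swap)
    finally show ?thesis by (simp add: cd_app_dual_bracket[OF \<delta>] sum_negf)
  qed
  have neg: "cd_app \<phi> (- v) = - cd_app \<phi> v" for \<phi> v
    using cd_app_linear(3)[of \<phi> 0 v] by (simp add: cd_app_linear(1))
  show ?thesis
    unfolding pqr double_pairing_def double_bracket_def
    using skew[of y x] skew[of z x] dskew[of \<xi> \<zeta> y] dskew[of \<eta> \<xi> z]
    by (simp add: app contr cd_app_linear cd_app_precomp[OF br] neg)
qed

text \<open>
  For \<open>z\<close> in the double, \<open>Ad(x\<^sup>-\<^sup>1)(z)\<close> is a function of \<open>x\<close> in the formal group of the dual,
  with values in the double.  Its value on a word \<open>[\<xi>\<^sub>1, \<dots>, \<xi>\<^sub>n]\<close>, i.e. on
  \<open>\<xi>\<^sub>1 \<cdots> \<xi>\<^sub>n\<close> in the enveloping algebra, is the action of the antipode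
  \<open>(-\<xi>\<^sub>n) \<cdots> (-\<xi>\<^sub>1)\<close> on \<open>z\<close>.
\<close>

definition Ad_inv ::
  "('h::complex_space \<Rightarrow> 'h \<Rightarrow> 'h) \<Rightarrow> ('h \<Rightarrow> 'h \<Rightarrow> 'h \<Rightarrow> complex) \<Rightarrow>
   'h \<times> 'h cdual \<Rightarrow> 'h cdual list \<Rightarrow> 'h \<times> 'h cdual" where
  "Ad_inv br \<delta> z w = fold (\<lambda>\<xi> v. - double_bracket br \<delta> (0, \<xi>) v) w z"

text \<open>The vector field \<open>R\<close> along \<open>\<Sum>\<^sub>e \<epsilon>\<^sup>e \<otimes> \<phi>\<^sub>e\<close> is \<open>\<Sum>\<^sub>e \<phi>\<^sub>e R(\<epsilon>\<^sup>e)\<close>; here \<open>\<phi>\<^sub>e\<close> is the value on \<open>e\<close>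
  of the component of \<open>Ad(x\<^sup>-\<^sup>1)(a)\<close> in the dual.\<close>

definition dress ::
  "('h::complex_space \<Rightarrow> 'h \<Rightarrow> 'h) \<Rightarrow> ('h \<Rightarrow> 'h \<Rightarrow> 'h \<Rightarrow> complex) \<Rightarrow>
   'h \<Rightarrow> 'h cdual wfun \<Rightarrow> 'h cdual wfun" where
  "dress br \<delta> a f =
     - (\<Sum>e\<in>cbasis. WFun (\<lambda>w. cd_app (snd (Ad_inv br \<delta> (a, 0) w)) e) * Rop (dual_basis e) f)"

lemma dress_times: "dress br \<delta> a (f * g) = dress br \<delta> a f * g + f * dress br \<delta> a g"
proof -
  have "- (\<Sum>e\<in>A. F e * (r e * g + f * r' e)) = - (\<Sum>e\<in>A. F e * r e) * g + f * - (\<Sum>e\<in>A. F e * r' e)"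
    for A :: "'a set" and F r r' :: "'a \<Rightarrow> 'a cdual wfun"
    by (induction A rule: infinite_finite_induct) (simp_all add: algebra_simps)
  then show ?thesis by (simp only: dress_def Rop_times)
qed


section \<open>Poisson-Lie dynamical r-matrices\<close>

definition CYB :: "('a::complex_space \<Rightarrow> 'a \<Rightarrow> 'a) \<Rightarrow>
    ('a \<Rightarrow> 'a \<Rightarrow> 'r::{complex_space, times}) \<Rightarrow> 'a \<Rightarrow> 'a \<Rightarrow> 'a \<Rightarrow> 'r" where
  "CYB br \<rho> = ext2 (\<lambda>x y r. ext2 (\<lambda>x' y' r'.
     pure3 (br x x') y y' (r * r') + pure3 x (br y x') y' (r * r') + pure3 x x' (br y y') (r * r'))
     \<rho>) \<rho>"

text \<open>\<open>\<iota>\<close> is the inclusion of the Lie bialgebra \<open>'h\<close> in \<open>'a\<close>.\<close>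

definition dL :: "('h::complex_space \<Rightarrow> 'a::complex_space) \<Rightarrow>
    ('a \<Rightarrow> 'a \<Rightarrow> 'h cdual wfun fract) \<Rightarrow> 'a \<Rightarrow> 'a \<Rightarrow> 'a \<Rightarrow> 'h cdual wfun fract" where
  "dL \<iota> = ext2 (\<lambda>x y r. - (\<Sum>e\<in>cbasis.
     pure3 x y (\<iota> e) (extend_derivation (Lop (dual_basis e)) r)))"

definition pl_dynamical_r_matrix ::
  "('h::fd_complex_space \<Rightarrow> 'h \<Rightarrow> 'h) \<Rightarrow> ('h \<Rightarrow> 'h \<Rightarrow> 'h \<Rightarrow> complex) \<Rightarrow>
   ('a::fd_complex_space \<Rightarrow> 'a \<Rightarrow> 'a) \<Rightarrow> ('a \<Rightarrow> 'a \<Rightarrow> 'a \<Rightarrow> complex) \<Rightarrow> ('h \<Rightarrow> 'a) \<Rightarrow>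
   ('a \<Rightarrow> 'a \<Rightarrow> 'a \<Rightarrow> complex) \<Rightarrow> ('a \<Rightarrow> 'a \<Rightarrow> 'h cdual wfun fract) \<Rightarrow> bool" where
  "pl_dynamical_r_matrix br\<^sub>h \<delta>\<^sub>h br \<delta> \<iota> Z \<rho> \<longleftrightarrow>
     (\<exists>P\<in>formal_functions (dual_bracket \<delta>\<^sub>h). P \<noteq> 0 \<and>
        \<rho> \<in> wedge2 (localization (formal_functions (dual_bracket \<delta>\<^sub>h)) P)) \<and>
     (\<forall>a. cmap2 (extend_derivation (dress br\<^sub>h \<delta>\<^sub>h a)) \<rho> + ad2 br (\<iota> a) \<rho> = 0) \<and>
     CYB br \<rho> + Alt3 (dL \<iota> \<rho>) + Alt3 (cob2 \<delta> \<rho>) = (\<lambda>b c d. Z b c d *\<^sub>C 1)"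


section \<open>Splittings\<close>

text \<open>\<open>\<gg> = \<ll> \<oplus> \<uu>\<close>, with \<open>il\<close> and \<open>iu\<close> the inclusions of \<open>\<ll>\<close> and \<open>\<uu>\<close> in \<open>\<gg>\<close>\<close>

definition lie_bialgebra_splitting ::
  "('g::fd_complex_space \<Rightarrow> 'g \<Rightarrow> 'g) \<Rightarrow> ('g \<Rightarrow> 'g \<Rightarrow> 'g \<Rightarrow> complex) \<Rightarrow>
   ('l::fd_complex_space \<Rightarrow> 'l \<Rightarrow> 'l) \<Rightarrow> ('l \<Rightarrow> 'l \<Rightarrow> 'l \<Rightarrow> complex) \<Rightarrow>
   ('l \<Rightarrow> 'g) \<Rightarrow> ('u::fd_complex_space \<Rightarrow> 'g) \<Rightarrow> bool" where
  "lie_bialgebra_splitting br \<delta> br\<^sub>l \<delta>\<^sub>l il iu \<longleftrightarrow>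
     lie_bialgebra_inclusion br\<^sub>l \<delta>\<^sub>l br \<delta> il \<and> clinear iu \<and> inj iu \<and>
     (\<forall>z. \<exists>!(y, u). z = il y + iu u) \<and>
     (\<forall>y u. br (il y) (iu u) \<in> range iu) \<and>
     (\<forall>u. \<delta> (iu u) \<in> {r + s + t | r s t. r \<in> tens (range il) (range iu) \<and>
        s \<in> tens (range iu) (range il) \<and> t \<in> tens (range iu) (range iu)})"

definition proj_l :: "('l \<Rightarrow> 'g) \<Rightarrow> ('u \<Rightarrow> 'g) \<Rightarrow> 'g::plus \<Rightarrow> 'l" where
  "proj_l il iu z = (THE y. \<exists>u. z = il y + iu u)"

text \<open>The inclusion of \<open>\<ll>\<^sup>*\<close> in \<open>\<gg>\<^sup>*\<close> given by the decomposition \<open>\<gg> = \<ll> \<oplus> \<uu>\<close>\<close>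

definition incl_dual :: "('l \<Rightarrow> 'g) \<Rightarrow> ('u \<Rightarrow> 'g) \<Rightarrow>
    'l::complex_space cdual \<Rightarrow> 'g::complex_space cdual" where
  "incl_dual il iu = precomp (proj_l il iu)"

inductive_set polynomial_functions :: "('v::complex_space \<Rightarrow> complex) set" where
  const: "(\<lambda>_. c) \<in> polynomial_functions"
| linear: "clinear f \<Longrightarrow> f \<in> polynomial_functions"
| add: "f \<in> polynomial_functions \<Longrightarrow> g \<in> polynomial_functions \<Longrightarrow>
    (\<lambda>v. f v + g v) \<in> polynomial_functions"
| mult: "f \<in> polynomial_functions \<Longrightarrow> g \<in> polynomial_functions \<Longrightarrow>
    (\<lambda>v. f v * g v) \<in> polynomial_functions"

text \<open>\<open>Q\<close> holds on a nonempty Zariski open subset.\<close>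

definition for_generic :: "('v::complex_space \<Rightarrow> bool) \<Rightarrow> bool" where
  "for_generic Q \<longleftrightarrow>
     (\<exists>p\<in>polynomial_functions. (\<exists>v. p v \<noteq> 0) \<and> (\<forall>v. p v \<noteq> 0 \<longrightarrow> Q v))"

definition nondegenerate_splitting ::
  "('g::complex_space \<Rightarrow> 'g \<Rightarrow> 'g) \<Rightarrow> ('l::complex_space \<Rightarrow> 'g) \<Rightarrow> ('u::zero \<Rightarrow> 'g) \<Rightarrow> bool" where
  "nondegenerate_splitting br il iu \<longleftrightarrow>
     for_generic (\<lambda>\<phi>. \<forall>u. (\<forall>v. cd_app \<phi> (proj_l il iu (br (iu u) (iu v))) = 0) \<longrightarrow> u = 0)"


subsection \<open>The element sigma\<close>

text \<open>The pairing of the two components of \<open>Ad(x\<^sup>-\<^sup>1)\<close> is expanded in a basis of \<open>\<gg>\<close> and its dual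
  basis; \<open>x\<close> runs through the subgroup \<open>L\<^sup>*\<close>, i.e. words in \<open>\<ll>\<^sup>*\<close> are mapped to words in \<open>\<gg>\<^sup>*\<close>.\<close>

definition omega ::
  "('g::complex_space \<Rightarrow> 'g \<Rightarrow> 'g) \<Rightarrow> ('g \<Rightarrow> 'g \<Rightarrow> 'g \<Rightarrow> complex) \<Rightarrow>
   ('l::complex_space \<Rightarrow> 'g) \<Rightarrow> ('u \<Rightarrow> 'g) \<Rightarrow> 'u \<Rightarrow> 'u \<Rightarrow> 'l cdual wfun" where
  "omega br \<delta> il iu u v =
     (let Ad = (\<lambda>u w. Ad_inv br \<delta> (iu u, 0) (map (incl_dual il iu) w)) in
      \<Sum>b\<in>cbasis. WFun (\<lambda>w. coord b (fst (Ad u w))) * WFun (\<lambda>w. cd_app (snd (Ad v w)) b))"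

text \<open>\<open>a_endo \<dots> i u\<close> is \<open>a(x)(u)\<close>, an element of \<open>\<uu> \<otimes> \<complex>[[L\<^sup>*]]\<close>, where \<open>i\<close> is the chosen
  isomorphism of \<open>\<uu>\<close> with its dual; \<open>P_det\<close> is the determinant of its matrix.\<close>

definition a_endo ::
  "('g::complex_space \<Rightarrow> 'g \<Rightarrow> 'g) \<Rightarrow> ('g \<Rightarrow> 'g \<Rightarrow> 'g \<Rightarrow> complex) \<Rightarrow>
   ('l::complex_space \<Rightarrow> 'g) \<Rightarrow> ('u \<Rightarrow> 'g) \<Rightarrow> ('u \<Rightarrow> 'u cdual) \<Rightarrow>
   'u \<Rightarrow> 'u::complex_space \<Rightarrow> 'l cdual wfun" where
  "a_endo br \<delta> il iu i u =
     (\<Sum>e\<in>cbasis. pure1 (inv_into UNIV i (dual_basis e)) (omega br \<delta> il iu u e))"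

definition P_det ::
  "('g::complex_space \<Rightarrow> 'g \<Rightarrow> 'g) \<Rightarrow> ('g \<Rightarrow> 'g \<Rightarrow> 'g \<Rightarrow> complex) \<Rightarrow>
   ('l::complex_space \<Rightarrow> 'g) \<Rightarrow> ('u::complex_space \<Rightarrow> 'g) \<Rightarrow> ('u \<Rightarrow> 'u cdual) \<Rightarrow> 'l cdual wfun" where
  "P_det br \<delta> il iu i =
     (let es = (SOME es. distinct es \<and> set es = cbasis); n = length es in
      det (mat n n (\<lambda>(r, c). a_endo br \<delta> il iu i (es ! c) (es ! r))))"

definition sigma ::
  "('g::complex_space \<Rightarrow> 'g \<Rightarrow> 'g) \<Rightarrow> ('g \<Rightarrow> 'g \<Rightarrow> 'g \<Rightarrow> complex) \<Rightarrow>
   ('l \<Rightarrow> 'l \<Rightarrow> 'l \<Rightarrow> complex) \<Rightarrow> ('l::complex_space \<Rightarrow> 'g) \<Rightarrow> ('u::complex_space \<Rightarrow> 'g) \<Rightarrow>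
   ('u \<Rightarrow> 'u cdual) \<Rightarrow> 'u \<Rightarrow> 'u \<Rightarrow> 'l cdual wfun fract" where
  "sigma br \<delta> \<delta>\<^sub>l il iu i = (THE \<sigma>.
     \<sigma> \<in> wedge2 (localization (formal_functions (dual_bracket \<delta>\<^sub>l)) (P_det br \<delta> il iu i)) \<and>
     (\<forall>v. ext2 (\<lambda>a b l. pure1 a (to_fract (omega br \<delta> il iu v b) * l)) \<sigma> = pure1 v 1))"

subsection \<open>Restriction to the subgroup\<close>

definition restriction_defined ::
  "('g \<Rightarrow> 'g \<Rightarrow> 'g \<Rightarrow> complex) \<Rightarrow> ('l::complex_space \<Rightarrow> 'g) \<Rightarrow> ('u \<Rightarrow> 'g) \<Rightarrow>
   ('a::complex_space \<Rightarrow> 'a \<Rightarrow> 'g::complex_space cdual wfun fract) \<Rightarrow> bool" where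
  "restriction_defined \<delta> il iu \<rho> \<longleftrightarrow> (\<exists>P\<in>formal_functions (dual_bracket \<delta>).
     pullback (incl_dual il iu) P \<noteq> 0 \<and>
     \<rho> \<in> wedge2 (localization (formal_functions (dual_bracket \<delta>)) P))"

definition restrict_L ::
  "('l::complex_space \<Rightarrow> 'g) \<Rightarrow> ('u \<Rightarrow> 'g) \<Rightarrow>
   ('a \<Rightarrow> 'a \<Rightarrow> 'g::complex_space cdual wfun fract) \<Rightarrow> 'a \<Rightarrow> 'a \<Rightarrow> 'l cdual wfun fract" where
  "restrict_L il iu = cmap2 (extend_hom (pullback (incl_dual il iu)))"

end

theory Submission
  imports Defs
begin

text \<open>
  The theorem is a statement about the double \<open>\<dd> = \<gg> \<oplus> \<gg>\<^sup>*\<close> and the adjoint action of \<open>L\<^sup>*\<close> on it.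
  For \<open>x\<close> in \<open>L\<^sup>*\<close> the operator \<open>Ad(x\<^sup>-\<^sup>1)\<close> preserves the pairing and the invariant trilinear form
  of \<open>\<dd>\<close>, the subalgebra \<open>\<ll> \<oplus> \<ll>\<^sup>*\<close> and its orthogonal \<open>\<uu> \<oplus> \<uu>\<^sup>*\<close>.  The element \<open>\<sigma>\<close>, viewed as a map
  \<open>\<uu>\<^sup>* \<rightarrow> \<uu>\<close>, is characterized by the fact that the elements \<open>\<xi> - \<sigma>(\<xi>)\<close>, with \<open>\<xi>\<close> in \<open>\<uu>\<^sup>*\<close>,
  are mapped to \<open>\<gg>\<close> by \<open>Ad(x\<^sup>-\<^sup>1)\<close> (\<open>X_AdH_zero\<close>); their span is \<open>Ad(x)(\<uu>)\<close>.  Three consequences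
  give the theorem.

  First, \<open>\<gg>\<close> is an isotropic subalgebra of the double, so that the trilinear form vanishes on
  these elements (\<open>X_trilinear_zero\<close>).  Expanding it gives the component of the dynamical
  Yang-Baxter equation of \<open>\<sigma>\<close> in \<open>\<uu> \<otimes> \<uu> \<otimes> \<uu>\<close>, which contains no derivative.

  Secondly, the subspace \<open>Ad(x)(\<uu>)\<close> moves in a known way when \<open>x\<close> is translated from the left or
  along a dressing field.  This determines the derivatives of \<open>\<sigma>\<close> (\<open>Lop_\<sigma>\<close>, \<open>dress_\<sigma>\<close>).  The
  former give the components of the Yang-Baxter equation with one leg in \<open>\<ll>\<close>; hence \<open>\<sigma>\<close> solves the
  equation with right hand side 0 (\<open>dynamical_yang_baxter_\<tau>\<close>).  The latter say that
  \<open>\<sigma>\<close> is equivariant under \<open>\<ll>\<close> (\<open>equivariant_\<tau>\<close>).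

  Thirdly, a left translation of a function \<open>f\<close> on \<open>G\<^sup>*\<close> in the direction \<open>\<xi>\<close> is, up to the sign, the
  right translation along \<open>Ad(x\<^sup>-\<^sup>1)(\<xi>)\<close>, and the dressing field of \<open>a\<close> is, up to the same sign, the
  right translation along the dual part of \<open>Ad(x\<^sup>-\<^sup>1)(a)\<close>.  As the dual part
  of \<open>Ad(x\<^sup>-\<^sup>1)(\<xi> - \<sigma>(\<xi>))\<close> vanishes, the derivative of \<open>f\<close> in a direction \<open>\<xi>\<close> transversal to \<open>L\<^sup>*\<close> is
  the derivative along the dressing field of \<open>\<sigma>(\<xi>)\<close> (\<open>restrict_Lop_uincl\<close>).  If \<open>f\<close> is a component
  of \<open>\<rho>\<close>, then the latter is given by the equivariance of \<open>\<rho>\<close>.  So restricting the Yang-Baxter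
  equation of \<open>\<rho>\<close> to \<open>L\<^sup>*\<close> replaces the transversal derivatives by terms in which one leg of
  \<open>\<sigma>\<close> acts on \<open>\<rho>\<close> (\<open>frestrict_dL\<close>), and these are exactly the bracket terms between \<open>\<rho>\<close> and \<open>\<sigma>\<close>
  in the equation for the sum (\<open>cyb_cross_terms\<close>).

  Moreover, \<open>\<sigma>\<close> exists and is unique since the lowest term of the determinant of \<open>\<omega>\<close> is the determinant of
  the form \<open>\<nu>([u, v]\<^sub>\<ll>)\<close> for \<open>\<nu>\<close> in \<open>\<ll>\<^sup>*\<close>, which is nondegenerate for a generic \<open>\<nu>\<close> (\<open>P_nonzero\<close>).

  Group elements do not occur in the formal proofs.  A function on the formal group is a function on
  words, its shifts by a letter are its left derivatives, and identities between functions are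
  proved by induction on words: they hold at the empty word, and their derivatives are identities of
  the same form.
\<close>


section \<open>Complex algebras, coordinates and linear expansions\<close>

instance fract :: (complex_idom) complex_idom
  by standard (simp add: cscale_fract_def mult.assoc)

instantiation prod :: (complex_space, complex_space) complex_space
begin
definition "c *\<^sub>C (z :: 'a \<times> 'b) = (c *\<^sub>C fst z, c *\<^sub>C snd z)"
instance
  by standard (auto simp: cscale_prod_def prod_eq_iff cscale_add_right cscale_add_left
      cscale_cscale cscale_one)
end

lemma cscale_Pair [simp]: "c *\<^sub>C (x, y) = (c *\<^sub>C x, c *\<^sub>C y)"
  by (simp add: cscale_prod_def)

lemma fst_cscale [simp]: "fst (c *\<^sub>C z) = c *\<^sub>C fst z"
  and snd_cscale [simp]: "snd (c *\<^sub>C z) = c *\<^sub>C snd z"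
  by (simp_all add: cscale_prod_def)

lemma cscale_mult_right: "x * (c *\<^sub>C y) = c *\<^sub>C (x * (y :: 'r::complex_idom))"
  by (metis mult.commute cscale_mult_left)

lemma cscale_fun_apply [simp]: "(c *\<^sub>C f) x = c *\<^sub>C f x"
  by (simp add: cscale_fun_def)

lemma cscale_complex [simp]: "c *\<^sub>C (z::complex) = c * z"
  by (simp add: cscale_complex_def)

lemma to_fract_cscale: "to_fract (c *\<^sub>C (x::'r::complex_idom)) = c *\<^sub>C to_fract x"
  by (simp add: cscale_fract_def cscale_mult_left flip: to_fract_mult)

lemma to_fract_sum: "to_fract (\<Sum>a\<in>A. f a) = (\<Sum>a\<in>A. to_fract (f a))"
  by (induction A rule: infinite_finite_induct) simp_all

lemma clinear_add: "clinear f \<Longrightarrow> f (x + y) = f x + f y"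
  and clinear_scale: "clinear f \<Longrightarrow> f (c *\<^sub>C x) = c *\<^sub>C f x"
  by (simp_all add: clinear_iff)

lemma clinear_zero: "clinear f \<Longrightarrow> f 0 = 0"
  using clinear_scale[of f 0 0] by simp

lemma clinear_neg: "clinear f \<Longrightarrow> f (- x) = - f x"
  using clinear_scale[of f "-1" x] by simp

lemma clinear_diff: "clinear f \<Longrightarrow> f (x - y) = f x - f y"
  using clinear_add[of f x "- y"] by (simp add: clinear_neg)

lemma clinear_sum: "clinear f \<Longrightarrow> f (\<Sum>a\<in>A. g a) = (\<Sum>a\<in>A. f (g a))"
  by (induction A rule: infinite_finite_induct) (simp_all add: clinear_zero clinear_add)

lemma clinearI:
  "(\<And>x y. f (x + y) = f x + f y) \<Longrightarrow> (\<And>c x. f (c *\<^sub>C x) = c *\<^sub>C f x) \<Longrightarrow> clinear f"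
  by (simp add: clinear_iff)

lemma clinear_compose: "clinear f \<Longrightarrow> clinear g \<Longrightarrow> clinear (\<lambda>x. f (g x))"
  by (simp add: clinear_iff)

lemma clinear_coord: "clinear (coord b :: 'a::complex_space \<Rightarrow> complex)"
  by (rule clinearI)
     (simp_all add: coord_def cvec.representation_add cvec.representation_scale cbasis)

lemma coord_outside: "b \<notin> cbasis \<Longrightarrow> coord b x = 0"
  unfolding coord_def by (meson cvec.representation_ne_zero)

lemma coord_cbasis: "b \<in> cbasis \<Longrightarrow> coord c b = (if c = b then 1 else 0)"
  by (simp add: coord_def cvec.representation_basis cbasis)

lemma coord_expand: "(\<Sum>b\<in>cbasis. coord b x *\<^sub>C b) = (x :: 'a::fd_complex_space)"
  unfolding coord_def
  by (rule cvec.sum_representation_eq) (simp_all add: cbasis finite_cbasis)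

lemma clinear_expand:
  fixes f :: "'a::fd_complex_space \<Rightarrow> 'b::complex_space"
  assumes "clinear f" shows "f x = (\<Sum>b\<in>cbasis. coord b x *\<^sub>C f b)"
  by (subst coord_expand[of x, symmetric])
     (simp add: clinear_sum[OF assms] clinear_scale[OF assms])

lemma cd_app_dual_basis [simp]: "cd_app (dual_basis b) x = coord b x"
  unfolding dual_basis_def by (subst Cd_inverse) (simp_all add: clinear_coord)

lemma cd_app_add [simp]: "cd_app (\<phi> + \<psi>) x = cd_app \<phi> x + cd_app \<psi> x"
  and cd_app_diff [simp]: "cd_app (\<phi> - \<psi>) x = cd_app \<phi> x - cd_app \<psi> x"
  and cd_app_neg [simp]: "cd_app (- \<phi>) x = - cd_app \<phi> x"
  and cd_app_zero [simp]: "cd_app 0 x = 0"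
  and cd_app_scale [simp]: "cd_app (c *\<^sub>C \<phi>) x = c * cd_app \<phi> x"
  by (transfer; simp)+

lemma cd_app_sum [simp]: "cd_app (\<Sum>a\<in>A. f a) x = (\<Sum>a\<in>A. cd_app (f a) x)"
  by (induction A rule: infinite_finite_induct) simp_all

lemma cd_eqI: "(\<And>x. cd_app \<phi> x = cd_app \<psi> x) \<Longrightarrow> \<phi> = \<psi>"
  by (metis cd_app_inverse ext)

lemma clinear_cd_app: "clinear (cd_app \<phi>)"
  using cd_app[of \<phi>] by simp

lemma cd_expand: "(\<Sum>b\<in>cbasis. cd_app \<phi> b *\<^sub>C dual_basis b) = (\<phi> :: 'a::fd_complex_space cdual)"
proof (rule cd_eqI)
  fix x show "cd_app (\<Sum>b\<in>cbasis. cd_app \<phi> b *\<^sub>C dual_basis b) x = cd_app \<phi> x"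
    by (subst clinear_expand[OF clinear_cd_app, of \<phi> x]) (simp add: mult.commute)
qed

lemma cdual_clinear_expand:
  fixes f :: "'a::fd_complex_space cdual \<Rightarrow> 'b::complex_space"
  assumes "clinear f" shows "f \<phi> = (\<Sum>b\<in>cbasis. cd_app \<phi> b *\<^sub>C f (dual_basis b))"
  by (subst cd_expand[of \<phi>, symmetric])
     (simp add: clinear_sum[OF assms] clinear_scale[OF assms])

section \<open>The ring of functions on a formal group\<close>

lemma clinear_shift: "clinear (shift x)"
  by (rule clinearI) simp_all

lemma wval_fold_shift: "wval (fold shift p f) q = wval f (p @ q)"
  by (induction p arbitrary: f) simp_all

lemma fold_shift_add: "fold shift p (f + g) = fold shift p f + fold shift p g"
  by (induction p arbitrary: f g) simp_all

text \<open>The relations of the enveloping algebra at the beginning of a word.  Relations further inside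
  a word are relations for an iterated shift, and shifts are derivations of the product; in this
  form the functions on the formal group are easily seen to be a subring.\<close>

definition local_relations :: "('x::complex_space \<Rightarrow> 'x \<Rightarrow> 'x) \<Rightarrow> 'x wfun \<Rightarrow> bool" where
  "local_relations br f \<longleftrightarrow>
     (\<forall>x y. shift (x + y) f = shift x f + shift y f) \<and>
     (\<forall>c x. shift (c *\<^sub>C x) f = c *\<^sub>C shift x f) \<and>
     (\<forall>x y. shift y (shift x f) - shift x (shift y f) = shift (br x y) f)"

lemma formal_functions_shift_iff:
  "f \<in> formal_functions br \<longleftrightarrow> (\<forall>p. local_relations br (fold shift p f))"
proof -
  have eq: "g = h \<longleftrightarrow> (\<forall>q. wval g q = wval h q)" for g h :: "'a wfun"
    by (auto intro: wfun_eqI)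
  show ?thesis
    unfolding formal_functions_iff local_relations_def eq wval_simps wval_shift wval_fold_shift
      append_Cons append_Nil
    by blast
qed

lemma formal_functions_local: "f \<in> formal_functions br \<Longrightarrow> local_relations br f"
  unfolding formal_functions_shift_iff by (metis fold_simps(1))

lemma formal_functions_shift: "f \<in> formal_functions br \<Longrightarrow> shift x f \<in> formal_functions br"
  unfolding formal_functions_shift_iff by (metis fold_simps(2))

lemma local_relations_add:
  assumes f: "local_relations br f" and g: "local_relations br g"
  shows "local_relations br (f + g)"
proof -
  have "shift y (shift x (f + g)) - shift x (shift y (f + g)) =
      (shift y (shift x f) - shift x (shift y f)) + (shift y (shift x g) - shift x (shift y g))" for x y
    by simp
  then show ?thesis
    using f g unfolding local_relations_def by (simp add: cscale_add_right)
qed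

lemma formal_functions_add:
  "f \<in> formal_functions br \<Longrightarrow> g \<in> formal_functions br \<Longrightarrow> f + g \<in> formal_functions br"
  unfolding formal_functions_shift_iff by (simp add: fold_shift_add local_relations_add)

lemma fold_shift_cscale: "fold shift p (c *\<^sub>C f) = c *\<^sub>C fold shift p f"
  by (induction p arbitrary: f) simp_all

lemma local_relations_cscale: "local_relations br f \<Longrightarrow> local_relations br (c *\<^sub>C f)"
  unfolding local_relations_def
  by (simp add: cscale_add_right cscale_cscale mult.commute flip: cvec.scale_right_diff_distrib)

lemma formal_functions_cscale: "f \<in> formal_functions br \<Longrightarrow> c *\<^sub>C f \<in> formal_functions br"
  unfolding formal_functions_shift_iff by (simp add: fold_shift_cscale local_relations_cscale)

lemma formal_functions_const: "c *\<^sub>C 1 \<in> formal_functions br"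
  unfolding formal_functions_iff by (simp add: wval_one)

lemma formal_functions_one: "1 \<in> formal_functions br"
  using formal_functions_const[of 1] by (simp add: cscale_one)

lemma formal_functions_zero: "0 \<in> formal_functions br"
  using formal_functions_const[of 0] by simp

lemma formal_functions_uminus: "f \<in> formal_functions br \<Longrightarrow> - f \<in> formal_functions br"
  using formal_functions_cscale[of f br "-1"] by simp

lemma formal_functions_sum:
  "(\<And>a. a \<in> A \<Longrightarrow> f a \<in> formal_functions br) \<Longrightarrow> (\<Sum>a\<in>A. f a) \<in> formal_functions br"
  by (induction A rule: infinite_finite_induct)
     (simp_all add: formal_functions_zero formal_functions_add)

text \<open>Shifts are derivations, so the shifts of a product are sums of products of shifts, and the
  relations need to be checked for a single product only.\<close>

lemma formal_functions_mult:
  assumes "f \<in> formal_functions br" "g \<in> formal_functions br"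
  shows "f * g \<in> formal_functions br"
proof -
  have local: "local_relations br (f * g)"
    if f: "f \<in> formal_functions br" and g: "g \<in> formal_functions br" for f g
  proof -
    note F = formal_functions_local[OF f, unfolded local_relations_def]
      and G = formal_functions_local[OF g, unfolded local_relations_def]
    have "shift y (shift x (f * g)) - shift x (shift y (f * g)) =
      (shift y (shift x f) - shift x (shift y f)) * g + f * (shift y (shift x g) - shift x (shift y g))"
      for x y by (simp add: algebra_simps)
    then have "shift y (shift x (f * g)) - shift x (shift y (f * g)) =
      shift (br x y) f * g + f * shift (br x y) g" for x y
      using F G by (simp del: shift_times)
    moreover have "shift (x + y) (f * g) = shift x (f * g) + shift y (f * g)" for x y
      using F G by (simp add: distrib_left distrib_right)
    moreover have "shift (c *\<^sub>C x) (f * g) = c *\<^sub>C shift x (f * g)" for c x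
      using F G by (simp add: cscale_mult_left cscale_mult_right cscale_add_right)
    moreover have "shift (br x y) (f * g) = shift (br x y) f * g + f * shift (br x y) g" for x y
      by simp
    ultimately show ?thesis
      unfolding local_relations_def by (simp del: shift_times)
  qed
  have "local_relations br (fold shift p (f * g))" for p
    using assms
  proof (induction p arbitrary: f g)
    case (Cons x p)
    then show ?case
      by (simp add: fold_shift_add local_relations_add formal_functions_shift)
  qed (simp add: local)
  then show ?thesis by (simp add: formal_functions_shift_iff)
qed

lemma formal_functions_power: "f \<in> formal_functions br \<Longrightarrow> f ^ n \<in> formal_functions br"
  by (induction n) (simp_all add: formal_functions_one formal_functions_mult)

lemma formal_functions_prod:
  "(\<And>a. a \<in> A \<Longrightarrow> f a \<in> formal_functions br) \<Longrightarrow> (\<Prod>a\<in>A. f a) \<in> formal_functions br"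
  by (induction A rule: infinite_finite_induct)
     (simp_all add: formal_functions_one formal_functions_mult)

lemma wval_Lop [simp]: "wval (Lop \<xi> f) w = - wval f (\<xi> # w)"
  by (simp add: Lop_def)

lemma wval_Rop [simp]: "wval (Rop \<xi> f) w = wval f (w @ [\<xi>])"
  by (simp add: Rop_def)

lemma wval_pullback [simp]: "wval (pullback j f) w = wval f (map j w)"
  by (simp add: pullback_def)

lemma Lop_shift: "Lop \<xi> f = - shift \<xi> f"
  by (rule wfun_eqI) simp

lemma shift_Rop: "shift x (Rop \<xi> f) = Rop \<xi> (shift x f)"
  by (rule wfun_eqI) simp

lemma Rop_pullback: "Rop y (pullback j f) = pullback j (Rop (j y) f)"
  by (rule wfun_eqI) simp

lemma Lop_pullback: "Lop y (pullback j f) = pullback j (Lop (j y) f)"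
  by (rule wfun_eqI) simp

text \<open>Translations of functions on the group depend linearly on the direction; for an arbitrary
  function on words this fails.\<close>

lemma clinear_Lop_letter:
  assumes "f \<in> formal_functions br" shows "clinear (\<lambda>\<xi>. Lop \<xi> f)"
  using formal_functions_local[OF assms]
  by (intro clinearI) (simp_all add: Lop_shift local_relations_def)

lemma clinear_Rop_letter:
  assumes "f \<in> formal_functions br" shows "clinear (\<lambda>\<xi>. Rop \<xi> f)"
proof (rule clinearI; rule wfun_eqI)
  have "\<And>p x y. wval f (p @ [x + y] @ []) = wval f (p @ [x] @ []) + wval f (p @ [y] @ [])"
    and "\<And>p c x. wval f (p @ [c *\<^sub>C x] @ []) = c * wval f (p @ [x] @ [])"
    using assms unfolding formal_functions_iff by blast+
  then show "wval (Rop (x + y) f) w = wval (Rop x f + Rop y f) w"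
    "wval (Rop (c *\<^sub>C x) f) w = wval (c *\<^sub>C Rop x f) w" for x y c w
    by simp_all
qed

lemma formal_functions_pullback:
  assumes "clinear j" "\<And>x y. j (br' x y) = br (j x) (j y)" "f \<in> formal_functions br"
  shows "pullback j f \<in> formal_functions br'"
proof -
  have j: "j (x + y) = j x + j y" "j (c *\<^sub>C x) = c *\<^sub>C j x" for x y c
    using assms(1) by (simp_all add: clinear_iff)
  note f = assms(3)[unfolded formal_functions_iff]
  have "wval f (map j p @ [j x + j y] @ map j q) = wval f (map j p @ [j x] @ map j q) + wval f (map j p @ [j y] @ map j q)"
    "wval f (map j p @ [c *\<^sub>C j x] @ map j q) = c * wval f (map j p @ [j x] @ map j q)"
    "wval f (map j p @ [j x, j y] @ map j q) - wval f (map j p @ [j y, j x] @ map j q) =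
      wval f (map j p @ [br (j x) (j y)] @ map j q)" for p q x y c
    using f by blast+
  then show ?thesis
    unfolding formal_functions_iff wval_pullback map_append list.map j assms(2) by blast
qed


section \<open>Derivations and morphisms of fraction fields\<close>

definition derivation :: "('r::complex_idom \<Rightarrow> 'r) \<Rightarrow> bool" where
  "derivation D \<longleftrightarrow> clinear D \<and> (\<forall>f g. D (f * g) = D f * g + f * D g)"

lemma derivation_linear: "derivation D \<Longrightarrow> clinear D"
  and derivation_mult: "derivation D \<Longrightarrow> D (f * g) = D f * g + f * D g"
  by (simp_all add: derivation_def)

lemma derivation_one: "derivation D \<Longrightarrow> D 1 = 0"
  using derivation_mult[of D 1 1] unfolding mult_1_left mult_1_right by (metis add_cancel_right_right)

lemma fract_cases:
  obtains f g where "g \<noteq> 0" "q = to_fract f / to_fract (g :: 'r::idom)"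
  by (metis Fract_cases Fract_conv_to_fract)

lemma extend_derivation_fraction:
  assumes "derivation D" "g \<noteq> 0"
  shows "extend_derivation D (to_fract f / to_fract g) =
    (to_fract (D f) * to_fract g - to_fract f * to_fract (D g)) / (to_fract g)\<^sup>2"
  using extend_derivation[of D g f] assms
  by (simp add: derivation_mult power2_eq_square flip: to_fract_mult)

lemma extend_derivation_to_fract:
  assumes "derivation D" shows "extend_derivation D (to_fract f) = to_fract (D f)"
  using extend_derivation_fraction[OF assms, of 1 f] by (simp add: derivation_one[OF assms])

lemma derivation_extend:
  assumes D: "derivation D" shows "derivation (extend_derivation D)"
  unfolding derivation_def
proof (intro conjI allI clinearI)
  fix p q :: "'a fract" and c
  obtain f g where p: "g \<noteq> 0" "p = to_fract f / to_fract g" by (rule fract_cases)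
  obtain f' g' where q: "g' \<noteq> 0" "q = to_fract f' / to_fract g'" by (rule fract_cases)
  have nz: "to_fract g \<noteq> 0" "to_fract g' \<noteq> 0" "g * g' \<noteq> 0" using p(1) q(1) by simp_all
  have "p + q = to_fract (f * g' + f' * g) / to_fract (g * g')"
    using nz by (simp add: p q field_simps)
  then have "extend_derivation D (p + q) =
    (to_fract (D (f * g' + f' * g)) * to_fract (g * g') - to_fract (f * g' + f' * g) * to_fract (D (g * g')))
      / (to_fract (g * g'))\<^sup>2"
    by (simp only: extend_derivation_fraction[OF D nz(3)])
  also have "\<dots> = extend_derivation D p + extend_derivation D q"
    using nz unfolding p(2) q(2) extend_derivation_fraction[OF D p(1)] extend_derivation_fraction[OF D q(1)]
    by (simp add: derivation_mult[OF D] clinear_add[OF derivation_linear[OF D]] field_simps power2_eq_square)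
  finally show "extend_derivation D (p + q) = extend_derivation D p + extend_derivation D q" .
  have "p * q = to_fract (f * f') / to_fract (g * g')"
    using nz by (simp add: p q field_simps)
  then have "extend_derivation D (p * q) =
    (to_fract (D (f * f')) * to_fract (g * g') - to_fract (f * f') * to_fract (D (g * g')))
      / (to_fract (g * g'))\<^sup>2"
    by (simp only: extend_derivation_fraction[OF D nz(3)])
  also have "\<dots> = extend_derivation D p * q + p * extend_derivation D q"
    using nz unfolding p(2) q(2) extend_derivation_fraction[OF D p(1)] extend_derivation_fraction[OF D q(1)]
    by (simp add: derivation_mult[OF D] field_simps power2_eq_square)
  finally show "extend_derivation D (p * q) = extend_derivation D p * q + p * extend_derivation D q" .
  have "c *\<^sub>C p = to_fract (c *\<^sub>C f) / to_fract g"
    by (simp add: p to_fract_cscale cscale_mult_left divide_inverse)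
  then have "extend_derivation D (c *\<^sub>C p) =
    (to_fract (D (c *\<^sub>C f)) * to_fract g - to_fract (c *\<^sub>C f) * to_fract (D g)) / (to_fract g)\<^sup>2"
    using extend_derivation_fraction[OF D p(1)] by simp
  also have "\<dots> = c *\<^sub>C extend_derivation D p"
    unfolding p(2) extend_derivation_fraction[OF D p(1)]
    by (simp add: clinear_scale[OF derivation_linear[OF D]] to_fract_cscale cscale_mult_left divide_inverse
        flip: cvec.scale_right_diff_distrib)
  finally show "extend_derivation D (c *\<^sub>C p) = c *\<^sub>C extend_derivation D p" .
qed

definition algebra_hom :: "('r::complex_idom \<Rightarrow> 's::complex_idom) \<Rightarrow> bool" where
  "algebra_hom h \<longleftrightarrow> clinear h \<and> (\<forall>f g. h (f * g) = h f * h g) \<and> h 1 = 1"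

lemma algebra_hom_linear: "algebra_hom h \<Longrightarrow> clinear h"
  and algebra_hom_mult: "algebra_hom h \<Longrightarrow> h (f * g) = h f * h g"
  and algebra_hom_one: "algebra_hom h \<Longrightarrow> h 1 = 1"
  by (simp_all add: algebra_hom_def)

lemma algebra_hom_power: "algebra_hom h \<Longrightarrow> h (f ^ n) = h f ^ n"
  by (induction n) (simp_all add: algebra_hom_mult algebra_hom_one)

text \<open>The local ring of the fractions to which \<open>h\<close> extends: on it the extension is again a
  ring morphism.\<close>

definition hom_domain :: "('r::idom \<Rightarrow> 's::idom) \<Rightarrow> 'r fract set" where
  "hom_domain h = {to_fract f / to_fract g | f g. h g \<noteq> 0}"

lemma extend_hom_fraction:
  assumes "algebra_hom h" "h g \<noteq> 0"
  shows "extend_hom h (to_fract f / to_fract g) = to_fract (h f) / to_fract (h g)"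
  using assms by (intro extend_hom) (simp_all add: algebra_hom_mult algebra_hom_linear clinear_zero)

lemma
  assumes h: "algebra_hom h" and p: "p \<in> hom_domain h" and q: "q \<in> hom_domain h"
  shows hom_domain_add: "p + q \<in> hom_domain h"
    and extend_hom_add: "extend_hom h (p + q) = extend_hom h p + extend_hom h q"
    and hom_domain_mult: "p * q \<in> hom_domain h"
    and extend_hom_mult: "extend_hom h (p * q) = extend_hom h p * extend_hom h q"
proof -
  obtain f g where p: "h g \<noteq> 0" "p = to_fract f / to_fract g"
    using p by (auto simp: hom_domain_def)
  obtain f' g' where q: "h g' \<noteq> 0" "q = to_fract f' / to_fract g'"
    using q by (auto simp: hom_domain_def)
  have nz: "g \<noteq> 0" "g' \<noteq> 0" using p q clinear_zero[OF algebra_hom_linear[OF h]] by auto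
  have hnz: "h (g * g') \<noteq> 0" using p q by (simp add: algebra_hom_mult[OF h])
  have add: "p + q = to_fract (f * g' + f' * g) / to_fract (g * g')"
    using nz by (simp add: p q field_simps)
  have mult: "p * q = to_fract (f * f') / to_fract (g * g')"
    using nz by (simp add: p q field_simps)
  show "p + q \<in> hom_domain h" "p * q \<in> hom_domain h"
    using add mult hnz unfolding hom_domain_def by blast+
  show "extend_hom h (p + q) = extend_hom h p + extend_hom h q"
    unfolding add extend_hom_fraction[OF h hnz] unfolding p q extend_hom_fraction[OF h p(1)] extend_hom_fraction[OF h q(1)]
    using p(1) q(1) by (simp add: algebra_hom_mult[OF h] clinear_add[OF algebra_hom_linear[OF h]] field_simps)
  show "extend_hom h (p * q) = extend_hom h p * extend_hom h q"
    unfolding mult extend_hom_fraction[OF h hnz] unfolding p q extend_hom_fraction[OF h p(1)] extend_hom_fraction[OF h q(1)]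
    using p(1) q(1) by (simp add: algebra_hom_mult[OF h] field_simps)
qed

lemma
  assumes h: "algebra_hom h" and p: "p \<in> hom_domain h"
  shows hom_domain_cscale: "c *\<^sub>C p \<in> hom_domain h"
    and extend_hom_cscale: "extend_hom h (c *\<^sub>C p) = c *\<^sub>C extend_hom h p"
proof -
  obtain f g where p: "h g \<noteq> 0" "p = to_fract f / to_fract g"
    using p by (auto simp: hom_domain_def)
  have scale: "c *\<^sub>C p = to_fract (c *\<^sub>C f) / to_fract g"
    by (simp add: p to_fract_cscale cscale_mult_left divide_inverse)
  show "c *\<^sub>C p \<in> hom_domain h"
    using scale p(1) unfolding hom_domain_def by blast
  show "extend_hom h (c *\<^sub>C p) = c *\<^sub>C extend_hom h p"
    unfolding scale extend_hom_fraction[OF h p(1)] unfolding p extend_hom_fraction[OF h p(1)]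
    by (simp add: clinear_scale[OF algebra_hom_linear[OF h]] to_fract_cscale cscale_mult_left divide_inverse)
qed

lemma
  assumes h: "algebra_hom h"
  shows hom_domain_const: "c *\<^sub>C 1 \<in> hom_domain h"
    and extend_hom_const: "extend_hom h (c *\<^sub>C 1) = c *\<^sub>C 1"
proof -
  have eq: "(c *\<^sub>C 1 :: 'a fract) = to_fract (c *\<^sub>C 1) / to_fract 1" by (simp add: to_fract_cscale)
  have nz: "h 1 \<noteq> 0" by (simp add: algebra_hom_one[OF h])
  show "c *\<^sub>C 1 \<in> hom_domain h" unfolding hom_domain_def eq using nz by blast
  show "extend_hom h (c *\<^sub>C 1) = c *\<^sub>C 1"
    unfolding eq extend_hom_fraction[OF h nz]
    by (simp add: clinear_scale[OF algebra_hom_linear[OF h]] algebra_hom_one[OF h] to_fract_cscale)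
qed

lemma
  assumes h: "algebra_hom h"
  shows hom_domain_zero: "0 \<in> hom_domain h" and extend_hom_zero: "extend_hom h 0 = 0"
  using hom_domain_const[OF h, of 0] extend_hom_const[OF h, of 0] by simp_all

lemma
  assumes h: "algebra_hom h" and p: "p \<in> hom_domain h"
  shows hom_domain_uminus: "- p \<in> hom_domain h"
    and extend_hom_uminus: "extend_hom h (- p) = - extend_hom h p"
  using hom_domain_cscale[OF h p, of "-1"] extend_hom_cscale[OF h p, of "-1"] by simp_all

lemma
  assumes h: "algebra_hom h" and "\<And>a. a \<in> A \<Longrightarrow> q a \<in> hom_domain h"
  shows hom_domain_sum: "(\<Sum>a\<in>A. q a) \<in> hom_domain h"
    and extend_hom_sum: "extend_hom h (\<Sum>a\<in>A. q a) = (\<Sum>a\<in>A. extend_hom h (q a))"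
proof -
  have "(\<Sum>a\<in>A. q a) \<in> hom_domain h \<and> extend_hom h (\<Sum>a\<in>A. q a) = (\<Sum>a\<in>A. extend_hom h (q a))"
    using assms(2)
    by (induction A rule: infinite_finite_induct)
       (simp_all add: hom_domain_zero[OF h] extend_hom_zero[OF h] hom_domain_add[OF h] extend_hom_add[OF h])
  then show "(\<Sum>a\<in>A. q a) \<in> hom_domain h"
    "extend_hom h (\<Sum>a\<in>A. q a) = (\<Sum>a\<in>A. extend_hom h (q a))" by blast+
qed

text \<open>
  The quotient rule for a derivation \<open>\<Delta>\<close> along \<open>h\<close>.  It is linear in \<open>\<Delta>\<close>, so that linear
  relations between derivations along \<open>h\<close> carry over from functions to fractions.
\<close>

definition quotient_rule ::
  "('r::complex_idom \<Rightarrow> 's::complex_idom) \<Rightarrow> ('r \<Rightarrow> 's fract) \<Rightarrow> 'r \<Rightarrow> 'r \<Rightarrow> 's fract" where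
  "quotient_rule h \<Delta> f g =
     (\<Delta> f * to_fract (h g) - to_fract (h f) * \<Delta> g) / (to_fract (h g))\<^sup>2"

lemma
  assumes h: "algebra_hom h" and D: "derivation D" and g: "h g \<noteq> 0"
  shows hom_domain_derivation: "extend_derivation D (to_fract f / to_fract g) \<in> hom_domain h"
    and extend_hom_derivation: "extend_hom h (extend_derivation D (to_fract f / to_fract g)) =
      quotient_rule h (\<lambda>x. to_fract (h (D x))) f g"
proof -
  have "g \<noteq> 0" using g clinear_zero[OF algebra_hom_linear[OF h]] by auto
  then have eq: "extend_derivation D (to_fract f / to_fract g) =
      to_fract (D f * g - f * D g) / to_fract (g * g)"
    by (simp add: extend_derivation_fraction[OF D] power2_eq_square)
  have gg: "h (g * g) \<noteq> 0" using g by (simp add: algebra_hom_mult[OF h])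
  show "extend_derivation D (to_fract f / to_fract g) \<in> hom_domain h"
    unfolding eq hom_domain_def using gg by blast
  show "extend_hom h (extend_derivation D (to_fract f / to_fract g)) =
      quotient_rule h (\<lambda>x. to_fract (h (D x))) f g"
    unfolding eq extend_hom_fraction[OF h gg]
    by (simp add: quotient_rule_def algebra_hom_mult[OF h] clinear_diff[OF algebra_hom_linear[OF h]]
        power2_eq_square)
qed

lemma extend_derivation_hom:
  assumes h: "algebra_hom h" and D: "derivation D" and g: "h g \<noteq> 0"
  shows "extend_derivation D (extend_hom h (to_fract f / to_fract g)) =
      quotient_rule h (\<lambda>x. to_fract (D (h x))) f g"
  by (simp add: extend_hom_fraction[OF h g] extend_derivation_fraction[OF D g] quotient_rule_def)

lemma quotient_rule_sum:
  "quotient_rule h (\<lambda>x. \<Sum>a\<in>A. k a * \<Delta> a x) f g = (\<Sum>a\<in>A. k a * quotient_rule h (\<Delta> a) f g)"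
  by (simp add: quotient_rule_def sum_distrib_left sum_distrib_right right_diff_distrib
      mult.assoc mult.left_commute flip: sum_subtractf sum_divide_distrib)

lemma quotient_rule_add:
  "quotient_rule h (\<lambda>x. \<Delta> x + \<Delta>' x) f g = quotient_rule h \<Delta> f g + quotient_rule h \<Delta>' f g"
  by (simp add: quotient_rule_def algebra_simps diff_divide_distrib add_divide_distrib)

lemma quotient_rule_cong:
  "\<Delta> f = \<Delta>' f \<Longrightarrow> \<Delta> g = \<Delta>' g \<Longrightarrow> quotient_rule h \<Delta> f g = quotient_rule h \<Delta>' f g"
  by (simp add: quotient_rule_def)

lemma clinear_pullback: "clinear (pullback j)"
  by (rule clinearI; rule wfun_eqI) simp_all

lemma algebra_hom_pullback: "algebra_hom (pullback j)"
  unfolding algebra_hom_def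
  by (auto simp: clinear_pullback pullback_times wval_one intro: wfun_eqI)

lemma derivation_Lop: "derivation (Lop \<xi>)"
  unfolding derivation_def by (auto simp: Lop_times intro!: clinearI wfun_eqI)

lemma derivation_dress: "derivation (dress br \<delta> a)"
  unfolding derivation_def
proof (intro conjI allI clinearI)
  have R: "Rop e (f + g) = Rop e f + Rop e g" "Rop e (c *\<^sub>C f) = c *\<^sub>C Rop e f"
    for e :: "'a cdual" and f g c by (rule wfun_eqI; simp)+
  show "dress br \<delta> a (f + g) = dress br \<delta> a f + dress br \<delta> a g" for f g
    by (simp add: dress_def R distrib_left sum.distrib)
  show "dress br \<delta> a (c *\<^sub>C f) = c *\<^sub>C dress br \<delta> a f" for c f
    by (simp add: dress_def R cscale_mult_right cvec.scale_sum_right)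
qed (rule dress_times)

section \<open>Matrices with finite index sets\<close>

lemma matrix_left_inverse_of_right_inverse:
  fixes M N :: "'i \<Rightarrow> 'i \<Rightarrow> 'k::field"
  assumes A: "finite A"
    and MN: "\<And>a c. a \<in> A \<Longrightarrow> c \<in> A \<Longrightarrow> (\<Sum>b\<in>A. M a b * N b c) = (if a = c then 1 else 0)"
    and "a \<in> A" "c \<in> A"
  shows "(\<Sum>b\<in>A. N a b * M b c) = (if a = c then 1 else 0)"
proof -
  obtain es where es: "distinct es" "set es = A" using finite_distinct_list[OF A] by blast
  define n where "n = length es"
  have sum: "(\<Sum>b\<in>A. f b) = (\<Sum>k\<in>{0..<n}. f (es ! k))" for f :: "'i \<Rightarrow> 'k"
    using sum.reindex_bij_betw[OF bij_betw_nth[OF es(1) refl refl], of f] es(2)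
    by (simp add: n_def lessThan_atLeast0)
  define MM where "MM = mat n n (\<lambda>(r, c). M (es ! r) (es ! c))"
  define NN where "NN = mat n n (\<lambda>(r, c). N (es ! r) (es ! c))"
  have mem: "es ! r \<in> A" if "r < n" for r using that es n_def by auto
  have "MM * NN = 1\<^sub>m n"
  proof (rule eq_matI)
    fix r s assume rs: "r < dim_row (1\<^sub>m n :: 'k mat)" "s < dim_col (1\<^sub>m n :: 'k mat)"
    then show "(MM * NN) $$ (r, s) = (1\<^sub>m n :: 'k mat) $$ (r, s)"
      using MN[OF mem mem, of r s] es(1)
      by (simp add: MM_def NN_def scalar_prod_def sum n_def nth_eq_iff_index_eq)
  qed (simp_all add: MM_def NN_def)
  then have *: "NN * MM = 1\<^sub>m n"
    by (rule mat_mult_left_right_inverse[rotated 2]) (simp_all add: MM_def NN_def)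
  obtain r s where rs: "r < n" "s < n" "a = es ! r" "c = es ! s"
    using assms(3,4) es n_def by (metis in_set_conv_nth)
  show ?thesis
    using arg_cong[OF *, of "\<lambda>X. X $$ (r, s)"] rs es(1)
    by (simp add: MM_def NN_def scalar_prod_def sum n_def nth_eq_iff_index_eq)
qed

lemma formal_functions_det:
  assumes A: "A \<in> carrier_mat n n" and el: "\<And>r s. r < n \<Longrightarrow> s < n \<Longrightarrow> A $$ (r, s) \<in> formal_functions br"
  shows "det A \<in> formal_functions br"
proof -
  have "det A = (\<Sum>p | p permutes {0..<n}. signof p * (\<Prod>r = 0..<n. A $$ (r, p r)))"
    using A by (rule det_def')
  also have "\<dots> \<in> formal_functions br"
  proof (intro formal_functions_sum formal_functions_mult formal_functions_prod)
    fix p assume "p \<in> {p. p permutes {0..<n}}"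
    then have p: "p permutes {0..<n}" by simp
    show "signof p \<in> formal_functions br"
      by (simp add: sign_def formal_functions_one formal_functions_uminus)
    show "A $$ (r, p r) \<in> formal_functions br" if "r \<in> {0..<n}" for r
      using that permutes_in_image[OF p, of r] by (intro el) auto
  qed
  finally show ?thesis .
qed


section \<open>Tensor operations in coordinates\<close>

lemma sum_swap_inner:
  "(\<Sum>a\<in>A. \<Sum>b\<in>B. \<Sum>c\<in>C. f a b c) = (\<Sum>a\<in>A. \<Sum>c\<in>C. \<Sum>b\<in>B. f a b c)"
  by (rule sum.cong[OF refl]) (rule sum.swap)

lemma sum_fun_apply: "(\<Sum>a\<in>A. f a) x = (\<Sum>a\<in>A. f a x)"
  by (induction A rule: infinite_finite_induct) simp_all

lemma sum_coord:
  fixes f :: "'a::fd_complex_space \<Rightarrow> 'r::complex_space"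
  assumes "b \<in> cbasis" shows "(\<Sum>x\<in>cbasis. coord b x *\<^sub>C f x) = f b"
proof -
  have "(\<Sum>x\<in>cbasis. coord b x *\<^sub>C f x) = (\<Sum>x\<in>cbasis. if b = x then f x else 0)"
    by (intro sum.cong) (simp_all add: coord_cbasis cscale_one)
  also have "\<dots> = f b" using assms by (simp add: finite_cbasis)
  finally show ?thesis .
qed

lemma cd_app_expand:
  fixes x :: "'a::fd_complex_space"
  shows "(\<Sum>b\<in>cbasis. coord b x * cd_app \<phi> b) = cd_app \<phi> x"
  using clinear_expand[OF clinear_cd_app, of \<phi> x] by simp

lemma tmap2_apply:
  "tmap2 f t b c = (\<Sum>x\<in>cbasis. \<Sum>y\<in>cbasis. (coord b (f x) * coord c (f y)) *\<^sub>C t x y)"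
  by (simp add: tmap2_def ext2_def sum_fun_apply pure2_def)

lemma ad2_apply:
  fixes t :: "'a::fd_complex_space \<Rightarrow> 'a \<Rightarrow> 'r::complex_space"
  assumes "b \<in> cbasis" "c \<in> cbasis"
  shows "ad2 br a t b c = (\<Sum>x\<in>cbasis. coord b (br a x) *\<^sub>C t x c) + (\<Sum>x\<in>cbasis. coord c (br a x) *\<^sub>C t b x)"
proof -
  have "ad2 br a t b c = (\<Sum>x\<in>cbasis. \<Sum>y\<in>cbasis. coord c y *\<^sub>C coord b (br a x) *\<^sub>C t x y)
      + (\<Sum>y\<in>cbasis. \<Sum>x\<in>cbasis. coord b x *\<^sub>C coord c (br a y) *\<^sub>C t x y)"
    by (subst (2) sum.swap)
       (simp add: ad2_def ext2_def sum_fun_apply pure2_def sum.distrib cscale_cscale mult.commute)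
  then show ?thesis by (simp only: sum_coord[OF assms(1)] sum_coord[OF assms(2)])
qed

lemma cob2_apply:
  fixes t :: "'a::fd_complex_space \<Rightarrow> 'a \<Rightarrow> 'r::complex_space"
  assumes "b \<in> cbasis" "c \<in> cbasis" "d \<in> cbasis"
  shows "cob2 \<delta> t b c d = (\<Sum>x\<in>cbasis. \<delta> x b c *\<^sub>C t x d)"
proof -
  have "cob2 \<delta> t b c d = (\<Sum>x\<in>cbasis. \<Sum>y\<in>cbasis. coord d y *\<^sub>C (\<Sum>x'\<in>cbasis. coord b x' *\<^sub>C
      (\<Sum>x''\<in>cbasis. coord c x'' *\<^sub>C (\<delta> x x' x'' *\<^sub>C t x y))))"
    by (simp add: cob2_def ext2_def sum_fun_apply pure3_def cvec.scale_sum_right cscale_cscale mult.assoc mult.left_commute)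
  then show ?thesis by (simp only: sum_coord[OF assms(1)] sum_coord[OF assms(2)] sum_coord[OF assms(3)])
qed

text \<open>The polarization of \<open>CYB\<close>, in coordinates\<close>

definition cyb ::
  "('a::complex_space \<Rightarrow> 'a \<Rightarrow> 'a) \<Rightarrow> ('a \<Rightarrow> 'a \<Rightarrow> 'r::complex_idom) \<Rightarrow> ('a \<Rightarrow> 'a \<Rightarrow> 'r) \<Rightarrow> 'a \<Rightarrow> 'a \<Rightarrow> 'a \<Rightarrow> 'r"
  where "cyb br s t b c d =
    (\<Sum>x\<in>cbasis. \<Sum>y\<in>cbasis. coord b (br x y) *\<^sub>C (s x c * t y d)) +
    (\<Sum>x\<in>cbasis. \<Sum>y\<in>cbasis. coord c (br x y) *\<^sub>C (s b x * t y d)) +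
    (\<Sum>x\<in>cbasis. \<Sum>y\<in>cbasis. coord d (br x y) *\<^sub>C (s b x * t c y))"

lemma CYB_apply:
  fixes t :: "'a::fd_complex_space \<Rightarrow> 'a \<Rightarrow> 'r::complex_idom"
  assumes "b \<in> cbasis" "c \<in> cbasis" "d \<in> cbasis"
  shows "CYB br t b c d = cyb br t t b c d"
proof -
  let ?f = "\<lambda>x y x' y'. (coord b (br x x') * coord c y * coord d y') *\<^sub>C (t x y * t x' y')"
    and ?g = "\<lambda>x y x' y'. (coord b x * coord c (br y x') * coord d y') *\<^sub>C (t x y * t x' y')"
    and ?h = "\<lambda>x y x' y'. (coord b x * coord c x' * coord d (br y y')) *\<^sub>C (t x y * t x' y')"
  let ?S = "\<lambda>f. \<Sum>x\<in>cbasis. \<Sum>y\<in>cbasis. \<Sum>x'\<in>cbasis. \<Sum>y'\<in>cbasis. f x y x' y' :: 'r"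
  have "CYB br t b c d =
    ?S ?f +
    ?S ?g +
    ?S ?h"
    by (simp add: CYB_def ext2_def sum_fun_apply pure3_def sum.distrib)
  also have "?S ?f
    = (\<Sum>x\<in>cbasis. \<Sum>y\<in>cbasis. coord c y *\<^sub>C (\<Sum>x'\<in>cbasis. \<Sum>y'\<in>cbasis. coord d y' *\<^sub>C (coord b (br x x') *\<^sub>C (t x y * t x' y'))))"
    by (simp add: cvec.scale_sum_right cscale_cscale ac_simps)
  also have "\<dots> = (\<Sum>x\<in>cbasis. \<Sum>y\<in>cbasis. coord b (br x y) *\<^sub>C (t x c * t y d))"
    by (simp only: sum_coord assms)
  also have "?S ?g
    = (\<Sum>x\<in>cbasis. coord b x *\<^sub>C (\<Sum>y\<in>cbasis. \<Sum>x'\<in>cbasis. \<Sum>y'\<in>cbasis. coord d y' *\<^sub>C (coord c (br y x') *\<^sub>C (t x y * t x' y'))))"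
    by (simp add: cvec.scale_sum_right cscale_cscale ac_simps)
  also have "\<dots> = (\<Sum>x\<in>cbasis. \<Sum>y\<in>cbasis. coord c (br x y) *\<^sub>C (t b x * t y d))"
    by (simp only: sum_coord assms)
  also have "?S ?h
    = (\<Sum>x\<in>cbasis. coord b x *\<^sub>C (\<Sum>y\<in>cbasis. \<Sum>x'\<in>cbasis. coord c x' *\<^sub>C (\<Sum>y'\<in>cbasis. coord d (br y y') *\<^sub>C (t x y * t x' y'))))"
    by (simp add: cvec.scale_sum_right cscale_cscale ac_simps)
  also have "\<dots> = (\<Sum>x\<in>cbasis. \<Sum>y\<in>cbasis. coord d (br x y) *\<^sub>C (t b x * t c y))"
    by (simp only: sum_coord assms)
  finally show ?thesis by (simp only: cyb_def)
qed

lemma CYB_outside: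
  fixes t :: "'a::fd_complex_space \<Rightarrow> 'a \<Rightarrow> 'r::complex_idom"
  shows "b \<notin> cbasis \<or> c \<notin> cbasis \<or> d \<notin> cbasis \<Longrightarrow> CYB br t b c d = 0"
  by (auto simp: CYB_def ext2_def sum_fun_apply pure3_def coord_outside)

lemma cob2_outside:
  fixes t :: "'a::fd_complex_space \<Rightarrow> 'a \<Rightarrow> 'r::complex_space"
  shows "b \<notin> cbasis \<or> c \<notin> cbasis \<or> d \<notin> cbasis \<Longrightarrow> cob2 \<delta> t b c d = 0"
  by (auto simp: cob2_def ext2_def sum_fun_apply pure3_def coord_outside)

lemma ad2_outside:
  fixes t :: "'a::fd_complex_space \<Rightarrow> 'a \<Rightarrow> 'r::complex_space"
  shows "b \<notin> cbasis \<or> c \<notin> cbasis \<Longrightarrow> ad2 br a t b c = 0"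
  by (auto simp: ad2_def ext2_def sum_fun_apply pure2_def coord_outside)

lemma dL_outside:
  "b \<notin> cbasis \<or> c \<notin> cbasis \<or> d \<notin> cbasis \<Longrightarrow> dL \<iota> t b c d = 0"
  by (auto simp: dL_def ext2_def sum_fun_apply pure3_def coord_outside)

lemma dL_apply:
  fixes \<iota> :: "'h::complex_space \<Rightarrow> 'a::fd_complex_space"
  assumes "b \<in> cbasis" "c \<in> cbasis"
  shows "dL \<iota> t b c d = - (\<Sum>e\<in>cbasis. coord d (\<iota> e) *\<^sub>C extend_derivation (Lop (dual_basis e)) (t b c))"
proof -
  have "dL \<iota> t b c d = (\<Sum>x\<in>cbasis. \<Sum>y\<in>cbasis. - (\<Sum>e\<in>cbasis. (coord b x * coord c y * coord d (\<iota> e)) *\<^sub>C extend_derivation (Lop (dual_basis e)) (t x y)))"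
    by (simp add: dL_def ext2_def sum_fun_apply pure3_def)
  also have "\<dots> = - (\<Sum>x\<in>cbasis. coord b x *\<^sub>C (\<Sum>y\<in>cbasis. coord c y *\<^sub>C (\<Sum>e\<in>cbasis. coord d (\<iota> e) *\<^sub>C extend_derivation (Lop (dual_basis e)) (t x y))))"
    by (simp add: cvec.scale_sum_right cscale_cscale ac_simps sum_negf)
  finally show ?thesis by (simp only: sum_coord assms)
qed

section \<open>The double\<close>

lemma double_pairing_simp [simp]: "double_pairing (x, \<xi>) (y, \<eta>) = cd_app \<xi> y + cd_app \<eta> x"
  by (simp add: double_pairing_def)

lemma clinear_double_pairing: "clinear (double_pairing z)" "clinear (\<lambda>z. double_pairing z w)"
  by (auto intro!: clinearI simp: double_pairing_def case_prod_unfold cd_app_linear algebra_simps)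

lemma separated_by_dual:
  fixes x y :: "'a::fd_complex_space"
  assumes "\<And>\<phi>. cd_app \<phi> x = cd_app \<phi> y" shows "x = y"
proof -
  have "coord b x = coord b y" for b using assms[of "dual_basis b"] by simp
  then have "(\<Sum>b\<in>cbasis. coord b x *\<^sub>C b) = (\<Sum>b\<in>cbasis. coord b y *\<^sub>C b)" by simp
  then show ?thesis by (simp only: coord_expand)
qed

lemma double_pairing_nondegenerate:
  fixes z :: "'a::fd_complex_space \<times> 'a cdual"
  assumes "\<And>v. double_pairing z v = double_pairing w v" shows "z = w"
proof (cases z; cases w)
  fix x \<xi> y \<eta> assume eq: "z = (x, \<xi>)" "w = (y, \<eta>)"
  have "cd_app \<phi> x = cd_app \<phi> y" for \<phi> using assms[of "(0, \<phi>)"] by (simp add: eq cd_app_linear)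
  moreover have "cd_app \<xi> v = cd_app \<eta> v" for v using assms[of "(v, 0)"] by (simp add: eq)
  ultimately show "z = w" unfolding eq by (simp add: separated_by_dual cd_eqI)
qed

locale lie_bialg =
  fixes br :: "'h::fd_complex_space \<Rightarrow> 'h \<Rightarrow> 'h" and \<delta> :: "'h \<Rightarrow> 'h \<Rightarrow> 'h \<Rightarrow> complex"
  assumes lie_bialgebra: "lie_bialgebra br \<delta>"
begin

abbreviation dbr (infixl "\<star>" 70) where "z \<star> w \<equiv> double_bracket br \<delta> z w"

lemma clinear_br: "clinear (br x)" and clinear_br_left: "clinear (\<lambda>x. br x y)"
  and br_self: "br x x = 0"
  and jacobi: "br x (br y z) + br y (br z x) + br z (br x y) = 0"
  and clinear_\<delta>: "clinear \<delta>" and \<delta>_wedge2: "\<delta> x \<in> wedge2 UNIV"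
  and \<delta>_cojacobi: "Alt3 (cob2 \<delta> (\<delta> x)) = 0"
  and \<delta>_cocycle: "\<delta> (br x y) = ad2 br x (\<delta> y) - ad2 br y (\<delta> x)"
  using lie_bialgebra unfolding lie_bialgebra_def lie_algebra_def cbilinear_def by blast+

lemma br_skew: "br x y = - br y x"
proof -
  have "br x y + br y x = 0"
  proof -
    have "br (x + y) (x + y) = br x x + br y x + (br x y + br y y)"
      by (simp only: clinear_add[OF clinear_br] clinear_add[OF clinear_br_left])
    then show ?thesis by (simp add: br_self add.commute)
  qed
  then show ?thesis by (simp add: eq_neg_iff_add_eq_0)
qed

lemma \<delta>_skew: "\<delta> x b c = - \<delta> x c b"
  using \<delta>_wedge2[of x] unfolding wedge2_def mem_Collect_eq by blast

lemmas cd_app_dual_bracket = cd_app_dual_bracket[OF clinear_\<delta>]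

lemma clinear_dual_bracket: "clinear (dual_bracket \<delta> \<phi>)" "clinear (\<lambda>\<phi>. dual_bracket \<delta> \<phi> \<psi>)"
  by (auto intro!: clinearI cd_eqI
      simp: cd_app_dual_bracket algebra_simps sum.distrib sum_distrib_left)

lemma dual_bracket_skew: "dual_bracket \<delta> \<phi> \<psi> = - dual_bracket \<delta> \<psi> \<phi>"
proof (rule cd_eqI)
  fix x
  have "cd_app (dual_bracket \<delta> \<phi> \<psi>) x = (\<Sum>b\<in>cbasis. \<Sum>c\<in>cbasis. - (\<delta> x c b * cd_app \<psi> c * cd_app \<phi> b))"
    unfolding cd_app_dual_bracket by (intro sum.cong refl) (subst \<delta>_skew, simp)
  also have "\<dots> = - cd_app (dual_bracket \<delta> \<psi> \<phi>) x"
    unfolding cd_app_dual_bracket by (subst sum.swap) (simp add: sum_negf)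
  finally show "cd_app (dual_bracket \<delta> \<phi> \<psi>) x = cd_app (- dual_bracket \<delta> \<psi> \<phi>) x" by simp
qed

lemma cd_app_contract: "cd_app \<phi> (contract \<delta> \<psi> x) = cd_app (dual_bracket \<delta> \<psi> \<phi>) x"
  by (simp add: contract_def ext2_def cd_app_dual_bracket cd_app_linear)

lemma precomp_br [simp]: "cd_app (precomp (br x) \<phi>) y = cd_app \<phi> (br x y)"
  by (rule cd_app_precomp[OF clinear_br])

lemma double_bracket_simp:
  "(x, \<xi>) \<star> (y, \<eta>) = (br x y + contract \<delta> \<eta> x - contract \<delta> \<xi> y,
      dual_bracket \<delta> \<xi> \<eta> - precomp (br x) \<eta> + precomp (br y) \<xi>)"
  by (simp add: double_bracket_def)

lemma invariant: "double_pairing (a \<star> b) c = double_pairing a (b \<star> c)"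
  by (rule double_pairing_invariant[OF lie_bialgebra])

text \<open>As the pairing is nondegenerate, this form determines the bracket of the double, and identities
  for the bracket are proved for the form.\<close>

lemma trilinear_form:
  "double_pairing ((x, \<xi>) \<star> (y, \<eta>)) (z, \<theta>) =
     cd_app \<theta> (br x y) + cd_app \<xi> (br y z) + cd_app \<eta> (br z x) +
     cd_app (dual_bracket \<delta> \<eta> \<theta>) x + cd_app (dual_bracket \<delta> \<theta> \<xi>) y + cd_app (dual_bracket \<delta> \<xi> \<eta>) z"
  using br_skew[of x z] dual_bracket_skew[of \<theta> \<xi>]
  by (simp add: double_bracket_simp cd_app_contract cd_app_linear clinear_neg[OF clinear_cd_app])

lemma double_bracket_skew: "a \<star> b = - (b \<star> a)"
proof (rule double_pairing_nondegenerate)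
  fix v :: "'h \<times> 'h cdual"
  obtain x \<xi> y \<eta> z \<theta> where eq: "a = (x, \<xi>)" "b = (y, \<eta>)" "v = (z, \<theta>)" by (metis surj_pair)
  have "double_pairing (- (b \<star> a)) v = - double_pairing (b \<star> a) v"
    by (rule clinear_neg[OF clinear_double_pairing(2)])
  then show "double_pairing (a \<star> b) v = double_pairing (- (b \<star> a)) v"
    unfolding eq trilinear_form
    using br_skew[of x z] br_skew[of y z] br_skew[of x y]
      dual_bracket_skew[of \<theta> \<xi>] dual_bracket_skew[of \<xi> \<eta>] dual_bracket_skew[of \<eta> \<theta>]
    by (simp add: clinear_neg[OF clinear_cd_app])
qed

lemma pairing_ad_skew: "double_pairing (a \<star> b) c = - double_pairing b (a \<star> c)"
  by (subst double_bracket_skew) (simp only: clinear_neg[OF clinear_double_pairing(2)] invariant)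

lemma clinear_double_bracket: "clinear (\<lambda>b. a \<star> b)"
proof (rule clinearI; rule double_pairing_nondegenerate)
  fix b c v and k :: complex
  show "double_pairing (a \<star> (b + c)) v = double_pairing (a \<star> b + a \<star> c) v"
    by (simp add: pairing_ad_skew clinear_add[OF clinear_double_pairing(2)])
  show "double_pairing (a \<star> (k *\<^sub>C b)) v = double_pairing (k *\<^sub>C (a \<star> b)) v"
    by (simp add: pairing_ad_skew clinear_scale[OF clinear_double_pairing(2)])
qed

lemma clinear_double_bracket_left: "clinear (\<lambda>a. a \<star> b)"
proof -
  have "(\<lambda>a. a \<star> b) = (\<lambda>a. - (b \<star> a))" by (rule ext) (rule double_bracket_skew)
  then show ?thesis
    using clinear_double_bracket[of b] by (simp add: clinear_iff)
qed

text \<open>Evaluation on elements of the dual frees the axioms on the cobracket from tensor coordinates.\<close>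

lemma cojacobi:
  "cd_app (dual_bracket \<delta> (dual_bracket \<delta> \<phi> \<psi>) \<chi>) x + cd_app (dual_bracket \<delta> (dual_bracket \<delta> \<psi> \<chi>) \<phi>) x
    + cd_app (dual_bracket \<delta> (dual_bracket \<delta> \<chi> \<phi>) \<psi>) x = 0"
proof -
  define C where "C = cob2 \<delta> (\<delta> x)"
  define S where "S = (\<lambda>\<phi> \<psi> \<chi> (C :: 'h \<Rightarrow> 'h \<Rightarrow> 'h \<Rightarrow> complex). \<Sum>b\<in>cbasis. \<Sum>c\<in>cbasis. \<Sum>d\<in>cbasis.
     C b c d * (cd_app \<phi> b * cd_app \<psi> c * cd_app \<chi> d))"
  have eq: "cd_app (dual_bracket \<delta> (dual_bracket \<delta> \<phi> \<psi>) \<chi>) x = S \<phi> \<psi> \<chi> C" for \<phi> \<psi> \<chi>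
  proof -
    let ?f = "\<lambda>p b c d. \<delta> p b c * \<delta> x p d * (cd_app \<phi> b * cd_app \<psi> c * cd_app \<chi> d)"
    have "S \<phi> \<psi> \<chi> C = (\<Sum>b\<in>cbasis. \<Sum>c\<in>cbasis. \<Sum>d\<in>cbasis. \<Sum>p\<in>cbasis. ?f p b c d)"
      by (simp add: S_def C_def cob2_apply sum_distrib_right)
    also have "\<dots> = (\<Sum>b\<in>cbasis. \<Sum>c\<in>cbasis. \<Sum>p\<in>cbasis. \<Sum>d\<in>cbasis. ?f p b c d)"
      by (rule sum.cong[OF refl], rule sum_swap_inner)
    also have "\<dots> = (\<Sum>b\<in>cbasis. \<Sum>p\<in>cbasis. \<Sum>c\<in>cbasis. \<Sum>d\<in>cbasis. ?f p b c d)"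
      by (rule sum_swap_inner)
    also have "\<dots> = (\<Sum>p\<in>cbasis. \<Sum>b\<in>cbasis. \<Sum>c\<in>cbasis. \<Sum>d\<in>cbasis. ?f p b c d)"
      by (rule sum.swap)
    also have "\<dots> = (\<Sum>p\<in>cbasis. \<Sum>d\<in>cbasis. \<Sum>b\<in>cbasis. \<Sum>c\<in>cbasis. ?f p b c d)"
    proof (rule sum.cong[OF refl])
      fix p
      have "(\<Sum>b\<in>cbasis. \<Sum>c\<in>cbasis. \<Sum>d\<in>cbasis. ?f p b c d) = (\<Sum>b\<in>cbasis. \<Sum>d\<in>cbasis. \<Sum>c\<in>cbasis. ?f p b c d)"
        by (rule sum_swap_inner)
      also have "\<dots> = (\<Sum>d\<in>cbasis. \<Sum>b\<in>cbasis. \<Sum>c\<in>cbasis. ?f p b c d)"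
        by (rule sum.swap)
      finally show "(\<Sum>b\<in>cbasis. \<Sum>c\<in>cbasis. \<Sum>d\<in>cbasis. ?f p b c d) = (\<Sum>d\<in>cbasis. \<Sum>b\<in>cbasis. \<Sum>c\<in>cbasis. ?f p b c d)" .
    qed
    also have "\<dots> = cd_app (dual_bracket \<delta> (dual_bracket \<delta> \<phi> \<psi>) \<chi>) x"
      by (simp add: cd_app_dual_bracket sum_distrib_left sum_distrib_right ac_simps)
    finally show ?thesis ..
  qed
  have cyc: "S \<psi> \<chi> \<phi> C = S \<phi> \<psi> \<chi> (\<lambda>b c d. C c d b)" for \<phi> \<psi> \<chi> C
  proof -
    have "S \<psi> \<chi> \<phi> C = (\<Sum>c\<in>cbasis. \<Sum>b\<in>cbasis. \<Sum>d\<in>cbasis. C c d b * (cd_app \<psi> c * cd_app \<chi> d * cd_app \<phi> b))"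
      unfolding S_def by (rule sum_swap_inner)
    also have "\<dots> = S \<phi> \<psi> \<chi> (\<lambda>b c d. C c d b)"
      unfolding S_def by (subst sum.swap) (simp add: ac_simps)
    finally show ?thesis .
  qed
  have "S \<phi> \<psi> \<chi> C + S \<psi> \<chi> \<phi> C + S \<chi> \<phi> \<psi> C = S \<phi> \<psi> \<chi> (Alt3 C)"
  proof -
    have "S \<chi> \<phi> \<psi> C = S \<psi> \<chi> \<phi> (\<lambda>b c d. C c d b)"
      by (rule cyc)
    also have "\<dots> = S \<phi> \<psi> \<chi> (\<lambda>b c d. C d b c)"
      by (rule cyc)
    finally have 1: "S \<chi> \<phi> \<psi> C = S \<phi> \<psi> \<chi> (\<lambda>b c d. C d b c)" .
    have 2: "S \<psi> \<chi> \<phi> C = S \<phi> \<psi> \<chi> (\<lambda>b c d. C c d b)"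
      by (rule cyc)
    show ?thesis
      unfolding 1 2 by (simp add: S_def Alt3_def sum.distrib distrib_right)
  qed
  also have "\<dots> = 0" using \<delta>_cojacobi[of x] by (simp add: C_def S_def)
  finally show ?thesis by (simp add: eq)
qed

lemma cocycle:
  "cd_app (dual_bracket \<delta> \<phi> \<psi>) (br x y) =
     cd_app (dual_bracket \<delta> (precomp (br x) \<phi>) \<psi>) y + cd_app (dual_bracket \<delta> \<phi> (precomp (br x) \<psi>)) y
   - cd_app (dual_bracket \<delta> (precomp (br y) \<phi>) \<psi>) x - cd_app (dual_bracket \<delta> \<phi> (precomp (br y) \<psi>)) x"
proof -
  have ad: "(\<Sum>b\<in>cbasis. \<Sum>c\<in>cbasis. ad2 br x (\<delta> y) b c * cd_app \<phi> b * cd_app \<psi> c) =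
     cd_app (dual_bracket \<delta> (precomp (br x) \<phi>) \<psi>) y + cd_app (dual_bracket \<delta> \<phi> (precomp (br x) \<psi>)) y" for x y
  proof -
    have "(\<Sum>b\<in>cbasis. \<Sum>c\<in>cbasis. ad2 br x (\<delta> y) b c * cd_app \<phi> b * cd_app \<psi> c) =
      (\<Sum>b\<in>cbasis. \<Sum>c\<in>cbasis. \<Sum>p\<in>cbasis. coord b (br x p) * \<delta> y p c * (cd_app \<phi> b * cd_app \<psi> c)) +
      (\<Sum>b\<in>cbasis. \<Sum>c\<in>cbasis. \<Sum>p\<in>cbasis. coord c (br x p) * \<delta> y b p * (cd_app \<phi> b * cd_app \<psi> c))"
      by (simp add: ad2_apply sum.distrib sum_distrib_right distrib_right mult.assoc)
    also have "(\<Sum>b\<in>cbasis. \<Sum>c\<in>cbasis. \<Sum>p\<in>cbasis. coord b (br x p) * \<delta> y p c * (cd_app \<phi> b * cd_app \<psi> c))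
      = (\<Sum>c\<in>cbasis. \<Sum>p\<in>cbasis. \<delta> y p c * (\<Sum>b\<in>cbasis. coord b (br x p) * cd_app \<phi> b) * cd_app \<psi> c)"
    proof -
      let ?f = "\<lambda>b c p. coord b (br x p) * \<delta> y p c * (cd_app \<phi> b * cd_app \<psi> c)"
      have "(\<Sum>b\<in>cbasis. \<Sum>c\<in>cbasis. \<Sum>p\<in>cbasis. ?f b c p) = (\<Sum>c\<in>cbasis. \<Sum>b\<in>cbasis. \<Sum>p\<in>cbasis. ?f b c p)"
        by (rule sum.swap)
      also have "\<dots> = (\<Sum>c\<in>cbasis. \<Sum>p\<in>cbasis. \<Sum>b\<in>cbasis. ?f b c p)"
        by (rule sum_swap_inner)
      finally show ?thesis by (simp add: sum_distrib_left sum_distrib_right ac_simps)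
    qed
    also have "\<dots> = (\<Sum>p\<in>cbasis. \<Sum>c\<in>cbasis. \<delta> y p c * cd_app \<phi> (br x p) * cd_app \<psi> c)"
      by (subst sum.swap) (simp only: cd_app_expand)
    also have "(\<Sum>b\<in>cbasis. \<Sum>c\<in>cbasis. \<Sum>p\<in>cbasis. coord c (br x p) * \<delta> y b p * (cd_app \<phi> b * cd_app \<psi> c))
      = (\<Sum>b\<in>cbasis. \<Sum>p\<in>cbasis. \<delta> y b p * cd_app \<phi> b * (\<Sum>c\<in>cbasis. coord c (br x p) * cd_app \<psi> c))"
    proof -
      let ?f = "\<lambda>b c p. coord c (br x p) * \<delta> y b p * (cd_app \<phi> b * cd_app \<psi> c)"
      have "(\<Sum>b\<in>cbasis. \<Sum>c\<in>cbasis. \<Sum>p\<in>cbasis. ?f b c p) = (\<Sum>b\<in>cbasis. \<Sum>p\<in>cbasis. \<Sum>c\<in>cbasis. ?f b c p)"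
        by (rule sum_swap_inner)
      then show ?thesis by (simp add: sum_distrib_left ac_simps)
    qed
    also have "\<dots> = (\<Sum>b\<in>cbasis. \<Sum>p\<in>cbasis. \<delta> y b p * cd_app \<phi> b * cd_app \<psi> (br x p))"
      by (simp only: cd_app_expand)
    finally show ?thesis by (simp add: cd_app_dual_bracket)
  qed
  have "cd_app (dual_bracket \<delta> \<phi> \<psi>) (br x y) =
     (\<Sum>b\<in>cbasis. \<Sum>c\<in>cbasis. ad2 br x (\<delta> y) b c * cd_app \<phi> b * cd_app \<psi> c) -
     (\<Sum>b\<in>cbasis. \<Sum>c\<in>cbasis. ad2 br y (\<delta> x) b c * cd_app \<phi> b * cd_app \<psi> c)"
    by (simp add: cd_app_dual_bracket \<delta>_cocycle left_diff_distrib sum_subtractf)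
  then show ?thesis by (simp add: ad)
qed

lemma zero_simps: "br 0 x = 0" "contract \<delta> \<xi> 0 = 0" "precomp (br 0) \<xi> = 0"
  using clinear_zero[OF clinear_br_left] clinear_zero[OF clinear_\<delta>]
  by (auto simp: contract_def ext2_def intro!: cd_eqI simp: cd_app_linear)

end


context lie_bialg
begin

text \<open>According to the number of arguments in the dual, the components of this identity are the
  Jacobi identity, the cocycle condition and the co-Jacobi identity.\<close>

lemma trilinear_form_ad_invariant:
  "double_pairing (((0, \<zeta>) \<star> a) \<star> b) c + double_pairing (a \<star> ((0, \<zeta>) \<star> b)) c
    + double_pairing (a \<star> b) ((0, \<zeta>) \<star> c) = 0"
proof -
  obtain x \<xi> y \<eta> z \<theta> where eq: "a = (x, \<xi>)" "b = (y, \<eta>)" "c = (z, \<theta>)" by (metis surj_pair)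
  have ad: "(0, \<zeta>) \<star> (x, \<xi>) = (- contract \<delta> \<zeta> x, dual_bracket \<delta> \<zeta> \<xi> + precomp (br x) \<zeta>)" for x \<xi>
    by (simp add: double_bracket_simp zero_simps)
  note lin = clinear_add[OF clinear_dual_bracket(1)] clinear_add[OF clinear_dual_bracket(2)]
    clinear_neg[OF clinear_cd_app] clinear_neg[OF clinear_br] clinear_neg[OF clinear_br_left]
  have pc: "cd_app \<phi> (br x (contract \<delta> \<zeta> y)) = cd_app (dual_bracket \<delta> \<zeta> (precomp (br x) \<phi>)) y"
    "cd_app \<phi> (br (contract \<delta> \<zeta> y) x) = - cd_app (dual_bracket \<delta> \<zeta> (precomp (br x) \<phi>)) y" for \<phi> x y
  proof -
    show "cd_app \<phi> (br x (contract \<delta> \<zeta> y)) = cd_app (dual_bracket \<delta> \<zeta> (precomp (br x) \<phi>)) y"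
      by (simp flip: precomp_br add: cd_app_contract)
    then show "cd_app \<phi> (br (contract \<delta> \<zeta> y) x) = - cd_app (dual_bracket \<delta> \<zeta> (precomp (br x) \<phi>)) y"
      by (subst br_skew) (simp add: clinear_neg[OF clinear_cd_app])
  qed
  have jac: "cd_app \<zeta> (br x (br y z)) + cd_app \<zeta> (br y (br z x)) + cd_app \<zeta> (br z (br x y)) = 0"
    using arg_cong[OF jacobi[of x y z], of "cd_app \<zeta>"] by (simp add: cd_app_linear)
  have skew: "cd_app (dual_bracket \<delta> \<phi> \<psi>) v = - cd_app (dual_bracket \<delta> \<psi> \<phi>) v" for \<phi> \<psi> v
    by (subst dual_bracket_skew) simp
  have skew2: "cd_app (dual_bracket \<delta> (dual_bracket \<delta> \<phi> \<psi>) \<chi>) v = - cd_app (dual_bracket \<delta> \<chi> (dual_bracket \<delta> \<phi> \<psi>)) v"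
    "cd_app (dual_bracket \<delta> \<chi> (dual_bracket \<delta> \<phi> \<psi>)) v = - cd_app (dual_bracket \<delta> \<chi> (dual_bracket \<delta> \<psi> \<phi>)) v" for \<phi> \<psi> \<chi> v
    by (rule skew) (subst (2) dual_bracket_skew, simp add: clinear_neg[OF clinear_dual_bracket(1)])
  note cyc = cocycle[of \<zeta> \<theta> x y] cocycle[of \<zeta> \<xi> y z] cocycle[of \<zeta> \<eta> z x]
  note sk = skew[of \<theta> "precomp (br x) \<zeta>" y] skew[of \<xi> "precomp (br y) \<zeta>" z] skew[of \<eta> "precomp (br z) \<zeta>" x]
  have cj: "cd_app (dual_bracket \<delta> \<zeta> (dual_bracket \<delta> \<phi> \<psi>)) v =
    cd_app (dual_bracket \<delta> (dual_bracket \<delta> \<zeta> \<phi>) \<psi>) v + cd_app (dual_bracket \<delta> \<phi> (dual_bracket \<delta> \<zeta> \<psi>)) v" for \<phi> \<psi> v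
  proof -
    have "cd_app (dual_bracket \<delta> (dual_bracket \<delta> \<phi> \<psi>) \<zeta>) v = - cd_app (dual_bracket \<delta> \<zeta> (dual_bracket \<delta> \<phi> \<psi>)) v"
      "cd_app (dual_bracket \<delta> (dual_bracket \<delta> \<psi> \<zeta>) \<phi>) v = cd_app (dual_bracket \<delta> \<phi> (dual_bracket \<delta> \<zeta> \<psi>)) v"
      by (rule skew) (subst skew, subst dual_bracket_skew, simp add: clinear_neg[OF clinear_dual_bracket(1)])
    then show ?thesis using cojacobi[of \<zeta> \<phi> \<psi> v] by (simp add: algebra_simps)
  qed
  show ?thesis
    unfolding eq ad trilinear_form
    using jac cj[of \<eta> \<theta> x] cj[of \<theta> \<xi> y] cj[of \<xi> \<eta> z] cyc sk
    by (simp add: lin pc cd_app_contract complex_eq_iff)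
qed

text \<open>This case of the Jacobi identity of the double makes the double a module over the Lie algebra
  \<open>\<hh>\<^sup>*\<close>, hence over its formal group.\<close>

lemma double_bracket_derivation:
  "(0, \<zeta>) \<star> (a \<star> b) = ((0, \<zeta>) \<star> a) \<star> b + a \<star> ((0, \<zeta>) \<star> b)"
proof (rule double_pairing_nondegenerate)
  fix c
  show "double_pairing ((0, \<zeta>) \<star> (a \<star> b)) c = double_pairing (((0, \<zeta>) \<star> a) \<star> b + a \<star> ((0, \<zeta>) \<star> b)) c"
    using trilinear_form_ad_invariant[of \<zeta> a b c]
    by (simp add: pairing_ad_skew[of "(0, \<zeta>)" "a \<star> b"] clinear_add[OF clinear_double_pairing(2)]
        neg_eq_iff_add_eq_0 ac_simps)
qed

end

section \<open>The matrix coefficients of the adjoint action on the double\<close>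

text \<open>The coordinates on the double: \<open>Inl p\<close> for the Lie bialgebra, \<open>Inr p\<close> for its dual.\<close>

definition double_index :: "('h::complex_space + 'h) set" where
  "double_index = cbasis <+> cbasis"

fun double_coord :: "'h::complex_space + 'h \<Rightarrow> 'h \<times> 'h cdual \<Rightarrow> complex" where
  "double_coord (Inl p) z = coord p (fst z)"
| "double_coord (Inr p) z = cd_app (snd z) p"

fun double_basis :: "'h::complex_space + 'h \<Rightarrow> 'h \<times> 'h cdual" where
  "double_basis (Inl p) = (p, 0)"
| "double_basis (Inr p) = (0, dual_basis p)"

lemma sum_double_index:
  "(\<Sum>k\<in>(double_index :: ('h::fd_complex_space + 'h) set). f k) =
     (\<Sum>p\<in>cbasis. f (Inl p)) + (\<Sum>p\<in>cbasis. f (Inr p))"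
proof -
  have "sum f (Inl ` cbasis \<union> Inr ` cbasis) = sum f (Inl ` cbasis) + sum f (Inr ` (cbasis :: 'h set))"
    by (rule sum.union_disjoint) (auto simp: finite_cbasis)
  then show ?thesis
    by (simp add: double_index_def Plus_def sum.reindex inj_on_def)
qed

lemma clinear_double_coord: "clinear (double_coord k)"
  by (cases k) (auto intro!: clinearI simp: clinear_add[OF clinear_coord] clinear_scale[OF clinear_coord])

lemma double_expand:
  "(\<Sum>k\<in>double_index. double_coord k z *\<^sub>C double_basis k) = (z :: 'h::fd_complex_space \<times> 'h cdual)"
proof -
  have fst: "fst (\<Sum>a\<in>A. f a) = (\<Sum>a\<in>A. fst (f a))" and snd: "snd (\<Sum>a\<in>A. f a) = (\<Sum>a\<in>A. snd (f a))"
    for A :: "'h set" and f :: "'h \<Rightarrow> 'h \<times> 'h cdual"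
    by (induction A rule: infinite_finite_induct) simp_all
  show ?thesis
    by (simp add: sum_double_index prod_eq_iff fst snd coord_expand cd_expand)
qed

lemma clinear_double_expand:
  fixes f :: "'h::fd_complex_space \<times> 'h cdual \<Rightarrow> 'r::complex_space"
  assumes "clinear f"
  shows "(\<Sum>k\<in>double_index. double_coord k z *\<^sub>C f (double_basis k)) = f z"
  by (subst (2) double_expand[of z, symmetric])
     (simp add: clinear_sum[OF assms] clinear_scale[OF assms])

context lie_bialg
begin

text \<open>\<open>Ad_fun j k z\<close> is the \<open>k\<close>-th coordinate of \<open>Ad(j(x)\<^sup>-\<^sup>1)(z)\<close>, as a function of \<open>x\<close>.\<close>

definition Ad_fun :: "('x \<Rightarrow> 'h cdual) \<Rightarrow> 'h + 'h \<Rightarrow> 'h \<times> 'h cdual \<Rightarrow> 'x wfun" where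
  "Ad_fun j k z = WFun (\<lambda>w. double_coord k (Ad_inv br \<delta> z (map j w)))"

lemma Ad_inv_Nil [simp]: "Ad_inv br \<delta> z [] = z"
  and Ad_inv_Cons [simp]: "Ad_inv br \<delta> z (\<xi> # w) = Ad_inv br \<delta> (- ((0, \<xi>) \<star> z)) w"
  and Ad_inv_snoc [simp]: "Ad_inv br \<delta> z (w @ [\<xi>]) = - ((0, \<xi>) \<star> Ad_inv br \<delta> z w)"
  by (simp_all add: Ad_inv_def)

lemma clinear_Ad_inv: "clinear (\<lambda>z. Ad_inv br \<delta> z w)"
proof (induction w)
  case (Cons \<xi> w)
  have "clinear (\<lambda>z. - ((0, \<xi>) \<star> z))"
    using clinear_double_bracket[of "(0, \<xi>)"] by (simp add: clinear_iff)
  from clinear_compose[OF Cons this] show ?case by simp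
qed (simp add: clinear_iff)

lemma wval_Ad_fun: "wval (Ad_fun j k z) w = double_coord k (Ad_inv br \<delta> z (map j w))"
  by (simp add: Ad_fun_def)

lemma clinear_Ad_fun: "clinear (Ad_fun j k)"
  by (intro clinearI; intro wfun_eqI)
     (simp_all add: wval_Ad_fun clinear_add[OF clinear_Ad_inv] clinear_scale[OF clinear_Ad_inv]
        clinear_add[OF clinear_double_coord] clinear_scale[OF clinear_double_coord])

lemma shift_Ad_fun: "shift x (Ad_fun j k z) = - Ad_fun j k ((0, j x) \<star> z)"
  by (rule wfun_eqI) (simp add: wval_Ad_fun clinear_neg[OF clinear_Ad_inv] clinear_neg[OF clinear_double_coord])

text \<open>As \<open>x\<close> becomes \<open>e\<^sup>-\<^sup>\<epsilon>\<^sup>\<zeta>x\<close>, the element \<open>Ad(x\<^sup>-\<^sup>1)(z)\<close> becomes \<open>Ad(x\<^sup>-\<^sup>1)(z + \<epsilon>[\<zeta>, z])\<close>;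
  a right translation acts on the value \<open>Ad(x\<^sup>-\<^sup>1)(z)\<close> itself.\<close>

lemma Lop_Ad_fun: "Lop x (Ad_fun j k z) = Ad_fun j k ((0, j x) \<star> z)"
  by (simp add: Lop_shift shift_Ad_fun)

lemma Rop_Ad_fun:
  "Rop x (Ad_fun j k z) =
     - (\<Sum>m\<in>double_index. double_coord k ((0, j x) \<star> double_basis m) *\<^sub>C Ad_fun j m z)"
proof (rule wfun_eqI)
  fix w
  have "clinear (\<lambda>v. double_coord k ((0, j x) \<star> v))"
    by (rule clinear_compose[OF clinear_double_coord clinear_double_bracket])
  from clinear_double_expand[OF this, of "Ad_inv br \<delta> z (map j w)"]
  show "wval (Rop x (Ad_fun j k z)) w =
    wval (- (\<Sum>m\<in>double_index. double_coord k ((0, j x) \<star> double_basis m) *\<^sub>C Ad_fun j m z)) w"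
    by (simp add: wval_Ad_fun clinear_neg[OF clinear_double_coord] mult.commute)
qed

lemma formal_functions_Ad_fun:
  assumes j: "clinear j" "\<And>x y. j (br' x y) = dual_bracket \<delta> (j x) (j y)"
  shows "Ad_fun j k z \<in> formal_functions br'"
  unfolding formal_functions_shift_iff
proof
  fix p
  have "\<exists>z'. fold shift p (Ad_fun j k z) = Ad_fun j k z'"
  proof (induction p arbitrary: z)
    case (Cons x p)
    then show ?case by (simp add: shift_Ad_fun clinear_neg[OF clinear_Ad_fun, symmetric])
  qed auto
  then obtain z' where z': "fold shift p (Ad_fun j k z) = Ad_fun j k z'" ..
  have br0: "(0, j (br' x y)) = (0, j x) \<star> (0, j y)" for x y
    by (simp add: double_bracket_simp j(2) zero_simps)
  have jac: "(0, j (br' x y)) \<star> z' = (0, j x) \<star> ((0, j y) \<star> z') - (0, j y) \<star> ((0, j x) \<star> z')" for x y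
    using double_bracket_derivation[of "j x" "(0, j y)" z'] by (simp add: br0)
  have add: "(0::'h, j (x + y)) = (0, j x) + (0, j y)" "(0::'h, j (c *\<^sub>C x)) = c *\<^sub>C (0, j x)" for x y c
    using j(1) by (simp_all add: clinear_iff)
  show "local_relations br' (fold shift p (Ad_fun j k z))"
    unfolding z' local_relations_def shift_Ad_fun jac add
    by (simp add: clinear_add[OF clinear_double_bracket_left] clinear_scale[OF clinear_double_bracket_left]
        clinear_add[OF clinear_Ad_fun] clinear_scale[OF clinear_Ad_fun] clinear_diff[OF clinear_Ad_fun]
        shift_Ad_fun del: cscale_Pair add_Pair)
qed

text \<open>The dual is a subalgebra of the double, hence stable under its own group.\<close>

lemma Ad_fun_dual: "Ad_fun j (Inl p) (0, \<xi>) = 0"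
proof (rule wfun_eqI)
  fix w
  have ad: "fst ((0, \<zeta>) \<star> (0, \<xi>)) = 0" for \<zeta> \<xi>
    using clinear_zero[OF clinear_br_left] clinear_zero[OF clinear_\<delta>]
    by (simp add: double_bracket_simp contract_def ext2_def)
  have "fst z = 0 \<Longrightarrow> fst (Ad_inv br \<delta> z w) = 0" for z w
  proof (induction w arbitrary: z)
    case (Cons \<zeta> w)
    then show ?case using ad[of \<zeta> "snd z"] by (cases z) simp
  qed simp
  then show "wval (Ad_fun j (Inl p) (0, \<xi>)) w = wval 0 w"
    by (simp add: wval_Ad_fun clinear_zero[OF clinear_coord])
qed

text \<open>Invariant forms are preserved by \<open>Ad(x\<^sup>-\<^sup>1)\<close>.  The shifts of the left hand side are again
  such expressions, so it is determined by its values at the empty word.\<close>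

lemma Ad_fun_preserves_pairing:
  "(\<Sum>p\<in>cbasis. Ad_fun j (Inl p) a * Ad_fun j (Inr p) b + Ad_fun j (Inr p) a * Ad_fun j (Inl p) b) =
     double_pairing a b *\<^sub>C 1" (is "?P a b = _")
proof (rule wfun_eqI)
  fix w
  show "wval (?P a b) w = wval (double_pairing a b *\<^sub>C 1) w"
  proof (induction w arbitrary: a b)
    case Nil
    obtain x \<xi> y \<eta> where eq: "a = (x, \<xi>)" "b = (y, \<eta>)" by (metis surj_pair)
    show ?case
      using cd_app_expand[of x \<eta>] cd_app_expand[of y \<xi>]
      by (simp add: wval_Ad_fun eq wval_one sum.distrib mult.commute[of "cd_app \<xi> _"])
  next
    case (Cons x w)
    have neg: "?P (- a) b = - ?P a b" "?P a (- b) = - ?P a b" for a b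
      by (simp_all add: clinear_neg[OF clinear_Ad_fun] flip: sum_negf)
    have shift_sum: "shift x (\<Sum>p\<in>A. f p) = (\<Sum>p\<in>A. shift x (f p))" for f and A :: "'h set"
      by (rule clinear_sum[OF clinear_shift])
    have "shift x (?P a b) = - (?P ((0, j x) \<star> a) b + ?P a ((0, j x) \<star> b))"
      by (simp add: shift_sum shift_Ad_fun algebra_simps flip: sum.distrib sum_negf)
    then have "wval (?P a b) (x # w) = wval (- (?P ((0, j x) \<star> a) b + ?P a ((0, j x) \<star> b))) w"
      by (metis wval_shift)
    also have "\<dots> = 0"
      unfolding wval_simps Cons by (simp add: pairing_ad_skew)
    finally show ?case by (simp add: wval_one)
  qed
qed

lemma Ad_fun_preserves_trilinear_form:
  "(\<Sum>k\<in>double_index. \<Sum>l\<in>double_index. \<Sum>m\<in>double_index.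
      double_pairing (double_basis k \<star> double_basis l) (double_basis m) *\<^sub>C
        (Ad_fun j k a * Ad_fun j l b * Ad_fun j m c)) = double_pairing (a \<star> b) c *\<^sub>C 1"
  (is "?T a b c = _")
proof (rule wfun_eqI)
  fix w
  show "wval (?T a b c) w = wval (double_pairing (a \<star> b) c *\<^sub>C 1) w"
  proof (induction w arbitrary: a b c)
    case Nil
    have 1: "clinear (double_pairing (a \<star> b))" for a b by (rule clinear_double_pairing)
    have 2: "clinear (\<lambda>b. double_pairing (a \<star> b) c)" for a c
      by (rule clinear_compose[OF clinear_double_pairing(2) clinear_double_bracket])
    have 3: "clinear (\<lambda>a. double_pairing (a \<star> b) c)" for b c
      by (rule clinear_compose[OF clinear_double_pairing(2) clinear_double_bracket_left])
    have "wval (?T a b c) [] = (\<Sum>k\<in>double_index. double_coord k a *\<^sub>C (\<Sum>l\<in>double_index. double_coord l b *\<^sub>C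
      (\<Sum>m\<in>double_index. double_coord m c *\<^sub>C double_pairing (double_basis k \<star> double_basis l) (double_basis m))))"
      by (simp add: wval_Ad_fun sum_distrib_left ac_simps)
    also have "\<dots> = double_pairing (a \<star> b) c"
      by (simp only: clinear_double_expand[OF 1] clinear_double_expand[OF 2] clinear_double_expand[OF 3])
    finally show ?case by (simp add: wval_one)
  next
    case (Cons x w)
    have shift_sum: "shift x (\<Sum>p\<in>A. f p) = (\<Sum>p\<in>A. shift x (f p))" for f and A :: "('h + 'h) set"
      by (rule clinear_sum[OF clinear_shift])
    have "shift x (?T a b c) =
        - (?T ((0, j x) \<star> a) b c + ?T a ((0, j x) \<star> b) c + ?T a b ((0, j x) \<star> c))"
      by (simp add: shift_sum shift_Ad_fun algebra_simps cvec.scale_right_diff_distrib cscale_add_right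
          flip: sum.distrib sum_negf)
    then have "wval (?T a b c) (x # w) =
        wval (- (?T ((0, j x) \<star> a) b c + ?T a ((0, j x) \<star> b) c + ?T a b ((0, j x) \<star> c))) w"
      by (metis wval_shift)
    also have "\<dots> = - (double_pairing (((0, j x) \<star> a) \<star> b) c + double_pairing (a \<star> ((0, j x) \<star> b)) c
        + double_pairing (a \<star> b) ((0, j x) \<star> c)) * wval 1 w"
      unfolding wval_simps(2,4) Cons by (simp add: algebra_simps)
    also have "\<dots> = 0" by (simp only: trilinear_form_ad_invariant) simp
    finally show ?case by (simp add: wval_one)
  qed
qed

end


section \<open>Splittings\<close>

lemma tens_pairing_zero:
  fixes t :: "'a::fd_complex_space \<Rightarrow> 'a \<Rightarrow> complex"
  assumes "t \<in> tens S T" "\<And>x y. x \<in> S \<Longrightarrow> y \<in> T \<Longrightarrow> cd_app \<phi> x * cd_app \<psi> y = 0"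
  shows "(\<Sum>b\<in>cbasis. \<Sum>c\<in>cbasis. t b c * cd_app \<phi> b * cd_app \<psi> c) = 0"
  using assms(1) unfolding tens_def
proof (induction rule: cvec.span_induct_alt)
  case base
  then show ?case by simp
next
  case (step k s t)
  then obtain x y where s: "s = pure2 x y 1" "x \<in> S" "y \<in> T" by auto
  have "(\<Sum>b\<in>cbasis. \<Sum>c\<in>cbasis. s b c * cd_app \<phi> b * cd_app \<psi> c) =
     (\<Sum>b\<in>cbasis. coord b x * cd_app \<phi> b) * (\<Sum>c\<in>cbasis. coord c y * cd_app \<psi> c)"
    by (simp add: s(1) pure2_def sum_product ac_simps)
  also have "\<dots> = 0" using assms(2) s by (simp only: cd_app_expand)
  finally have "(\<Sum>b\<in>cbasis. \<Sum>c\<in>cbasis. s b c * cd_app \<phi> b * cd_app \<psi> c) = 0" .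
  then have "k * (\<Sum>b\<in>cbasis. \<Sum>c\<in>cbasis. s b c * cd_app \<phi> b * cd_app \<psi> c) = 0" by simp
  then show ?case
    using step.IH by (simp add: distrib_right sum.distrib sum_distrib_left mult.assoc)
qed

lemma dual_bracket_tmap2:
  fixes f :: "'a::fd_complex_space \<Rightarrow> 'b::fd_complex_space"
  assumes f: "clinear f" and \<delta>: "clinear \<delta>" "clinear \<delta>'" and eq: "\<delta>' (f x) = tmap2 f (\<delta> x)"
  shows "cd_app (dual_bracket \<delta>' \<phi> \<psi>) (f x) = cd_app (dual_bracket \<delta> (precomp f \<phi>) (precomp f \<psi>)) x"
proof -
  let ?h = "\<lambda>b c y z. \<delta> x y z * (coord b (f y) * cd_app \<phi> b) * (coord c (f z) * cd_app \<psi> c)"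
  have "cd_app (dual_bracket \<delta>' \<phi> \<psi>) (f x) = (\<Sum>b\<in>cbasis. \<Sum>c\<in>cbasis. \<Sum>y\<in>cbasis. \<Sum>z\<in>cbasis. ?h b c y z)"
    by (simp add: cd_app_dual_bracket[OF \<delta>(2)] eq tmap2_apply sum_distrib_left sum_distrib_right ac_simps)
  also have "\<dots> = (\<Sum>(b, c)\<in>cbasis \<times> cbasis. \<Sum>(y, z)\<in>cbasis \<times> cbasis. ?h b c y z)"
    by (simp add: sum.cartesian_product[symmetric])
  also have "\<dots> = (\<Sum>(y, z)\<in>cbasis \<times> cbasis. \<Sum>(b, c)\<in>cbasis \<times> cbasis. ?h b c y z)"
    unfolding case_prod_unfold by (rule sum.swap)
  also have "\<dots> = (\<Sum>y\<in>cbasis. \<Sum>z\<in>cbasis. \<delta> x y z * (\<Sum>b\<in>cbasis. coord b (f y) * cd_app \<phi> b) * (\<Sum>c\<in>cbasis. coord c (f z) * cd_app \<psi> c))"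
    by (simp add: sum.cartesian_product[symmetric] sum_distrib_left sum_distrib_right ac_simps)
  finally show ?thesis
    by (simp add: cd_app_expand cd_app_dual_bracket[OF \<delta>(1)] cd_app_precomp[OF f])
qed

locale splitting =
  fixes br :: "'g::fd_complex_space \<Rightarrow> 'g \<Rightarrow> 'g" and \<delta> :: "'g \<Rightarrow> 'g \<Rightarrow> 'g \<Rightarrow> complex"
    and br\<^sub>l :: "'l::fd_complex_space \<Rightarrow> 'l \<Rightarrow> 'l" and \<delta>\<^sub>l :: "'l \<Rightarrow> 'l \<Rightarrow> 'l \<Rightarrow> complex"
    and il :: "'l \<Rightarrow> 'g" and iu :: "'u::fd_complex_space \<Rightarrow> 'g"
  assumes splitting: "lie_bialgebra_splitting br \<delta> br\<^sub>l \<delta>\<^sub>l il iu"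
begin

sublocale lie_bialg br \<delta>
  using splitting by unfold_locales (simp add: lie_bialgebra_splitting_def lie_bialgebra_inclusion_def)

lemma lie_bialgebra_l: "lie_bialgebra br\<^sub>l \<delta>\<^sub>l"
  and clinear_il: "clinear il" and clinear_iu: "clinear iu" and inj_iu: "inj iu"
  and il_br: "il (br\<^sub>l x y) = br (il x) (il y)"
  and \<delta>_il: "\<delta> (il x) = tmap2 il (\<delta>\<^sub>l x)"
  and decomposition: "\<exists>!(y, u). z = il y + iu u"
  and br_il_iu: "br (il y) (iu u) \<in> range iu"
  and \<delta>_iu: "\<delta> (iu u) \<in> {r + s + t | r s t. r \<in> tens (range il) (range iu) \<and>
        s \<in> tens (range iu) (range il) \<and> t \<in> tens (range iu) (range iu)}"
  using splitting unfolding lie_bialgebra_splitting_def lie_bialgebra_inclusion_def by blast+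

definition pl :: "'g \<Rightarrow> 'l" where "pl = proj_l il iu"
definition pu :: "'g \<Rightarrow> 'u" where "pu z = inv_into UNIV iu (z - il (pl z))"

lemma pl_unique: "z = il y + iu u \<Longrightarrow> pl z = y"
  unfolding pl_def proj_l_def
proof (rule the_equality)
  fix y' assume z: "z = il y + iu u" "\<exists>u'. z = il y' + iu u'"
  then obtain u' where "z = il y' + iu u'" by blast
  with z(1) have "(y', u') = (y, u)"
    using decomposition[of z] by (elim ex1E) (metis (mono_tags, lifting) case_prod_conv)
  then show "y' = y" by simp
qed blast

lemma decompose: "il (pl z) + iu (pu z) = z"
proof -
  obtain y u where z: "z = il y + iu u" using decomposition[of z] by (auto simp: case_prod_unfold)
  have pl: "pl z = y" by (rule pl_unique[OF z])
  have "z - il (pl z) = iu u" unfolding pl by (simp add: z)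
  then have "pu z = u" using inj_iu by (simp add: pu_def)
  then show ?thesis unfolding pl by (simp add: z)
qed

lemma pu_unique: assumes "z = il y + iu u" shows "pu z = u"
  using decompose[of z] pl_unique[OF assms] assms inj_iu by (simp add: inj_eq)

lemma projections [simp]: "pl (il y) = y" "pl (iu u) = 0" "pu (il y) = 0" "pu (iu u) = u"
  using pl_unique[of "il y" y 0] pl_unique[of "iu u" 0 u] pu_unique[of "il y" y 0] pu_unique[of "iu u" 0 u]
  by (simp_all add: clinear_zero[OF clinear_il] clinear_zero[OF clinear_iu])

lemma clinear_projections: "clinear pl" "clinear pu"
proof -
  have add: "z + z' = il (pl z + pl z') + iu (pu z + pu z')" for z z'
  proof -
    have "z + z' = (il (pl z) + iu (pu z)) + (il (pl z') + iu (pu z'))" by (simp only: decompose)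
    then show ?thesis by (simp add: clinear_add[OF clinear_il] clinear_add[OF clinear_iu])
  qed
  have scale: "c *\<^sub>C z = il (c *\<^sub>C pl z) + iu (c *\<^sub>C pu z)" for c z
  proof -
    have "c *\<^sub>C z = c *\<^sub>C (il (pl z) + iu (pu z))" by (simp only: decompose)
    then show ?thesis by (simp add: clinear_scale[OF clinear_il] clinear_scale[OF clinear_iu] cscale_add_right)
  qed
  show "clinear pl" "clinear pu"
    using pl_unique[OF add] pu_unique[OF add] pl_unique[OF scale] pu_unique[OF scale]
    by (auto intro!: clinearI)
qed

lemma br_il_projections: "pl (br (il y) z) = br\<^sub>l y (pl z)"
proof -
  have "br (il y) z = br (il y) (il (pl z) + iu (pu z))" by (simp add: decompose)
  also have "\<dots> = il (br\<^sub>l y (pl z)) + br (il y) (iu (pu z))"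
    by (simp add: clinear_add[OF clinear_br] il_br)
  finally show ?thesis
    using br_il_iu[of y "pu z"] by (auto simp: clinear_add[OF clinear_projections(1)])
qed

abbreviation incl :: "'l cdual \<Rightarrow> 'g cdual" where "incl \<equiv> incl_dual il iu"
definition uincl :: "'u cdual \<Rightarrow> 'g cdual" where "uincl = precomp pu"

lemma cd_app_incl [simp]: "cd_app (incl \<phi>) z = cd_app \<phi> (pl z)"
  using cd_app_precomp[OF clinear_projections(1)] by (simp add: incl_dual_def pl_def)

lemma cd_app_uincl [simp]: "cd_app (uincl \<phi>) z = cd_app \<phi> (pu z)"
  by (simp add: uincl_def cd_app_precomp[OF clinear_projections(2)])

lemma cd_app_precomp_il [simp]: "cd_app (precomp il \<phi>) y = cd_app \<phi> (il y)"
  and cd_app_precomp_iu [simp]: "cd_app (precomp iu \<phi>) u = cd_app \<phi> (iu u)"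
  by (rule cd_app_precomp[OF clinear_il]) (rule cd_app_precomp[OF clinear_iu])

lemma clinear_incl: "clinear incl"
  by (intro clinearI cd_eqI) simp_all

lemma dual_decompose: "incl (precomp il \<phi>) + uincl (precomp iu \<phi>) = \<phi>"
proof (rule cd_eqI)
  fix z
  have "cd_app \<phi> z = cd_app \<phi> (il (pl z) + iu (pu z))" by (simp add: decompose)
  then show "cd_app (incl (precomp il \<phi>) + uincl (precomp iu \<phi>)) z = cd_app \<phi> z"
    by (simp add: cd_app_linear)
qed

abbreviation FG :: "'g cdual wfun set" where "FG \<equiv> formal_functions (dual_bracket \<delta>)"
abbreviation FL :: "'l cdual wfun set" where "FL \<equiv> formal_functions (dual_bracket \<delta>\<^sub>l)"

lemma clinear_\<delta>l: "clinear \<delta>\<^sub>l"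
  using lie_bialgebra_l by (simp add: lie_bialgebra_def)

lemma dual_bracket_il:
  "cd_app (dual_bracket \<delta> \<phi> \<psi>) (il y) = cd_app (dual_bracket \<delta>\<^sub>l (precomp il \<phi>) (precomp il \<psi>)) y"
  by (rule dual_bracket_tmap2[OF clinear_il clinear_\<delta>l clinear_\<delta> \<delta>_il])

lemma precomp_il_incl [simp]: "precomp il (incl \<phi>) = \<phi>"
  by (rule cd_eqI) simp

text \<open>The cobracket of \<open>\<uu>\<close> has no component in \<open>\<ll> \<otimes> \<ll>\<close>, so that \<open>\<ll>\<^sup>*\<close> is closed under the
  bracket of \<open>\<gg>\<^sup>*\<close>.\<close>

lemma dual_bracket_incl: "dual_bracket \<delta> (incl \<phi>) (incl \<psi>) = incl (dual_bracket \<delta>\<^sub>l \<phi> \<psi>)"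
proof (rule cd_eqI)
  fix z
  obtain r s t where \<delta>: "\<delta> (iu (pu z)) = r + s + t" "r \<in> tens (range il) (range iu)"
    "s \<in> tens (range iu) (range il)" "t \<in> tens (range iu) (range iu)" using \<delta>_iu by blast
  have "(\<Sum>b\<in>cbasis. \<Sum>c\<in>cbasis. r b c * cd_app (incl \<phi>) b * cd_app (incl \<psi>) c) = 0"
    "(\<Sum>b\<in>cbasis. \<Sum>c\<in>cbasis. s b c * cd_app (incl \<phi>) b * cd_app (incl \<psi>) c) = 0"
    "(\<Sum>b\<in>cbasis. \<Sum>c\<in>cbasis. t b c * cd_app (incl \<phi>) b * cd_app (incl \<psi>) c) = 0"
    by (rule tens_pairing_zero[OF \<delta>(2)] tens_pairing_zero[OF \<delta>(3)] tens_pairing_zero[OF \<delta>(4)];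
        auto simp: cd_app_linear)+
  then have zero: "cd_app (dual_bracket \<delta> (incl \<phi>) (incl \<psi>)) (iu (pu z)) = 0"
    unfolding cd_app_dual_bracket \<delta>(1) by (simp add: distrib_right sum.distrib)
  have "cd_app (dual_bracket \<delta> (incl \<phi>) (incl \<psi>)) z =
      cd_app (dual_bracket \<delta> (incl \<phi>) (incl \<psi>)) (il (pl z) + iu (pu z))"
    by (simp add: decompose)
  also have "\<dots> = cd_app (dual_bracket \<delta>\<^sub>l \<phi> \<psi>) (pl z)"
    by (simp only: cd_app_linear zero dual_bracket_il precomp_il_incl add_0_right)
  finally show "cd_app (dual_bracket \<delta> (incl \<phi>) (incl \<psi>)) z = cd_app (incl (dual_bracket \<delta>\<^sub>l \<phi> \<psi>)) z"
    by simp
qed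

text \<open>The double of \<open>\<ll>\<close> is a subalgebra of the double of \<open>\<gg>\<close>, and its orthogonal is
  \<open>\<uu> \<oplus> \<uu>\<^sup>*\<close>.\<close>

definition dincl :: "'l \<times> 'l cdual \<Rightarrow> 'g \<times> 'g cdual" where
  "dincl = map_prod il incl"

lemma dincl_simp [simp]: "dincl (y, \<psi>) = (il y, incl \<psi>)"
  by (simp add: dincl_def)

lemma double_bracket_dincl:
  "(0, incl \<phi>) \<star> dincl z = dincl (double_bracket br\<^sub>l \<delta>\<^sub>l (0, \<phi>) z)"
proof -
  interpret l: lie_bialg br\<^sub>l \<delta>\<^sub>l by unfold_locales (rule lie_bialgebra_l)
  obtain y \<psi> where z: "z = (y, \<psi>)" by (cases z)
  have "contract \<delta> (incl \<phi>) (il y) = il (contract \<delta>\<^sub>l \<phi> y)"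
  proof (rule separated_by_dual)
    fix \<theta>
    have "cd_app \<theta> (il (contract \<delta>\<^sub>l \<phi> y)) = cd_app (precomp il \<theta>) (contract \<delta>\<^sub>l \<phi> y)" by simp
    then show "cd_app \<theta> (contract \<delta> (incl \<phi>) (il y)) = cd_app \<theta> (il (contract \<delta>\<^sub>l \<phi> y))"
      by (simp only: cd_app_contract l.cd_app_contract dual_bracket_il precomp_il_incl)
  qed
  moreover have "precomp (br (il y)) (incl \<phi>) = incl (precomp (br\<^sub>l y) \<phi>)"
    by (rule cd_eqI) (simp add: br_il_projections)
  ultimately show ?thesis
    by (simp add: z double_bracket_simp l.double_bracket_simp zero_simps l.zero_simps dual_bracket_incl clinear_neg[OF clinear_il]
        clinear_add[OF clinear_incl])
qed

lemma Ad_inv_dincl: "Ad_inv br \<delta> (dincl z) (map incl w) = dincl (Ad_inv br\<^sub>l \<delta>\<^sub>l z w)"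
proof (induction w arbitrary: z)
  case (Cons \<phi> w)
  interpret l: lie_bialg br\<^sub>l \<delta>\<^sub>l by unfold_locales (rule lie_bialgebra_l)
  have "dincl (- v) = - dincl v" for v
    by (cases v) (simp add: clinear_neg[OF clinear_il] clinear_neg[OF clinear_incl])
  then show ?case by (simp add: double_bracket_dincl Cons[symmetric])
qed (simp add: Ad_inv_def)

definition double_u :: "('g \<times> 'g cdual) set" where
  "double_u = {z. \<forall>v. double_pairing z (dincl v) = 0}"

lemma double_u_ad: "z \<in> double_u \<Longrightarrow> (0, incl \<phi>) \<star> z \<in> double_u"
  by (simp add: double_u_def pairing_ad_skew double_bracket_dincl del: split_paired_All)

lemma iu_in_double_u: "(iu u, 0) \<in> double_u"
  and uincl_in_double_u: "(0, uincl \<psi>) \<in> double_u"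
  by (auto simp: double_u_def cd_app_linear)

text \<open>From now on \<open>x\<close> runs through \<open>L\<^sup>*\<close>.\<close>

abbreviation AdG :: "'g \<Rightarrow> 'g \<times> 'g cdual \<Rightarrow> 'l cdual wfun" where
  "AdG p \<equiv> Ad_fun incl (Inl p)"
abbreviation AdH :: "'g \<Rightarrow> 'g \<times> 'g cdual \<Rightarrow> 'l cdual wfun" where
  "AdH p \<equiv> Ad_fun incl (Inr p)"

text \<open>\<open>Ad(x\<^sup>-\<^sup>1)\<close> preserves the double of \<open>\<ll>\<close> and its orthogonal.  As the double of \<open>\<ll>\<close> is the
  sum of its intersections with \<open>\<gg>\<close> and \<open>\<gg>\<^sup>*\<close>, the component in \<open>\<gg>\<close> alone is orthogonal, too.\<close>

lemma AdG_AdH_orthogonal: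
  assumes "z \<in> double_u"
  shows "(\<Sum>p\<in>cbasis. AdG p (dincl v) * AdH p z) = 0" (is "?P v z = _")
proof (rule wfun_eqI)
  fix w
  show "wval (?P v z) w = wval 0 w"
    using assms
  proof (induction w arbitrary: v z)
    case Nil
    obtain y \<psi> where v: "v = (y, \<psi>)" by (cases v)
    have "double_pairing z (dincl (y, 0)) = 0" using Nil by (simp add: double_u_def)
    then have "cd_app (snd z) (il y) = 0"
      by (cases z) (simp add: clinear_zero[OF clinear_incl])
    then show ?case
      using cd_app_expand[of "il y" "snd z"] by (simp add: v wval_Ad_fun)
  next
    case (Cons \<phi> w)
    have "shift \<phi> (?P v z) = - (?P (double_bracket br\<^sub>l \<delta>\<^sub>l (0, \<phi>) v) z + ?P v ((0, incl \<phi>) \<star> z))"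
      by (simp add: clinear_sum[OF clinear_shift] shift_Ad_fun double_bracket_dincl algebra_simps flip: sum.distrib sum_negf)
    then have "wval (?P v z) (\<phi> # w) =
        wval (- (?P (double_bracket br\<^sub>l \<delta>\<^sub>l (0, \<phi>) v) z + ?P v ((0, incl \<phi>) \<star> z))) w"
      by (metis wval_shift)
    also have "\<dots> = 0"
      unfolding wval_simps using Cons.IH[OF Cons.prems] Cons.IH[OF double_u_ad[OF Cons.prems]] by simp
    finally show ?case by simp
  qed
qed

lemma formal_functions_AdF: "Ad_fun incl k z \<in> FL"
  by (rule formal_functions_Ad_fun) (simp_all only: clinear_incl dual_bracket_incl)

abbreviation \<omega> :: "'u \<Rightarrow> 'u \<Rightarrow> 'l cdual wfun" where "\<omega> \<equiv> omega br \<delta> il iu"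

lemma omega_eq: "\<omega> u v = (\<Sum>p\<in>cbasis. AdG p (iu u, 0) * AdH p (iu v, 0))"
  by (simp add: omega_def Ad_fun_def Let_def)

lemma clinear_omega: "clinear (\<omega> u)" "clinear (\<lambda>u. \<omega> u v)"
proof -
  have "clinear (\<lambda>u. (iu u, 0 :: 'g cdual))"
    using clinear_iu by (simp add: clinear_iff)
  then have "clinear (\<lambda>u. Ad_fun incl k (iu u, 0))" for k
    by (rule clinear_compose[OF clinear_Ad_fun])
  then have lin: "Ad_fun incl k (iu (u + v), 0) = Ad_fun incl k (iu u, 0) + Ad_fun incl k (iu v, 0)"
    "Ad_fun incl k (iu (c *\<^sub>C u), 0) = c *\<^sub>C Ad_fun incl k (iu u, 0)" for k u v c
    by (simp_all add: clinear_iff)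
  show "clinear (\<omega> u)" "clinear (\<lambda>u. \<omega> u v)"
    by (rule clinearI; simp add: omega_eq lin distrib_left distrib_right sum.distrib
        cscale_mult_left cscale_mult_right cvec.scale_sum_right)+
qed

text \<open>The elements \<open>u\<close> and \<open>v\<close> of \<open>\<gg>\<close> are orthogonal in the double, and \<open>Ad(x\<^sup>-\<^sup>1)\<close> preserves the
  pairing.\<close>

lemma omega_skew: "\<omega> u v = - \<omega> v u"
proof -
  have "\<omega> u v + \<omega> v u = double_pairing (iu u, 0) (iu v, 0) *\<^sub>C 1"
    unfolding Ad_fun_preserves_pairing[of incl "(iu u, 0)" "(iu v, 0)", symmetric] omega_eq
    by (simp add: sum.distrib mult.commute)
  then show ?thesis by (simp add: eq_neg_iff_add_eq_0)
qed

lemma formal_functions_omega: "\<omega> u v \<in> FL"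
  unfolding omega_eq by (intro formal_functions_sum formal_functions_mult formal_functions_AdF)

end


section \<open>Translations and dressing fields on the dual group and on the subgroup\<close>

context lie_bialg
begin

lemma dress_eq: "dress br \<delta> a f = - (\<Sum>e\<in>cbasis. Ad_fun id (Inr e) (a, 0) * Rop (dual_basis e) f)"
  by (simp add: dress_def Ad_fun_def)

text \<open>Left translations are right translations in the direction transported by \<open>Ad(x\<^sup>-\<^sup>1)\<close>:
  \<open>e\<^sup>-\<^sup>\<epsilon>\<^sup>\<zeta>x\<close> is \<open>x\<close> times the exponential of \<open>- \<epsilon> Ad(x\<^sup>-\<^sup>1)(\<zeta>)\<close>.  The induction moves the letter
  \<open>\<zeta>\<close> through the word, from the left end to the right end.\<close>

lemma Lop_eq_Rop:
  assumes "f \<in> formal_functions (dual_bracket \<delta>)"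
  shows "Lop \<zeta> f = - (\<Sum>e\<in>cbasis. Ad_fun id (Inr e) (0, \<zeta>) * Rop (dual_basis e) f)"
    (is "_ = - ?Q \<zeta> f")
proof (rule wfun_eqI)
  fix w
  have "wval f (\<zeta> # w) = wval (?Q \<zeta> f) w"
    using assms
  proof (induction w arbitrary: f \<zeta>)
    case Nil
    have "Rop \<zeta> f = (\<Sum>e\<in>cbasis. cd_app \<zeta> e *\<^sub>C Rop (dual_basis e) f)"
      by (rule cdual_clinear_expand[OF clinear_Rop_letter[OF Nil]])
    from arg_cong[OF this, of "\<lambda>g. wval g []"] show ?case by (simp add: wval_Ad_fun)
  next
    case (Cons \<eta> w)
    have "shift \<eta> (shift \<zeta> f) - shift \<zeta> (shift \<eta> f) = shift (dual_bracket \<delta> \<zeta> \<eta>) f"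
      using formal_functions_local[OF Cons.prems] by (simp add: local_relations_def)
    from arg_cong[OF this, of "\<lambda>g. wval g w"]
    have "wval f (\<zeta> # \<eta> # w) = wval (shift \<eta> f) (\<zeta> # w) + wval f (dual_bracket \<delta> \<zeta> \<eta> # w)"
      by (simp add: algebra_simps)
    also have "\<dots> = wval (?Q \<zeta> (shift \<eta> f)) w + wval (?Q (dual_bracket \<delta> \<zeta> \<eta>) f) w"
      by (simp only: Cons.IH[OF formal_functions_shift[OF Cons.prems]] Cons.IH[OF Cons.prems])
    also have "\<dots> = wval (shift \<eta> (?Q \<zeta> f)) w"
    proof -
      have "(0, \<eta>) \<star> (0, \<zeta>) = - (0, dual_bracket \<delta> \<zeta> \<eta>)"
        by (simp add: double_bracket_simp dual_bracket_skew[of \<eta>] zero_simps)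
      then have "shift \<eta> (?Q \<zeta> f) = ?Q \<zeta> (shift \<eta> f) + ?Q (dual_bracket \<delta> \<zeta> \<eta>) f"
        by (simp add: clinear_sum[OF clinear_shift] shift_Ad_fun shift_Rop clinear_neg[OF clinear_Ad_fun]
            sum.distrib del: uminus_Pair)
      then show ?thesis by simp
    qed
    finally show ?case by simp
  qed
  then show "wval (Lop \<zeta> f) w = wval (- ?Q \<zeta> f) w" by simp
qed

lemma pullback_Ad_fun: "pullback j (Ad_fun id k z) = Ad_fun j k z"
  by (rule wfun_eqI) (simp add: wval_Ad_fun)

lemma formal_functions_Ad_fun_id: "Ad_fun id k z \<in> formal_functions (dual_bracket \<delta>)"
  by (rule formal_functions_Ad_fun) (simp_all add: clinear_iff)

end

context splitting
begin

abbreviation restrict :: "'g cdual wfun \<Rightarrow> 'l cdual wfun" where "restrict \<equiv> pullback incl"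

lemma formal_functions_restrict:
  "f \<in> FG \<Longrightarrow> restrict f \<in> FL"
  by (rule formal_functions_pullback) (simp_all only: clinear_incl dual_bracket_incl)

text \<open>For \<open>a\<close> in \<open>\<ll>\<close> the element \<open>Ad(x\<^sup>-\<^sup>1)(a)\<close> stays in the double of \<open>\<ll>\<close>, so that the
  dressing field of \<open>a\<close> is tangent to \<open>L\<^sup>*\<close>.\<close>

lemma restrict_dress:
  assumes "f \<in> FG"
  shows "restrict (dress br \<delta> (il a) f) = dress br\<^sub>l \<delta>\<^sub>l a (restrict f)"
proof -
  define h where "h e = WFun (\<lambda>w. cd_app (snd (Ad_inv br\<^sub>l \<delta>\<^sub>l (a, 0) w)) e)" for e
  have H: "AdH q (il a, 0) = (\<Sum>e\<in>cbasis. coord e (pl q) *\<^sub>C h e)" for q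
  proof (rule wfun_eqI)
    fix w
    have "Ad_inv br \<delta> (il a, 0) (map incl w) = dincl (Ad_inv br\<^sub>l \<delta>\<^sub>l (a, 0) w)"
      using Ad_inv_dincl[of "(a, 0)" w] by (simp add: clinear_zero[OF clinear_incl])
    then have "wval (AdH q (il a, 0)) w = cd_app (snd (Ad_inv br\<^sub>l \<delta>\<^sub>l (a, 0) w)) (pl q)"
      by (simp add: wval_Ad_fun dincl_def)
    then show "wval (AdH q (il a, 0)) w = wval (\<Sum>e\<in>cbasis. coord e (pl q) *\<^sub>C h e) w"
      by (simp add: h_def cd_app_expand)
  qed
  have R: "Rop (incl (dual_basis e)) f = (\<Sum>q\<in>cbasis. coord e (pl q) *\<^sub>C Rop (dual_basis q) f)" for e
    using cdual_clinear_expand[OF clinear_Rop_letter[OF assms], of "incl (dual_basis e)"] by simp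
  have "dress br\<^sub>l \<delta>\<^sub>l a (restrict f) = - (\<Sum>e\<in>cbasis. h e * restrict (Rop (incl (dual_basis e)) f))"
    by (simp add: dress_def Rop_pullback h_def)
  also have "\<dots> = - (\<Sum>e\<in>cbasis. \<Sum>q\<in>cbasis. coord e (pl q) *\<^sub>C (h e * restrict (Rop (dual_basis q) f)))"
    by (simp add: R clinear_sum[OF clinear_pullback] clinear_scale[OF clinear_pullback] sum_distrib_left cscale_mult_right)
  also have "\<dots> = - (\<Sum>q\<in>cbasis. AdH q (il a, 0) * restrict (Rop (dual_basis q) f))"
    by (subst sum.swap) (simp add: H sum_distrib_right cscale_mult_left)
  also have "\<dots> = restrict (dress br \<delta> (il a) f)"
    by (simp add: dress_eq clinear_neg[OF clinear_pullback] clinear_sum[OF clinear_pullback]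
        pullback_times pullback_Ad_fun)
  finally show ?thesis ..
qed

lemma dress_Ad_fun:
  "dress br\<^sub>l \<delta>\<^sub>l a (Ad_fun incl k z) =
    (\<Sum>q\<in>cbasis. \<Sum>m\<in>double_index. double_coord k ((0, dual_basis q) \<star> double_basis m) *\<^sub>C
       (AdH q (il a, 0) * Ad_fun incl m z))"
proof -
  have "dress br\<^sub>l \<delta>\<^sub>l a (Ad_fun incl k z) = restrict (dress br \<delta> (il a) (Ad_fun id k z))"
    by (simp add: restrict_dress[OF formal_functions_Ad_fun_id] pullback_Ad_fun)
  then show ?thesis
    by (simp add: dress_eq Rop_Ad_fun clinear_neg[OF clinear_pullback] clinear_sum[OF clinear_pullback]
        clinear_scale[OF clinear_pullback] pullback_times pullback_Ad_fun sum_distrib_left sum_negf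
        cscale_mult_right)
qed

end

section \<open>The graph of sigma and its derivatives\<close>

lemma delta_mult:
  "(if P then 1 else 0) * y = (if P then y else (0::'r::comm_ring_1))"
  "y * (if P then 1 else 0) = (if P then y else (0::'r::comm_ring_1))"
  by simp_all

locale splitting_sigma = splitting br \<delta> br\<^sub>l \<delta>\<^sub>l il iu
  for br :: "'g::fd_complex_space \<Rightarrow> 'g \<Rightarrow> 'g" and \<delta> and br\<^sub>l :: "'l::fd_complex_space \<Rightarrow> 'l \<Rightarrow> 'l"
    and \<delta>\<^sub>l and il and iu :: "'u::fd_complex_space \<Rightarrow> 'g" +
  fixes \<sigma> :: "'u \<Rightarrow> 'u \<Rightarrow> 'l cdual wfun fract"
  assumes \<sigma>_skew: "\<sigma> b c = - \<sigma> c b"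
    and \<sigma>_inverse: "c \<in> cbasis \<Longrightarrow> (\<Sum>b\<in>cbasis. to_fract (\<omega> v b) * \<sigma> c b) = coord c v *\<^sub>C 1"
begin

text \<open>A function \<open>f\<close> on the double, extended linearly over the functions on \<open>L\<^sup>*\<close>, is evaluated at
  the element \<open>\<epsilon>\<^sup>i - \<sigma>(\<epsilon>\<^sup>i)\<close> of the graph of \<open>- \<sigma>\<close>, where \<open>\<epsilon>\<^sup>i\<close> is in \<open>\<uu>\<^sup>*\<close>.\<close>

definition X :: "'u \<Rightarrow> ('g \<times> 'g cdual \<Rightarrow> 'l cdual wfun fract) \<Rightarrow> 'l cdual wfun fract" where
  "X i f = f (0, uincl (dual_basis i)) - (\<Sum>c\<in>cbasis. \<sigma> i c * f (iu c, 0))"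

lemma X_sum: "X i (\<lambda>z. \<Sum>k\<in>A. f k z) = (\<Sum>k\<in>A. X i (f k))"
  unfolding X_def sum_subtractf sum_distrib_left by (subst (2) sum.swap) (rule refl)

lemma X_cscale: "X i (\<lambda>z. c *\<^sub>C f z) = c *\<^sub>C X i f"
  by (simp add: X_def cscale_mult_right cvec.scale_right_diff_distrib cvec.scale_sum_right)

lemma X_mult_left: "X i (\<lambda>z. k * f z) = k * X i f"
  by (simp add: X_def right_diff_distrib sum_distrib_left mult.left_commute)

lemma X_mult_right: "X i (\<lambda>z. f z * k) = X i f * k"
  using X_mult_left[of i k f] by (simp add: mult.commute)

lemma X_add: "X i (\<lambda>z. f z + g z) = X i f + X i g"
  by (simp add: X_def distrib_left sum.distrib)

abbreviation frac :: "'g + 'g \<Rightarrow> 'g \<times> 'g cdual \<Rightarrow> 'l cdual wfun fract" where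
  "frac k z \<equiv> to_fract (Ad_fun incl k z)"

lemma frac_pairing:
  "(\<Sum>p\<in>cbasis. frac (Inl p) a * frac (Inr p) b + frac (Inr p) a * frac (Inl p) b) =
     double_pairing a b *\<^sub>C 1"
  using arg_cong[OF Ad_fun_preserves_pairing[of incl a b], of to_fract]
  by (simp add: to_fract_sum to_fract_cscale)

lemma frac_trilinear:
  "(\<Sum>k\<in>double_index. \<Sum>l\<in>double_index. \<Sum>m\<in>double_index.
      double_pairing (double_basis k \<star> double_basis l) (double_basis m) *\<^sub>C
        (frac k a * frac l b * frac m c)) = double_pairing (a \<star> b) c *\<^sub>C 1"
  using arg_cong[OF Ad_fun_preserves_trilinear_form[of incl a b c], of to_fract]
  by (simp add: to_fract_sum to_fract_cscale)

lemma frac_dual: "frac (Inl p) (0, \<xi>) = 0"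
  by (simp add: Ad_fun_dual)

lemma frac_pairing_dual:
  "(\<Sum>p\<in>cbasis. frac (Inl p) (v, 0) * frac (Inr p) (0, \<xi>)) = cd_app \<xi> v *\<^sub>C 1"
  using frac_pairing[of "(v, 0)" "(0, \<xi>)"] by (simp add: frac_dual)

text \<open>The graph of \<open>- \<sigma>\<close> is \<open>Ad(x)(\<uu>)\<close>.  What is proved here is that \<open>Ad(x\<^sup>-\<^sup>1)\<close> maps it to \<open>\<gg>\<close>.  The
  dual component of the image is orthogonal to the components in \<open>\<gg>\<close> of \<open>Ad(x\<^sup>-\<^sup>1)(\<uu>)\<close>, by the
  definition of \<open>\<sigma>\<close>, and to those of \<open>Ad(x\<^sup>-\<^sup>1)(\<ll>)\<close>, as it belongs to \<open>\<uu>\<^sup>*\<close>; and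
  these components exhaust \<open>\<gg>\<close>.\<close>

lemma X_AdH_zero:
  assumes i: "i \<in> cbasis" and r: "r \<in> cbasis"
  shows "X i (frac (Inr r)) = 0"
proof -
  define y where "y p = X i (frac (Inr p))" for p
  have u: "(\<Sum>p\<in>cbasis. frac (Inl p) (iu a, 0) * y p) = 0" for a
  proof -
    have "(\<Sum>p\<in>cbasis. frac (Inl p) (iu a, 0) * y p) =
        X i (\<lambda>z. \<Sum>p\<in>cbasis. frac (Inl p) (iu a, 0) * frac (Inr p) z)"
      by (simp add: y_def X_sum X_mult_left)
    also have "\<dots> = coord i a *\<^sub>C 1 - (\<Sum>c\<in>cbasis. to_fract (\<omega> a c) * \<sigma> i c)"
      unfolding X_def frac_pairing_dual by (simp add: omega_eq to_fract_sum mult.commute)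
    also have "\<dots> = 0" by (simp add: \<sigma>_inverse[OF i])
    finally show ?thesis .
  qed
  have l: "(\<Sum>p\<in>cbasis. frac (Inl p) (il v, 0) * y p) = 0" for v
  proof -
    have 0: "(\<Sum>p\<in>cbasis. frac (Inl p) (il v, 0) * frac (Inr p) z) = 0" if "z \<in> double_u" for z
      using arg_cong[OF AdG_AdH_orthogonal[OF that, of "(v, 0)"], of to_fract]
      by (simp add: clinear_zero[OF clinear_incl] to_fract_sum)
    have "(\<Sum>p\<in>cbasis. frac (Inl p) (il v, 0) * y p) =
        X i (\<lambda>z. \<Sum>p\<in>cbasis. frac (Inl p) (il v, 0) * frac (Inr p) z)"
      by (simp add: y_def X_sum X_mult_left)
    also have "\<dots> = 0"
      by (simp add: X_def 0 iu_in_double_u uincl_in_double_u)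
    finally show ?thesis .
  qed
  have all: "(\<Sum>p\<in>cbasis. frac (Inl p) (v, 0) * y p) = 0" for v
  proof -
    have "(v, 0 :: 'g cdual) = (il (pl v), 0) + (iu (pu v), 0)" by (simp add: decompose)
    then have "frac (Inl p) (v, 0) = frac (Inl p) (il (pl v), 0) + frac (Inl p) (iu (pu v), 0)" for p
      by (simp only: clinear_add[OF clinear_Ad_fun] to_fract_add)
    then show ?thesis using u[of "pu v"] l[of "pl v"] by (simp add: distrib_right sum.distrib)
  qed
  \<comment> \<open>the action on \<open>\<gg>\<^sup>*\<close> is contragredient to the one on the quotient of the double by \<open>\<gg>\<^sup>*\<close>, and
    provides the inverse matrix\<close>
  have inv: "(\<Sum>q\<in>cbasis. frac (Inr a) (0, dual_basis q) * frac (Inl c) (q, 0)) = (if a = c then 1 else 0)"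
    if "a \<in> cbasis" "c \<in> cbasis" for a c
    by (rule matrix_left_inverse_of_right_inverse[of cbasis "\<lambda>q p. frac (Inl p) (q, 0)" "\<lambda>p q. frac (Inr p) (0, dual_basis q)"])
       (auto simp: finite_cbasis frac_pairing_dual coord_cbasis cscale_one that)
  have "y r = (\<Sum>p\<in>cbasis. (if r = p then 1 else 0) * y p)"
    using r by (simp add: finite_cbasis delta_mult)
  also have "\<dots> = (\<Sum>p\<in>cbasis. (\<Sum>q\<in>cbasis. frac (Inr r) (0, dual_basis q) * frac (Inl p) (q, 0)) * y p)"
    by (intro sum.cong refl) (simp add: inv r)
  also have "\<dots> = (\<Sum>q\<in>cbasis. frac (Inr r) (0, dual_basis q) * (\<Sum>p\<in>cbasis. frac (Inl p) (q, 0) * y p))"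
    by (simp add: sum_distrib_left sum_distrib_right mult.assoc) (rule sum.swap)
  also have "\<dots> = 0" by (simp add: all)
  finally show ?thesis by (simp add: y_def)
qed

lemma X_pairing:
  assumes "j \<in> cbasis"
  shows "(\<Sum>p\<in>cbasis. frac (Inr p) a * X j (frac (Inl p))) = X j (\<lambda>b. double_pairing a b *\<^sub>C 1)"
  unfolding frac_pairing[symmetric] by (simp add: X_sum X_add X_mult_left X_AdH_zero[OF assms])

lemma X_pairing_u: "X j (\<lambda>b. double_pairing (iu c, 0) b *\<^sub>C 1) = coord j c *\<^sub>C 1"
  by (simp add: X_def cd_app_linear)

text \<open>Differentiating \<open>X i (frac (Inr p)) = 0\<close> expresses the derivatives of \<open>\<sigma>\<close> by those of the
  matrix coefficients.\<close>

lemma derivation_\<sigma>: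
  assumes D: "derivation D" and i: "i \<in> cbasis" and j: "j \<in> cbasis"
  shows "D (\<sigma> i j) = (\<Sum>p\<in>cbasis. X i (\<lambda>z. D (frac (Inr p) z)) * X j (frac (Inl p)))"
proof -
  note lin = derivation_linear[OF D]
  have "X i (\<lambda>z. D (frac (Inr p) z)) = (\<Sum>c\<in>cbasis. D (\<sigma> i c) * frac (Inr p) (iu c, 0))"
    if "p \<in> cbasis" for p
  proof -
    have "D (X i (frac (Inr p))) = 0" by (simp add: X_AdH_zero[OF i that] clinear_zero[OF lin])
    then show ?thesis
      by (simp add: X_def clinear_diff[OF lin] clinear_sum[OF lin] derivation_mult[OF D] sum.distrib
          algebra_simps)
  qed
  then have "(\<Sum>p\<in>cbasis. X i (\<lambda>z. D (frac (Inr p) z)) * X j (frac (Inl p)))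
      = (\<Sum>p\<in>cbasis. \<Sum>c\<in>cbasis. D (\<sigma> i c) * (frac (Inr p) (iu c, 0) * X j (frac (Inl p))))"
    by (simp add: sum_distrib_right mult.assoc)
  also have "\<dots> = (\<Sum>c\<in>cbasis. D (\<sigma> i c) * (\<Sum>p\<in>cbasis. frac (Inr p) (iu c, 0) * X j (frac (Inl p))))"
    by (subst sum.swap) (simp add: sum_distrib_left)
  also have "\<dots> = (\<Sum>c\<in>cbasis. D (\<sigma> i c) * (if j = c then 1 else 0))"
    by (intro sum.cong refl) (simp add: X_pairing[OF j] X_pairing_u coord_cbasis cscale_one)
  also have "\<dots> = D (\<sigma> i j)" using j by (simp add: finite_cbasis delta_mult)
  finally show ?thesis ..
qed

text \<open>Left translation by \<open>e\<^sup>-\<^sup>\<epsilon>\<^sup>\<zeta>\<close> moves the graph \<open>Ad(x)(\<uu>)\<close> by \<open>- \<epsilon> ad(\<zeta>)\<close>.\<close>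

lemma Lop_\<sigma>:
  assumes i: "i \<in> cbasis" and j: "j \<in> cbasis"
  shows "extend_derivation (Lop \<zeta>) (\<sigma> i j) =
    X i (\<lambda>a. X j (\<lambda>b. double_pairing ((0, incl \<zeta>) \<star> a) b *\<^sub>C 1))"
proof -
  have "extend_derivation (Lop \<zeta>) (\<sigma> i j) =
      (\<Sum>p\<in>cbasis. X i (\<lambda>z. frac (Inr p) ((0, incl \<zeta>) \<star> z)) * X j (frac (Inl p)))"
    by (simp add: derivation_\<sigma>[OF derivation_extend[OF derivation_Lop] i j]
        extend_derivation_to_fract[OF derivation_Lop] Lop_Ad_fun)
  also have "\<dots> = X i (\<lambda>z. \<Sum>p\<in>cbasis. frac (Inr p) ((0, incl \<zeta>) \<star> z) * X j (frac (Inl p)))"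
    by (simp add: X_sum X_mult_right)
  finally show ?thesis by (simp only: X_pairing[OF j])
qed

text \<open>\<open>\<gg>\<close> is an isotropic subalgebra of the double, and so is \<open>\<gg>\<^sup>*\<close>.\<close>

lemma trilinear_form_isotropic [simp]: "double_pairing ((x, 0) \<star> (y, 0)) (z, 0) = 0"
proof -
  have "dual_bracket \<delta> 0 0 = 0" by (rule clinear_zero[OF clinear_dual_bracket(1)])
  then show ?thesis by (simp add: trilinear_form)
qed

lemma trilinear_form_dual_isotropic: "double_pairing ((0, \<xi>) \<star> (0, \<eta>)) (0, \<zeta>) = 0"
  by (simp add: trilinear_form cd_app_linear clinear_zero[OF clinear_br])

text \<open>\<open>Ad(x\<^sup>-\<^sup>1)\<close> preserves the form and maps the graph to \<open>\<gg>\<close>.\<close>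

lemma X_trilinear_zero:
  assumes i: "i \<in> cbasis" and j: "j \<in> cbasis" and k: "k \<in> cbasis"
  shows "X i (\<lambda>a. X j (\<lambda>b. X k (\<lambda>c. double_pairing (a \<star> b) c *\<^sub>C 1))) = 0"
  unfolding frac_trilinear[symmetric]
  by (simp add: X_sum X_add X_cscale X_mult_left X_mult_right sum_double_index X_AdH_zero[OF i] X_AdH_zero[OF j] X_AdH_zero[OF k])

text \<open>The dressing field of \<open>a\<close> acts on \<open>Ad(x\<^sup>-\<^sup>1)(z)\<close> by the bracket with the dual component of
  \<open>Ad(x\<^sup>-\<^sup>1)(a)\<close>.  On the graph, whose image is in \<open>\<gg>\<close>, the component in \<open>\<gg>\<close> may be added without
  changing the trilinear form, and the whole of \<open>Ad(x\<^sup>-\<^sup>1)(a)\<close> can be transported back to \<open>a\<close>.\<close>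

lemma dress_\<sigma>:
  assumes i: "i \<in> cbasis" and j: "j \<in> cbasis"
  shows "extend_derivation (dress br\<^sub>l \<delta>\<^sub>l a) (\<sigma> i j) =
    X i (\<lambda>z. X j (\<lambda>z'. double_pairing ((il a, 0) \<star> z) z' *\<^sub>C 1))"
proof -
  let ?f = "\<lambda>p q m. double_pairing (double_basis (Inr q) \<star> double_basis (Inl m)) (double_basis (Inl p)) *\<^sub>C
       (frac (Inr q) (il a, 0) * X i (frac (Inl m)) * X j (frac (Inl p)))"
  have coord: "double_coord (Inr p) z = double_pairing z (double_basis (Inl p))" for p and z :: "'g \<times> 'g cdual"
    by (cases z) (simp add: cd_app_linear)
  have "extend_derivation (dress br\<^sub>l \<delta>\<^sub>l a) (\<sigma> i j) =
    (\<Sum>p\<in>cbasis. \<Sum>q\<in>cbasis. \<Sum>m\<in>double_index.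
      double_pairing (double_basis (Inr q) \<star> double_basis m) (double_basis (Inl p)) *\<^sub>C
       (frac (Inr q) (il a, 0) * X i (frac m) * X j (frac (Inl p))))"
    unfolding derivation_\<sigma>[OF derivation_extend[OF derivation_dress] i j]
      extend_derivation_to_fract[OF derivation_dress] dress_Ad_fun coord
    by (simp add: to_fract_sum to_fract_cscale X_sum X_cscale X_mult_left sum_distrib_right cscale_mult_left
        del: double_basis.simps(1))
  also have "\<dots> = (\<Sum>p\<in>cbasis. \<Sum>q\<in>cbasis. \<Sum>m\<in>cbasis. ?f p q m)"
    by (simp add: sum_double_index X_AdH_zero[OF i])
  also have "\<dots> = (\<Sum>q\<in>cbasis. \<Sum>p\<in>cbasis. \<Sum>m\<in>cbasis. ?f p q m)"
    by (rule sum.swap)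
  also have "\<dots> = (\<Sum>q\<in>cbasis. \<Sum>m\<in>cbasis. \<Sum>p\<in>cbasis. ?f p q m)"
    by (rule sum_swap_inner)
  also have "\<dots> = X i (\<lambda>z. X j (\<lambda>z'. double_pairing ((il a, 0) \<star> z) z' *\<^sub>C 1))"
    unfolding frac_trilinear[symmetric]
    by (simp add: X_sum X_add X_cscale X_mult_left X_mult_right sum_double_index X_AdH_zero[OF i] X_AdH_zero[OF j])
  finally show ?thesis .
qed

end


section \<open>Restriction of derivatives to the subgroup\<close>

context splitting_sigma
begin

text \<open>The left translation along \<open>\<epsilon>\<^sup>i\<close> and the combination of the dressing fields of \<open>\<uu>\<close> by \<open>\<sigma>\<close>
  are right translations along the two components of the dual part of \<open>X i\<close>, which vanishes.\<close>

lemma restrict_Lop_uincl: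
  assumes f: "f \<in> FG" and i: "i \<in> cbasis"
  shows "to_fract (restrict (Lop (uincl (dual_basis i)) f)) =
    (\<Sum>c\<in>cbasis. \<sigma> i c * to_fract (restrict (dress br \<delta> (iu c) f)))"
proof -
  define R where "R e = to_fract (restrict (Rop (dual_basis e) f))" for e
  have L: "to_fract (restrict (Lop (uincl (dual_basis i)) f)) =
      - (\<Sum>e\<in>cbasis. frac (Inr e) (0, uincl (dual_basis i)) * R e)"
    by (simp add: Lop_eq_Rop[OF f] R_def clinear_neg[OF clinear_pullback] clinear_sum[OF clinear_pullback]
        pullback_times pullback_Ad_fun to_fract_sum)
  have dress: "to_fract (restrict (dress br \<delta> (iu c) f)) = - (\<Sum>e\<in>cbasis. frac (Inr e) (iu c, 0) * R e)" for c
    by (simp add: dress_eq R_def clinear_neg[OF clinear_pullback] clinear_sum[OF clinear_pullback]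
        pullback_times pullback_Ad_fun to_fract_sum)
  have "(\<Sum>e\<in>cbasis. X i (frac (Inr e)) * R e) = 0" by (simp add: X_AdH_zero[OF i])
  then have "(\<Sum>e\<in>cbasis. frac (Inr e) (0, uincl (dual_basis i)) * R e) =
      (\<Sum>e\<in>cbasis. \<Sum>c\<in>cbasis. \<sigma> i c * (frac (Inr e) (iu c, 0) * R e))"
    by (simp add: X_def left_diff_distrib sum_subtractf sum_distrib_right mult.assoc)
  also have "\<dots> = (\<Sum>c\<in>cbasis. \<sigma> i c * (\<Sum>e\<in>cbasis. frac (Inr e) (iu c, 0) * R e))"
    by (subst sum.swap) (simp add: sum_distrib_left)
  finally show ?thesis unfolding L dress by (simp add: sum_negf)
qed

text \<open>The derivatives transversal to \<open>L\<^sup>*\<close> are expressed by dressing fields, along which the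
  derivatives of an equivariant function are known.\<close>

lemma restrict_Lop:
  assumes f: "f \<in> FG"
  shows "(\<Sum>e\<in>cbasis. cd_app \<theta> e *\<^sub>C to_fract (restrict (Lop (dual_basis e) f))) =
    (\<Sum>e\<in>cbasis. cd_app \<theta> (il e) *\<^sub>C to_fract (Lop (dual_basis e) (restrict f))) +
    (\<Sum>i\<in>cbasis. cd_app \<theta> (iu i) *\<^sub>C (\<Sum>c\<in>cbasis. \<sigma> i c * to_fract (restrict (dress br \<delta> (iu c) f))))"
proof -
  have lin: "clinear (\<lambda>\<theta>. to_fract (restrict (Lop \<theta> f)))"
    using clinear_Lop_letter[OF f] clinear_pullback[of incl]
    by (simp add: clinear_iff to_fract_cscale)
  have "(\<Sum>e\<in>cbasis. cd_app \<theta> e *\<^sub>C to_fract (restrict (Lop (dual_basis e) f))) =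
      to_fract (restrict (Lop (incl (precomp il \<theta>) + uincl (precomp iu \<theta>)) f))"
    unfolding dual_decompose by (rule cdual_clinear_expand[OF lin, symmetric])
  also have "\<dots> = to_fract (Lop (precomp il \<theta>) (restrict f)) + to_fract (restrict (Lop (uincl (precomp iu \<theta>)) f))"
    by (simp only: clinear_add[OF lin] Lop_pullback)
  also have "to_fract (Lop (precomp il \<theta>) (restrict f)) =
      (\<Sum>e\<in>cbasis. cd_app \<theta> (il e) *\<^sub>C to_fract (Lop (dual_basis e) (restrict f)))"
  proof -
    have "clinear (\<lambda>\<theta>. to_fract (Lop \<theta> (restrict f)))"
      using clinear_Lop_letter[OF formal_functions_restrict[OF f]]
      by (simp add: clinear_iff to_fract_cscale)
    from cdual_clinear_expand[OF this, of "precomp il \<theta>"] show ?thesis by simp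
  qed
  also have "to_fract (restrict (Lop (uincl (precomp iu \<theta>)) f)) =
      (\<Sum>i\<in>cbasis. cd_app \<theta> (iu i) *\<^sub>C to_fract (restrict (Lop (uincl (dual_basis i)) f)))"
  proof -
    have "clinear uincl" by (intro clinearI cd_eqI) simp_all
    from clinear_compose[OF lin this] cdual_clinear_expand[of "\<lambda>\<phi>. to_fract (restrict (Lop (uincl \<phi>) f))" "precomp iu \<theta>"]
    show ?thesis by simp
  qed
  finally show ?thesis by (simp add: restrict_Lop_uincl[OF f])
qed

definition restrictable :: "'g cdual wfun fract set" where
  "restrictable = {to_fract f / to_fract g | f g. f \<in> FG \<and>
     g \<in> FG \<and> restrict g \<noteq> 0}"

abbreviation frestrict :: "'g cdual wfun fract \<Rightarrow> 'l cdual wfun fract" where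
  "frestrict \<equiv> extend_hom restrict"

lemma restrictable_domain: "restrictable \<subseteq> hom_domain restrict"
  by (auto simp: restrictable_def hom_domain_def)

lemma restrictable_derivation:
  "q \<in> restrictable \<Longrightarrow> derivation D \<Longrightarrow> extend_derivation D q \<in> hom_domain restrict"
  by (auto simp: restrictable_def intro: hom_domain_derivation algebra_hom_pullback)

lemma frestrict_dress:
  assumes "q \<in> restrictable"
  shows "frestrict (extend_derivation (dress br \<delta> (il a)) q) =
    extend_derivation (dress br\<^sub>l \<delta>\<^sub>l a) (frestrict q)"
proof -
  obtain f g where q: "q = to_fract f / to_fract g" "f \<in> FG"
    "g \<in> FG" "restrict g \<noteq> 0"
    using assms by (auto simp: restrictable_def)
  show ?thesis
    unfolding q(1) extend_hom_derivation[OF algebra_hom_pullback derivation_dress q(4)]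
      extend_derivation_hom[OF algebra_hom_pullback derivation_dress q(4)]
    by (rule quotient_rule_cong) (simp_all add: restrict_dress q)
qed

text \<open>The same relation for fractions: both sides obey the quotient rule along the restriction.\<close>

lemma frestrict_Lop:
  assumes "q \<in> restrictable"
  shows "(\<Sum>e\<in>cbasis. cd_app \<theta> e *\<^sub>C frestrict (extend_derivation (Lop (dual_basis e)) q)) =
    (\<Sum>e\<in>cbasis. cd_app \<theta> (il e) *\<^sub>C extend_derivation (Lop (dual_basis e)) (frestrict q)) +
    (\<Sum>i\<in>cbasis. cd_app \<theta> (iu i) *\<^sub>C (\<Sum>c\<in>cbasis. \<sigma> i c * frestrict (extend_derivation (dress br \<delta> (iu c)) q)))"
proof -
  obtain f g where q: "q = to_fract f / to_fract g" "f \<in> FG"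
    "g \<in> FG" "restrict g \<noteq> 0"
    using assms by (auto simp: restrictable_def)
  have scale: "c *\<^sub>C (k :: 'l cdual wfun fract) = (c *\<^sub>C 1) * k" for c k by (simp add: cscale_mult_left)
  show ?thesis
    unfolding q(1) extend_hom_derivation[OF algebra_hom_pullback derivation_dress q(4)]
      extend_hom_derivation[OF algebra_hom_pullback derivation_Lop q(4)]
      extend_derivation_hom[OF algebra_hom_pullback derivation_Lop q(4)]
    unfolding scale[of _ "quotient_rule _ _ _ _"] scale[of _ "sum _ _"] quotient_rule_sum[symmetric]
      quotient_rule_add[symmetric]
    by (rule quotient_rule_cong)
       (simp_all only: restrict_Lop[OF q(2)] restrict_Lop[OF q(3)] cscale_mult_left mult_1_left)
qed

end


section \<open>Existence and uniqueness of sigma\<close>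

lemma wval_of_nat_Nil: "wval (of_nat k) [] = of_nat k"
  by (induction k) (simp_all add: wval_one)

text \<open>If the functions in a product vanish at the unit, only the distributions of the letters of
  \<open>x\<^sup>n\<close> that give one letter to each factor contribute.\<close>

lemma wval_prod_replicate:
  assumes "finite A" "\<And>k. k \<in> A \<Longrightarrow> wval (f k) [] = 0"
  shows "order_ge (card A) (\<Prod>k\<in>A. f k) \<and>
    wval (\<Prod>k\<in>A. f k) (replicate (card A) x) = fact (card A) * (\<Prod>k\<in>A. wval (f k) [x])"
  using assms
proof (induction A rule: finite_induct)
  case empty
  then show ?case by (simp add: order_ge_def wval_one)
next
  case (insert a A)
  let ?g = "\<Prod>k\<in>A. f k" and ?m = "card A"
  have IH: "order_ge ?m ?g" "wval ?g (replicate ?m x) = fact ?m * (\<Prod>k\<in>A. wval (f k) [x])"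
    using insert by auto
  have "order_ge 1 (f a)" using insert.prems by (simp add: order_ge_def)
  from order_ge_mult[OF this IH(1)] have ord: "order_ge (Suc ?m) (f a * ?g)" by simp
  have "wval (f a * ?g) (replicate (Suc ?m) x) = wval (shifts (Suc ?m) x (f a * ?g)) []"
    by (simp only: wval_shifts append_Nil2)
  also have "\<dots> = (\<Sum>i\<le>Suc ?m. of_nat (Suc ?m choose i) *
      (wval (f a) (replicate i x) * wval ?g (replicate (Suc ?m - i) x)))"
    by (simp only: shifts_times wval_sum wval_of_nat_Nil wval_times_Nil wval_shifts append_Nil2)
  \<comment> \<open>the factor \<open>f a\<close> takes at least one letter, and the remaining factors at least \<open>card A\<close>\<close>
  also have "\<dots> = (\<Sum>i\<in>{1}. of_nat (Suc ?m choose i) *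
      (wval (f a) (replicate i x) * wval ?g (replicate (Suc ?m - i) x)))"
  proof (rule sum.mono_neutral_right)
    show "\<forall>i\<in>{..Suc ?m} - {1}. of_nat (Suc ?m choose i) *
      (wval (f a) (replicate i x) * wval ?g (replicate (Suc ?m - i) x)) = 0"
    proof
      fix i assume "i \<in> {..Suc ?m} - {1}"
      then consider "i = 0" | "Suc ?m - i < ?m" by fastforce
      then show "of_nat (Suc ?m choose i) *
        (wval (f a) (replicate i x) * wval ?g (replicate (Suc ?m - i) x)) = 0"
        using insert.prems[of a] IH(1) by cases (auto simp: order_ge_def)
    qed
  qed auto
  finally show ?case using insert ord IH(2) by simp
qed

lemma wval_det_replicate:
  assumes "\<And>r c. r < n \<Longrightarrow> c < n \<Longrightarrow> wval (f r c) [] = 0"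
  shows "wval (det (mat n n (\<lambda>(r, c). f r c))) (replicate n x) =
    fact n * det (mat n n (\<lambda>(r, c). wval (f r c) [x]))"
proof -
  have sign: "wval (signof p * g) w = signof p * wval g w" for p :: "nat \<Rightarrow> nat" and g :: "'a wfun" and w
    by (simp add: sign_def)
  have prod: "wval (\<Prod>r = 0..<n. mat n n (\<lambda>(r, c). f r c) $$ (r, p r)) (replicate n x) =
      fact n * (\<Prod>r = 0..<n. mat n n (\<lambda>(r, c). wval (f r c) [x]) $$ (r, p r))"
    if "p permutes {0..<n}" for p
  proof -
    have p: "p r < n" if "r < n" for r
      using permutes_in_image[OF \<open>p permutes {0..<n}\<close>, of r] that by simp
    have "wval (\<Prod>r = 0..<n. f r (p r)) (replicate (card {0..<n}) x) =
      fact (card {0..<n}) * (\<Prod>r = 0..<n. wval (f r (p r)) [x])"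
      using wval_prod_replicate[of "{0..<n}" "\<lambda>r. f r (p r)" x] assms p by simp
    then show ?thesis using p by simp
  qed
  have "wval (det (mat n n (\<lambda>(r, c). f r c))) (replicate n x) =
    (\<Sum>p | p permutes {0..<n}. signof p * wval (\<Prod>r = 0..<n. mat n n (\<lambda>(r, c). f r c) $$ (r, p r)) (replicate n x))"
    by (subst det_def'[of _ n]) (simp_all only: mat_carrier wval_sum sign)
  also have "\<dots> = (\<Sum>p | p permutes {0..<n}. fact n * (signof p * (\<Prod>r = 0..<n. mat n n (\<lambda>(r, c). wval (f r c) [x]) $$ (r, p r))))"
    by (intro sum.cong refl) (simp only: mem_Collect_eq prod mult.left_commute)
  also have "\<dots> = fact n * det (mat n n (\<lambda>(r, c). wval (f r c) [x]))"
    by (subst det_def'[of _ n]) (simp_all only: mat_carrier sum_distrib_left)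
  finally show ?thesis .
qed

lemma formal_functions_adj_mat:
  assumes A: "A \<in> carrier_mat n n" and el: "\<And>r s. r < n \<Longrightarrow> s < n \<Longrightarrow> A $$ (r, s) \<in> formal_functions br"
    and rs: "r < n" "s < n"
  shows "adj_mat A $$ (r, s) \<in> formal_functions br"
proof -
  have "det (mat_delete A s r) \<in> formal_functions br"
  proof (rule formal_functions_det)
    show "mat_delete A s r \<in> carrier_mat (n - 1) (n - 1)" using mat_delete_carrier[OF A] .
    show "mat_delete A s r $$ (i, j) \<in> formal_functions br" if "i < n - 1" "j < n - 1" for i j
      using that A rs by (auto simp: mat_delete_def intro!: el)
  qed
  moreover have "(- 1) ^ k \<in> formal_functions br" for k
    by (intro formal_functions_power formal_functions_uminus formal_functions_one)
  ultimately show ?thesis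
    using A rs by (simp add: adj_mat_def cofactor_def formal_functions_mult)
qed

lemma matrix_right_inverse_unique:
  fixes W \<tau> \<tau>' :: "'i \<Rightarrow> 'i \<Rightarrow> 'k::field"
  assumes A: "finite A"
    and "\<And>v c. v \<in> A \<Longrightarrow> c \<in> A \<Longrightarrow> (\<Sum>b\<in>A. W v b * \<tau> c b) = (if v = c then 1 else 0)"
    and "\<And>v c. v \<in> A \<Longrightarrow> c \<in> A \<Longrightarrow> (\<Sum>b\<in>A. W v b * \<tau>' c b) = (if v = c then 1 else 0)"
    and c: "c \<in> A" and d: "d \<in> A"
  shows "\<tau> c d = \<tau>' c d"
proof -
  have left: "(\<Sum>v\<in>A. \<tau> v d * W v b) = (if d = b then 1 else 0)" if "b \<in> A" for b
    by (rule matrix_left_inverse_of_right_inverse[of A W "\<lambda>b v. \<tau> v b"]) (use assms that in auto)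
  have "s c d = (\<Sum>v\<in>A. \<tau> v d * (\<Sum>b\<in>A. W v b * s c b))" for s
  proof -
    have "(\<Sum>v\<in>A. \<tau> v d * (\<Sum>b\<in>A. W v b * s c b)) = (\<Sum>b\<in>A. (\<Sum>v\<in>A. \<tau> v d * W v b) * s c b)"
      by (simp add: sum_distrib_left sum_distrib_right mult.assoc) (rule sum.swap)
    also have "\<dots> = (\<Sum>b\<in>A. (if d = b then 1 else 0) * s c b)"
      by (intro sum.cong refl) (simp add: left)
    also have "\<dots> = s c d" using A d by (simp add: delta_mult)
    finally show ?thesis ..
  qed
  from this[of \<tau>] this[of \<tau>'] show ?thesis using assms(2,3) c by simp
qed

lemma wedge2_outside: "t \<in> wedge2 R \<Longrightarrow> b \<notin> cbasis \<or> c \<notin> cbasis \<Longrightarrow> t b c = 0"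
  and wedge2_skew: "t \<in> wedge2 R \<Longrightarrow> t b c = - t c b"
  and wedge2_mem: "t \<in> wedge2 R \<Longrightarrow> b \<in> cbasis \<Longrightarrow> c \<in> cbasis \<Longrightarrow> t b c \<in> R"
  unfolding wedge2_def mem_Collect_eq by blast+

locale nondegenerate_splitting_data = splitting br \<delta> br\<^sub>l \<delta>\<^sub>l il iu
  for br :: "'g::fd_complex_space \<Rightarrow> 'g \<Rightarrow> 'g" and \<delta> and br\<^sub>l :: "'l::fd_complex_space \<Rightarrow> 'l \<Rightarrow> 'l"
    and \<delta>\<^sub>l and il and iu :: "'u::fd_complex_space \<Rightarrow> 'g" +
  fixes i :: "'u \<Rightarrow> 'u cdual"
  assumes nondegenerate: "nondegenerate_splitting br il iu"
    and clinear_i: "clinear i" and bij_i: "bij i"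
begin

lemma wval_omega_Nil: "wval (\<omega> u v) [] = 0"
  by (simp add: omega_eq wval_Ad_fun)

lemma wval_omega_single: "wval (\<omega> u v) [\<nu>] = cd_app \<nu> (pl (br (iu u) (iu v)))"
proof -
  have "contract \<delta> 0 x = 0" "dual_bracket \<delta> \<xi> 0 = 0" "precomp (br 0) (0 :: 'g cdual) = 0" for x \<xi>
    using clinear_zero[OF clinear_dual_bracket(1)]
    by (auto simp: contract_def ext2_def intro!: cd_eqI)
  then have snd: "snd (- ((0, incl \<nu>) \<star> (iu v, 0))) = - precomp (br (iu v)) (incl \<nu>)"
    by (simp add: double_bracket_simp)
  have "wval (\<omega> u v) [\<nu>] = - (\<Sum>p\<in>cbasis. coord p (iu u) * cd_app (precomp (br (iu v)) (incl \<nu>)) p)"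
    using snd by (simp add: omega_eq wval_Ad_fun sum_negf)
  also have "\<dots> = - cd_app \<nu> (pl (br (iu v) (iu u)))"
    by (subst cd_app_expand) simp
  also have "\<dots> = cd_app \<nu> (pl (br (iu u) (iu v)))"
    by (subst br_skew) (simp add: clinear_neg[OF clinear_cd_app] clinear_neg[OF clinear_projections(1)])
  finally show ?thesis .
qed

abbreviation P :: "'l cdual wfun" where "P \<equiv> P_det br \<delta> il iu i"
abbreviation j :: "'u cdual \<Rightarrow> 'u" where "j \<equiv> inv_into UNIV i"

lemma i_j: "i (j \<phi>) = \<phi>" and j_i: "j (i u) = u"
  using bij_i by (auto simp: bij_def surj_f_inv_f)

lemma clinear_j: "clinear j"
proof (rule clinearI)
  show "j (\<phi> + \<psi>) = j \<phi> + j \<psi>" for \<phi> \<psi>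
    using j_i[of "j \<phi> + j \<psi>"] by (simp add: clinear_add[OF clinear_i] i_j)
  show "j (c *\<^sub>C \<phi>) = c *\<^sub>C j \<phi>" for c \<phi>
    using j_i[of "c *\<^sub>C j \<phi>"] by (simp add: clinear_scale[OF clinear_i] i_j)
qed

text \<open>The same choice of an enumeration of the basis as in \<open>P_det\<close>\<close>

definition es :: "'u list" where "es = (SOME es. distinct es \<and> set es = cbasis)"

lemma es: "distinct es" "set es = cbasis"
proof -
  have "\<exists>es :: 'u list. distinct es \<and> set es = cbasis"
    using finite_distinct_list[OF finite_cbasis] by blast
  from someI_ex[OF this] show "distinct es" "set es = cbasis" by (auto simp: es_def)
qed

definition a_mat :: "'l cdual wfun mat" where
  "a_mat = mat (length es) (length es) (\<lambda>(r, c). a_endo br \<delta> il iu i (es ! c) (es ! r))"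

lemma P_eq: "P = det a_mat"
  by (simp add: P_det_def a_mat_def es_def Let_def)

lemma a_endo_apply: "a_endo br \<delta> il iu i u b = (\<Sum>e\<in>cbasis. coord b (j (dual_basis e)) *\<^sub>C \<omega> u e)"
  by (simp add: a_endo_def pure1_def sum_fun_apply)

text \<open>To first order in \<open>x\<close> the form \<open>\<omega>\<close> is \<open>\<nu>([u, v]\<^sub>\<ll>)\<close> with \<open>\<nu>\<close> in \<open>\<ll>\<^sup>*\<close>, so that the term of lowest
  degree of the determinant is a determinant of that form; it does not vanish for a generic \<open>\<nu>\<close>.
  The matrix is composed with \<open>i\<^sup>-\<^sup>1\<close>, which is why \<open>j\<close> appears below.\<close>

lemma P_nonzero: "P \<noteq> 0"
proof -
  obtain \<nu> where \<nu>: "\<And>u. (\<And>v. cd_app \<nu> (pl (br (iu u) (iu v))) = 0) \<Longrightarrow> u = 0"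
    using nondegenerate unfolding nondegenerate_splitting_def for_generic_def pl_def by blast
  define n where "n = length es"
  define B where "B u e = cd_app \<nu> (pl (br (iu u) (iu e)))" for u e
  define M where "M = mat n n (\<lambda>(r, c). \<Sum>e\<in>cbasis. coord (es ! r) (j (dual_basis e)) * B (es ! c) e)"
  have lin: "clinear (\<lambda>u. B u e)" "clinear (B u)" for u e
    unfolding B_def
    using clinear_br clinear_br_left clinear_iu clinear_projections clinear_cd_app[of \<nu>]
    by (simp_all add: clinear_iff)
  have "det M \<noteq> 0"
  proof
    assume "det M = 0"
    moreover have M: "M \<in> carrier_mat n n" by (simp add: M_def)
    ultimately obtain v where v: "v \<in> carrier_vec n" "v \<noteq> 0\<^sub>v n" "M *\<^sub>v v = 0\<^sub>v n"
      using det_0_iff_vec_prod_zero_field by blast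
    define u where "u = (\<Sum>k = 0..<n. (v $ k) *\<^sub>C es ! k)"
    define \<phi> where "\<phi> = (\<Sum>e\<in>cbasis. B u e *\<^sub>C dual_basis e)"
    have coord_u: "coord (es ! k) u = v $ k" if "k < n" for k
    proof -
      have "coord (es ! k) u = (\<Sum>m = 0..<n. v $ m * (if k = m then 1 else 0))"
        unfolding u_def clinear_sum[OF clinear_coord] clinear_scale[OF clinear_coord]
        using that es nth_mem[of _ es]
        by (intro sum.cong) (auto simp: coord_cbasis n_def nth_eq_iff_index_eq simp del: nth_mem)
      also have "\<dots> = v $ k" using that by (simp add: delta_mult)
      finally show ?thesis .
    qed
    have "coord (es ! r) (j \<phi>) = 0" if "r < n" for r
    proof -
      have "coord (es ! r) (j \<phi>) = (\<Sum>e\<in>cbasis. B u e * coord (es ! r) (j (dual_basis e)))"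
        by (simp add: \<phi>_def clinear_sum[OF clinear_j] clinear_scale[OF clinear_j]
            clinear_sum[OF clinear_coord] clinear_scale[OF clinear_coord])
      also have "\<dots> = (\<Sum>e\<in>cbasis. \<Sum>k = 0..<n. v $ k * B (es ! k) e * coord (es ! r) (j (dual_basis e)))"
        by (simp add: u_def clinear_sum[OF lin(1)] clinear_scale[OF lin(1)] sum_distrib_right)
      also have "\<dots> = (\<Sum>k = 0..<n. (\<Sum>e\<in>cbasis. coord (es ! r) (j (dual_basis e)) * B (es ! k) e) * v $ k)"
        by (subst sum.swap) (simp add: sum_distrib_left sum_distrib_right ac_simps)
      also have "\<dots> = (M *\<^sub>v v) $ r"
        using that v(1) by (simp add: M_def scalar_prod_def)
      also have "\<dots> = 0" using that by (simp add: v(3))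
      finally show ?thesis .
    qed
    then have "coord b (j \<phi>) = 0" if "b \<in> cbasis" for b
      using that es by (metis in_set_conv_nth n_def)
    then have "j \<phi> = 0" using coord_expand[of "j \<phi>"] by simp
    then have "\<phi> = 0" using i_j[of \<phi>] by (simp add: clinear_zero[OF clinear_i])
    have "B u w = cd_app \<phi> w" for w
      using clinear_expand[OF lin(2), of u w] by (simp add: \<phi>_def mult.commute)
    then have "u = 0" using \<nu>[of u] \<open>\<phi> = 0\<close> by (simp add: B_def)
    then have "v = 0\<^sub>v n"
      using coord_u v(1) by (intro eq_vecI) (simp_all add: clinear_zero[OF clinear_coord])
    with v(2) show False by simp
  qed
  moreover have "wval P (replicate n \<nu>) = fact n * det M"
    unfolding P_eq a_mat_def n_def[symmetric] M_def
    by (subst wval_det_replicate) (simp_all add: a_endo_apply wval_omega_Nil wval_omega_single B_def)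
  ultimately have "wval P (replicate n \<nu>) \<noteq> 0" by simp
  then show ?thesis by auto
qed

lemma formal_functions_a_mat:
  "r < length es \<Longrightarrow> c < length es \<Longrightarrow> a_mat $$ (r, c) \<in> FL"
  by (simp add: a_mat_def a_endo_apply formal_functions_sum formal_functions_cscale formal_functions_omega)

lemma a_mat_carrier: "a_mat \<in> carrier_mat (length es) (length es)"
  by (simp add: a_mat_def)

lemma formal_functions_P: "P \<in> FL"
  unfolding P_eq by (rule formal_functions_det[OF a_mat_carrier formal_functions_a_mat])

definition is_sigma :: "('u \<Rightarrow> 'u \<Rightarrow> 'l cdual wfun fract) \<Rightarrow> bool" where
  "is_sigma \<sigma> \<longleftrightarrow> \<sigma> \<in> wedge2 (localization FL P) \<and>
     (\<forall>v. ext2 (\<lambda>a b l. pure1 a (to_fract (\<omega> v b) * l)) \<sigma> = pure1 v 1)"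

lemma contraction_iff:
  "(\<forall>v. ext2 (\<lambda>a b l. pure1 a (to_fract (\<omega> v b) * l)) \<sigma> = pure1 v 1) \<longleftrightarrow>
   (\<forall>v\<in>cbasis. \<forall>c\<in>cbasis. (\<Sum>b\<in>cbasis. to_fract (\<omega> v b) * \<sigma> c b) = (if v = c then 1 else 0))"
  (is "?lhs \<longleftrightarrow> ?rhs")
proof -
  have contraction: "ext2 (\<lambda>a b l. pure1 a (to_fract (\<omega> v b) * l)) \<sigma> c = (\<Sum>b\<in>cbasis. to_fract (\<omega> v b) * \<sigma> c b)"
    if "c \<in> cbasis" for v c
    using sum_coord[OF that, of "\<lambda>a. \<Sum>b\<in>cbasis. to_fract (\<omega> v b) * \<sigma> a b"]
    by (simp add: ext2_def pure1_def sum_fun_apply cvec.scale_sum_right)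
  show ?thesis
  proof
    assume ?lhs
    show ?rhs
    proof (intro ballI)
      fix v c :: 'u assume v: "v \<in> cbasis" and c: "c \<in> cbasis"
      have "ext2 (\<lambda>a b l. pure1 a (to_fract (\<omega> v b) * l)) \<sigma> c = pure1 v 1 c"
        using \<open>?lhs\<close> by simp
      then show "(\<Sum>b\<in>cbasis. to_fract (\<omega> v b) * \<sigma> c b) = (if v = c then 1 else 0)"
        unfolding contraction[OF c] by (simp add: pure1_def coord_cbasis[OF v] cscale_one)
    qed
  next
    assume rhs: ?rhs
    show ?lhs
    proof (intro allI ext)
      fix v c
      show "ext2 (\<lambda>a b l. pure1 a (to_fract (\<omega> v b) * l)) \<sigma> c = pure1 v 1 c"
      proof (cases "c \<in> cbasis")
        case True
        have lin: "clinear (\<lambda>v. \<Sum>b\<in>cbasis. to_fract (\<omega> v b) * \<sigma> c b)"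
          by (rule clinearI)
             (simp_all add: clinear_add[OF clinear_omega(2)] clinear_scale[OF clinear_omega(2)] to_fract_cscale
               distrib_right sum.distrib cscale_mult_left cvec.scale_sum_right)
        have "(\<Sum>b\<in>cbasis. to_fract (\<omega> v b) * \<sigma> c b) = (\<Sum>d\<in>cbasis. coord d v *\<^sub>C (if d = c then 1 else 0))"
          unfolding clinear_expand[OF lin, of v] using rhs True by (intro sum.cong) auto
        also have "\<dots> = (\<Sum>d\<in>cbasis. if c = d then coord d v *\<^sub>C 1 else 0)"
          by (intro sum.cong) auto
        also have "\<dots> = coord c v *\<^sub>C 1" using True by (simp add: finite_cbasis)
        finally show ?thesis unfolding contraction[OF True] by (simp add: pure1_def)
      next
        case False
        then show ?thesis by (simp add: ext2_def pure1_def sum_fun_apply coord_outside)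
      qed
    qed
  qed
qed

text \<open>By Cramer's rule \<open>\<sigma>\<close> is the adjugate matrix divided by the determinant; its entries are in the
  localization because the cofactors are functions on the group.\<close>

lemma is_sigma_exists: "\<exists>\<sigma>. is_sigma \<sigma>"
proof -
  define n where "n = length es"
  have ex: "\<exists>k. k < n \<and> es ! k = c" if "c \<in> cbasis" for c
    using that unfolding es(2)[symmetric] in_set_conv_nth n_def .
  define idx where "idx c = (SOME k. k < n \<and> es ! k = c)" for c
  have idx: "idx c < n" "es ! idx c = c" if "c \<in> cbasis" for c
    using someI_ex[OF ex[OF that]] unfolding idx_def by blast+
  define g where "g c b = (\<Sum>s = 0..<n. coord (es ! s) (j (dual_basis b)) *\<^sub>C adj_mat a_mat $$ (idx c, s))" for c b
  define \<sigma> where "\<sigma> c b = (if c \<in> cbasis \<and> b \<in> cbasis then to_fract (g c b) / to_fract P ^ 1 else 0)" for c b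
  have inverse: "(\<Sum>b\<in>cbasis. to_fract (\<omega> v b) * \<sigma> c b) = (if v = c then 1 else 0)"
    if v: "v \<in> cbasis" and c: "c \<in> cbasis" for v c
  proof -
    have "(\<Sum>b\<in>cbasis. \<omega> v b * g c b) =
      (\<Sum>s = 0..<n. adj_mat a_mat $$ (idx c, s) * a_endo br \<delta> il iu i v (es ! s))"
      unfolding g_def a_endo_apply sum_distrib_left
      by (subst sum.swap) (simp add: cscale_mult_right mult.commute)
    also have "\<dots> = (adj_mat a_mat * a_mat) $$ (idx c, idx v)"
      using idx[OF v] idx[OF c] adj_mat(1)[OF a_mat_carrier]
      by (simp add: scalar_prod_def a_mat_def n_def)
    also have "\<dots> = (if v = c then P else 0)"
      unfolding adj_mat(3)[OF a_mat_carrier] P_eq using idx[OF v] idx[OF c]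
      by (auto simp: n_def)
    finally have "to_fract (\<Sum>b\<in>cbasis. \<omega> v b * g c b) = (if v = c then to_fract P else 0)" by simp
    moreover have "(\<Sum>b\<in>cbasis. to_fract (\<omega> v b) * \<sigma> c b) = to_fract (\<Sum>b\<in>cbasis. \<omega> v b * g c b) / to_fract P"
      using c by (simp add: \<sigma>_def to_fract_sum sum_divide_distrib)
    ultimately show ?thesis using P_nonzero by simp
  qed
  \<comment> \<open>by the skew symmetry of \<open>\<omega>\<close> the negative transpose of \<open>\<sigma>\<close> is an inverse matrix, too\<close>
  have skew: "\<sigma> b c = - \<sigma> c b" for b c
  proof (cases "b \<in> cbasis \<and> c \<in> cbasis")
    case True
    have left: "(\<Sum>v\<in>cbasis. \<sigma> v a * to_fract (\<omega> v b)) = (if a = b then 1 else 0)"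
      if "a \<in> cbasis" "b \<in> cbasis" for a b
      by (rule matrix_left_inverse_of_right_inverse[of cbasis "\<lambda>v b. to_fract (\<omega> v b)" "\<lambda>b v. \<sigma> v b"])
         (simp_all only: finite_cbasis inverse that)
    have "(\<Sum>b\<in>cbasis. to_fract (\<omega> v b) * (- \<sigma> b c)) = (if v = c then 1 else 0)"
      if "v \<in> cbasis" "c \<in> cbasis" for v c
    proof -
      have "to_fract (\<omega> v b) * (- \<sigma> b c) = \<sigma> b c * to_fract (\<omega> b v)" for b
        by (subst omega_skew) simp
      then show ?thesis using left[OF that(2,1)] by (cases "v = c") simp_all
    qed
    from matrix_right_inverse_unique[OF finite_cbasis inverse this, of b c] True
    show ?thesis by simp
  qed (auto simp: \<sigma>_def)
  have g: "g c b \<in> FL" if "c \<in> cbasis" for c b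
    unfolding g_def using idx[OF that]
    by (intro formal_functions_sum formal_functions_cscale formal_functions_adj_mat[OF a_mat_carrier formal_functions_a_mat])
       (simp_all add: n_def)
  have "\<sigma> c b \<in> localization FL P"
    if "c \<in> cbasis" "b \<in> cbasis" for c b
  proof -
    have "\<sigma> c b = to_fract (g c b) / to_fract P ^ 1" using that by (simp only: \<sigma>_def simp_thms if_True)
    with g[OF that(1)] show ?thesis unfolding localization_def by blast
  qed
  then have "\<sigma> \<in> wedge2 (localization FL P)"
    unfolding wedge2_def mem_Collect_eq
  proof (intro conjI)
    show "\<forall>b c. b \<notin> cbasis \<or> c \<notin> cbasis \<longrightarrow> \<sigma> b c = 0" by (auto simp: \<sigma>_def)
    show "\<forall>b c. \<sigma> b c = - \<sigma> c b" using skew by blast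
  qed blast
  then have "is_sigma \<sigma>"
    unfolding is_sigma_def contraction_iff using inverse by blast
  then show ?thesis by blast
qed

lemma is_sigma_unique: assumes "is_sigma \<sigma>" "is_sigma \<sigma>'" shows "\<sigma> = \<sigma>'"
proof (intro ext)
  fix b c
  show "\<sigma> b c = \<sigma>' b c"
  proof (cases "b \<in> cbasis \<and> c \<in> cbasis")
    case True
    have inverse: "(\<Sum>b\<in>cbasis. to_fract (\<omega> v b) * \<tau> c b) = (if v = c then 1 else 0)"
      if "is_sigma \<tau>" "v \<in> cbasis" "c \<in> cbasis" for \<tau> v c
      using that unfolding is_sigma_def contraction_iff by blast
    show ?thesis
      by (rule matrix_right_inverse_unique[OF finite_cbasis inverse[OF assms(1)] inverse[OF assms(2)]])
         (use True in auto)
  next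
    case False
    then have zero: "\<tau> b c = 0" if "is_sigma \<tau>" for \<tau>
      using that wedge2_outside unfolding is_sigma_def by blast
    show ?thesis by (simp only: zero[OF assms(1)] zero[OF assms(2)])
  qed
qed

abbreviation \<sigma> :: "'u \<Rightarrow> 'u \<Rightarrow> 'l cdual wfun fract" where "\<sigma> \<equiv> sigma br \<delta> \<delta>\<^sub>l il iu i"

lemma is_sigma: "is_sigma \<sigma>"
proof -
  obtain \<tau> where "is_sigma \<tau>" using is_sigma_exists ..
  then have "is_sigma (THE \<sigma>. is_sigma \<sigma>)"
    using theI[of is_sigma \<tau>] is_sigma_unique by blast
  then show ?thesis by (simp add: sigma_def is_sigma_def[abs_def])
qed

sublocale splitting_sigma br \<delta> br\<^sub>l \<delta>\<^sub>l il iu \<sigma>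
proof
  show "\<sigma> b c = - \<sigma> c b" for b c
    using is_sigma unfolding is_sigma_def wedge2_def mem_Collect_eq by blast
  fix c v :: 'u assume "c \<in> cbasis"
  have "ext2 (\<lambda>a b l. pure1 a (to_fract (\<omega> v b) * l)) \<sigma> c = pure1 v 1 c"
    using is_sigma by (simp add: is_sigma_def)
  then show "(\<Sum>b\<in>cbasis. to_fract (\<omega> v b) * \<sigma> c b) = coord c v *\<^sub>C 1"
    using sum_coord[OF \<open>c \<in> cbasis\<close>, of "\<lambda>a. \<Sum>b\<in>cbasis. to_fract (\<omega> v b) * \<sigma> a b"]
    by (simp add: ext2_def pure1_def sum_fun_apply cvec.scale_sum_right)
qed

end


section \<open>Contractions with sigma\<close>

context splitting_sigma
begin

text \<open>\<open>Y \<phi> f\<close> is the value at \<open>\<sigma>(\<phi>)\<close> of the function \<open>f\<close> on \<open>\<gg>\<close>, extended linearly over the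
  functions on \<open>L\<^sup>*\<close>: the first leg of \<open>\<sigma>\<close> is contracted with \<open>\<phi>\<close>, the second one with \<open>f\<close>.\<close>

definition Y :: "'g cdual \<Rightarrow> ('g \<Rightarrow> 'l cdual wfun fract) \<Rightarrow> 'l cdual wfun fract" where
  "Y \<phi> f = (\<Sum>p\<in>cbasis. cd_app \<phi> (iu p) *\<^sub>C (\<Sum>q\<in>cbasis. \<sigma> p q * f (iu q)))"

lemma Y_add: "Y \<phi> (\<lambda>v. f v + g v) = Y \<phi> f + Y \<phi> g"
  by (simp add: Y_def distrib_left sum.distrib cscale_add_right)

lemma Y_neg: "Y \<phi> (\<lambda>v. - f v) = - Y \<phi> f"
  by (simp add: Y_def sum_negf)

lemma Y_diff: "Y \<phi> (\<lambda>v. f v - g v) = Y \<phi> f - Y \<phi> g"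
  by (simp add: Y_def right_diff_distrib sum_subtractf cvec.scale_right_diff_distrib)

lemma Y_zero: "Y \<phi> (\<lambda>v. 0) = 0"
  by (simp add: Y_def)

lemma Y_cscale: "Y \<phi> (\<lambda>v. c *\<^sub>C f v) = c *\<^sub>C Y \<phi> f"
  by (simp add: Y_def cscale_mult_right cvec.scale_sum_right cscale_cscale mult.commute)

lemma Y_mult: "Y \<phi> (\<lambda>v. k * f v) = k * Y \<phi> f"
  by (simp add: Y_def cscale_mult_right sum_distrib_left mult.left_commute)

lemma Y_sum: "Y \<phi> (\<lambda>v. \<Sum>a\<in>A. f a v) = (\<Sum>a\<in>A. Y \<phi> (f a))"
  by (induction A rule: infinite_finite_induct) (simp_all add: Y_zero Y_add)

lemma Y_cong: "(\<And>q. f (iu q) = g (iu q)) \<Longrightarrow> Y \<phi> f = Y \<phi> g"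
  by (simp add: Y_def)

lemma Y_swap: "Y \<phi> (\<lambda>v. Y \<psi> (\<lambda>w. f v w)) = Y \<psi> (\<lambda>w. Y \<phi> (\<lambda>v. f v w))"
  unfolding Y_def[of \<psi>] Y_sum Y_cscale Y_mult by (simp only: Y_def[of \<psi>])

lemma clinear_Y:
  assumes "\<And>v. clinear (\<lambda>a. f a v)" shows "clinear (\<lambda>a. Y \<phi> (f a))"
proof (rule clinearI)
  have "f (x + y) = (\<lambda>v. f x v + f y v)" "f (c *\<^sub>C x) = (\<lambda>v. c *\<^sub>C f x v)" for x y c
    by (rule ext, rule clinear_add[OF assms], rule ext, rule clinear_scale[OF assms])
  then show "Y \<phi> (f (x + y)) = Y \<phi> (f x) + Y \<phi> (f y)" "Y \<phi> (f (c *\<^sub>C x)) = c *\<^sub>C Y \<phi> (f x)" for x y c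
    by (simp_all only: Y_add Y_cscale)
qed

lemma dual_bracket_l_linear: "clinear (\<lambda>\<phi>. dual_bracket \<delta>\<^sub>l \<phi> \<psi>)"
  by (rule lie_bialg.clinear_dual_bracket(2)[OF lie_bialg.intro[OF lie_bialgebra_l]])

definition upart :: "'g cdual \<Rightarrow> 'g cdual" where "upart \<phi> = uincl (precomp iu \<phi>)"
definition lpart :: "'g cdual \<Rightarrow> 'g cdual" where "lpart \<phi> = incl (precomp il \<phi>)"

lemma parts: "\<phi> = upart \<phi> + lpart \<phi>"
  using dual_decompose[of \<phi>] by (simp add: upart_def lpart_def add.commute)

lemma cd_app_parts [simp]:
  "cd_app (upart \<phi>) z = cd_app \<phi> (iu (pu z))" "cd_app (lpart \<phi>) z = cd_app \<phi> (il (pl z))"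
  by (simp_all add: upart_def lpart_def)

text \<open>Contracting the indices of \<open>X\<close> with linear forms passes from the basis of \<open>\<uu>\<^sup>*\<close> to arbitrary
  elements of \<open>\<gg>\<^sup>*\<close>, and splits a multilinear function on the graph into its components on \<open>\<gg>\<close>
  and \<open>\<gg>\<^sup>*\<close>.\<close>

lemma sum_X:
  assumes "clinear f"
  shows "(\<Sum>i\<in>cbasis. cd_app \<phi> (iu i) *\<^sub>C X i f) = f (0, upart \<phi>) - Y \<phi> (\<lambda>q. f (q, 0))"
proof -
  have "clinear (\<lambda>\<psi>. (0 :: 'g, uincl \<psi>))"
    by (intro clinearI) (auto simp: prod_eq_iff intro!: cd_eqI)
  from cdual_clinear_expand[OF clinear_compose[OF assms this], of "precomp iu \<phi>"]
  show ?thesis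
    by (simp add: X_def Y_def upart_def cvec.scale_right_diff_distrib sum_subtractf)
qed

lemma sum_XX:
  assumes g: "\<And>a. clinear (g a)" "\<And>b. clinear (\<lambda>a. g a b)"
  shows "(\<Sum>i\<in>cbasis. \<Sum>j\<in>cbasis. (cd_app \<phi> (iu i) * cd_app \<psi> (iu j)) *\<^sub>C X i (\<lambda>a. X j (g a))) =
    g (0, upart \<phi>) (0, upart \<psi>) - Y \<psi> (\<lambda>q. g (0, upart \<phi>) (q, 0)) - Y \<phi> (\<lambda>p. g (p, 0) (0, upart \<psi>))
      + Y \<phi> (\<lambda>p. Y \<psi> (\<lambda>q. g (p, 0) (q, 0)))"
proof -
  have "(\<Sum>i\<in>cbasis. \<Sum>j\<in>cbasis. (cd_app \<phi> (iu i) * cd_app \<psi> (iu j)) *\<^sub>C X i (\<lambda>a. X j (g a))) =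
    (\<Sum>i\<in>cbasis. cd_app \<phi> (iu i) *\<^sub>C X i (\<lambda>a. g a (0, upart \<psi>) - Y \<psi> (\<lambda>q. g a (q, 0))))"
    by (simp only: sum_X[OF g(1), symmetric] X_sum X_cscale cvec.scale_sum_right cscale_cscale)
  also have "\<dots> = g (0, upart \<phi>) (0, upart \<psi>) - Y \<psi> (\<lambda>q. g (0, upart \<phi>) (q, 0))
      - Y \<phi> (\<lambda>p. g (p, 0) (0, upart \<psi>) - Y \<psi> (\<lambda>q. g (p, 0) (q, 0)))"
  proof (rule sum_X)
    have "clinear (\<lambda>a. Y \<psi> (\<lambda>q. g a (q, 0)))" by (rule clinear_Y) (rule g(2))
    then show "clinear (\<lambda>a. g a (0, upart \<psi>) - Y \<psi> (\<lambda>q. g a (q, 0)))"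
      using g(2)[of "(0, upart \<psi>)"] by (simp add: clinear_iff cvec.scale_right_diff_distrib)
  qed
  finally show ?thesis by (simp add: Y_diff)
qed

lemma sum_XXX:
  assumes g: "\<And>a b. clinear (g a b)" "\<And>a c. clinear (\<lambda>b. g a b c)" "\<And>b c. clinear (\<lambda>a. g a b c)"
  shows "(\<Sum>i\<in>cbasis. \<Sum>j\<in>cbasis. \<Sum>k\<in>cbasis.
      (cd_app \<phi> (iu i) * cd_app \<psi> (iu j) * cd_app \<theta> (iu k)) *\<^sub>C X i (\<lambda>a. X j (\<lambda>b. X k (g a b)))) =
    g (0, upart \<phi>) (0, upart \<psi>) (0, upart \<theta>)
    - Y \<phi> (\<lambda>p. g (p, 0) (0, upart \<psi>) (0, upart \<theta>))
    - Y \<psi> (\<lambda>p. g (0, upart \<phi>) (p, 0) (0, upart \<theta>))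
    - Y \<theta> (\<lambda>p. g (0, upart \<phi>) (0, upart \<psi>) (p, 0))
    + Y \<phi> (\<lambda>p. Y \<psi> (\<lambda>q. g (p, 0) (q, 0) (0, upart \<theta>)))
    + Y \<phi> (\<lambda>p. Y \<theta> (\<lambda>q. g (p, 0) (0, upart \<psi>) (q, 0)))
    + Y \<psi> (\<lambda>p. Y \<theta> (\<lambda>q. g (0, upart \<phi>) (p, 0) (q, 0)))
    - Y \<phi> (\<lambda>p. Y \<psi> (\<lambda>q. Y \<theta> (\<lambda>r. g (p, 0) (q, 0) (r, 0))))"
proof -
  let ?h = "\<lambda>a. g a (0, upart \<psi>) (0, upart \<theta>) - Y \<theta> (\<lambda>r. g a (0, upart \<psi>) (r, 0))
      - Y \<psi> (\<lambda>q. g a (q, 0) (0, upart \<theta>)) + Y \<psi> (\<lambda>q. Y \<theta> (\<lambda>r. g a (q, 0) (r, 0)))"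
  have "(\<Sum>i\<in>cbasis. \<Sum>j\<in>cbasis. \<Sum>k\<in>cbasis.
      (cd_app \<phi> (iu i) * cd_app \<psi> (iu j) * cd_app \<theta> (iu k)) *\<^sub>C X i (\<lambda>a. X j (\<lambda>b. X k (g a b)))) =
    (\<Sum>i\<in>cbasis. cd_app \<phi> (iu i) *\<^sub>C X i ?h)"
    by (simp only: sum_XX[OF g(1,2), symmetric] X_sum X_cscale cvec.scale_sum_right cscale_cscale mult.assoc)
  also have "\<dots> = ?h (0, upart \<phi>) - Y \<phi> (\<lambda>p. ?h (p, 0))"
  proof (rule sum_X)
    have "clinear (\<lambda>a. Y \<theta> (\<lambda>r. g a (0, upart \<psi>) (r, 0)))"
      "clinear (\<lambda>a. Y \<psi> (\<lambda>q. g a (q, 0) (0, upart \<theta>)))"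
      "clinear (\<lambda>a. Y \<psi> (\<lambda>q. Y \<theta> (\<lambda>r. g a (q, 0) (r, 0))))"
      by (intro clinear_Y g(3))+
    then show "clinear ?h"
      using g(3)[of "(0, upart \<psi>)" "(0, upart \<theta>)"]
      by (simp add: clinear_iff cvec.scale_right_diff_distrib cscale_add_right)
  qed
  finally show ?thesis by (simp add: Y_diff Y_add algebra_simps)
qed

lemma trilinear_form_linear:
  "clinear (\<lambda>c. double_pairing (a \<star> b) c *\<^sub>C (1 :: 'l cdual wfun fract))"
  "clinear (\<lambda>b. double_pairing (a \<star> b) c *\<^sub>C (1 :: 'l cdual wfun fract))"
  "clinear (\<lambda>a. double_pairing (a \<star> b) c *\<^sub>C (1 :: 'l cdual wfun fract))"
proof -
  have one: "clinear (\<lambda>k::complex. k *\<^sub>C (1 :: 'l cdual wfun fract))"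
    by (rule clinearI) (simp_all add: cscale_add_left cscale_cscale)
  show "clinear (\<lambda>c. double_pairing (a \<star> b) c *\<^sub>C (1 :: 'l cdual wfun fract))"
    by (rule clinear_compose[OF one clinear_double_pairing(1)])
  show "clinear (\<lambda>b. double_pairing (a \<star> b) c *\<^sub>C (1 :: 'l cdual wfun fract))"
    by (rule clinear_compose[OF one clinear_compose[OF clinear_double_pairing(2) clinear_double_bracket]])
  show "clinear (\<lambda>a. double_pairing (a \<star> b) c *\<^sub>C (1 :: 'l cdual wfun fract))"
    by (rule clinear_compose[OF one clinear_compose[OF clinear_double_pairing(2) clinear_double_bracket_left]])
qed

abbreviation scalar :: "complex \<Rightarrow> 'l cdual wfun fract" where "scalar c \<equiv> c *\<^sub>C 1"

lemma trilinear_form_cases: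
  "double_pairing ((x, 0) \<star> (y, 0)) (0, \<theta>) = cd_app \<theta> (br x y)"
  "double_pairing ((x, 0) \<star> (0, \<eta>)) (z, 0) = cd_app \<eta> (br z x)"
  "double_pairing ((0, \<xi>) \<star> (y, 0)) (z, 0) = cd_app \<xi> (br y z)"
  "double_pairing ((x, 0) \<star> (0, \<eta>)) (0, \<theta>) = cd_app (dual_bracket \<delta> \<eta> \<theta>) x"
  "double_pairing ((0, \<xi>) \<star> (y, 0)) (0, \<theta>) = cd_app (dual_bracket \<delta> \<theta> \<xi>) y"
  "double_pairing ((0, \<xi>) \<star> (0, \<eta>)) (z, 0) = cd_app (dual_bracket \<delta> \<xi> \<eta>) z"
  using clinear_zero[OF clinear_dual_bracket(1)] clinear_zero[OF clinear_dual_bracket(2)]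
    clinear_zero[OF clinear_br] clinear_zero[OF clinear_br_left]
  by (simp_all add: trilinear_form cd_app_linear)

lemma Y_br_skew:
  "Y \<phi> (\<lambda>v. Y \<psi> (\<lambda>w. scalar (cd_app \<xi> (br w v)))) = - Y \<phi> (\<lambda>v. Y \<psi> (\<lambda>w. scalar (cd_app \<xi> (br v w))))"
proof -
  have "scalar (cd_app \<xi> (br w v)) = - scalar (cd_app \<xi> (br v w))" for v w
    by (subst br_skew) (simp add: clinear_neg[OF clinear_cd_app])
  then have "Y \<phi> (\<lambda>v. Y \<psi> (\<lambda>w. scalar (cd_app \<xi> (br w v)))) = Y \<phi> (\<lambda>v. Y \<psi> (\<lambda>w. - scalar (cd_app \<xi> (br v w))))"
    by (intro Y_cong)
  then show ?thesis by (simp only: Y_neg)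
qed

text \<open>Expanded, the vanishing of the trilinear form on the graph is the component of the dynamical
  Yang-Baxter equation of \<open>\<sigma>\<close> in \<open>\<uu> \<otimes> \<uu> \<otimes> \<uu>\<close>; there is no derivative in this component.\<close>

lemma Y_trilinear:
  "Y \<beta> (\<lambda>v. Y \<gamma> (\<lambda>w. scalar (cd_app (upart \<theta>) (br v w)))) - Y \<beta> (\<lambda>v. Y \<theta> (\<lambda>w. scalar (cd_app (upart \<gamma>) (br v w))))
    + Y \<gamma> (\<lambda>v. Y \<theta> (\<lambda>w. scalar (cd_app (upart \<beta>) (br v w)))) =
   Y \<beta> (\<lambda>v. scalar (cd_app (dual_bracket \<delta> (upart \<gamma>) (upart \<theta>)) v))
   + Y \<gamma> (\<lambda>v. scalar (cd_app (dual_bracket \<delta> (upart \<theta>) (upart \<beta>)) v))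
   + Y \<theta> (\<lambda>v. scalar (cd_app (dual_bracket \<delta> (upart \<beta>) (upart \<gamma>)) v))"
proof -
  have "(\<Sum>i\<in>cbasis. \<Sum>j\<in>cbasis. \<Sum>k\<in>cbasis.
      (cd_app \<beta> (iu i) * cd_app \<gamma> (iu j) * cd_app \<theta> (iu k)) *\<^sub>C
        X i (\<lambda>a. X j (\<lambda>b. X k (\<lambda>c. scalar (double_pairing (a \<star> b) c))))) = 0"
    by (simp add: X_trilinear_zero)
  then show ?thesis
    unfolding sum_XXX[OF trilinear_form_linear]
    by (simp add: trilinear_form_cases trilinear_form_dual_isotropic Y_zero Y_br_skew[of \<beta> \<theta> "upart \<gamma>"]
        algebra_simps del: cd_app_parts)
qed

text \<open>The components of the same equation with one leg in \<open>\<ll>\<close>, which involve the derivatives of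
  \<open>\<sigma>\<close>\<close>

lemma Lop_contraction:
  "(\<Sum>i\<in>cbasis. \<Sum>j\<in>cbasis. (cd_app \<beta> (iu i) * cd_app \<gamma> (iu j)) *\<^sub>C
      (\<Sum>e\<in>cbasis. cd_app \<theta> (il e) *\<^sub>C extend_derivation (Lop (dual_basis e)) (\<sigma> i j))) =
    Y \<beta> (\<lambda>v. Y \<gamma> (\<lambda>w. scalar (cd_app (lpart \<theta>) (br v w))))
    - Y \<gamma> (\<lambda>v. scalar (cd_app (dual_bracket \<delta> (lpart \<theta>) (upart \<beta>)) v))
    - Y \<beta> (\<lambda>v. scalar (cd_app (dual_bracket \<delta> (upart \<gamma>) (lpart \<theta>)) v))"
proof -
  have lin: "clinear (\<lambda>\<zeta>. scalar (double_pairing ((0, incl \<zeta>) \<star> a) b))" for a b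
  proof -
    have "clinear (\<lambda>\<zeta>. (0 :: 'g, incl \<zeta>))" using clinear_incl by (simp add: clinear_iff)
    from clinear_compose[OF trilinear_form_linear(3) this] show ?thesis .
  qed
  have "(\<Sum>e\<in>cbasis. cd_app \<theta> (il e) *\<^sub>C extend_derivation (Lop (dual_basis e)) (\<sigma> i j)) =
      X i (\<lambda>a. X j (\<lambda>b. scalar (double_pairing ((0, lpart \<theta>) \<star> a) b)))"
    if "i \<in> cbasis" "j \<in> cbasis" for i j
    unfolding lpart_def cdual_clinear_expand[OF lin, of "precomp il \<theta>"]
    by (simp only: Lop_\<sigma>[OF that] X_sum X_cscale cd_app_precomp_il)
  then have "(\<Sum>i\<in>cbasis. \<Sum>j\<in>cbasis. (cd_app \<beta> (iu i) * cd_app \<gamma> (iu j)) *\<^sub>C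
      (\<Sum>e\<in>cbasis. cd_app \<theta> (il e) *\<^sub>C extend_derivation (Lop (dual_basis e)) (\<sigma> i j))) =
    (\<Sum>i\<in>cbasis. \<Sum>j\<in>cbasis. (cd_app \<beta> (iu i) * cd_app \<gamma> (iu j)) *\<^sub>C
      X i (\<lambda>a. X j (\<lambda>b. scalar (double_pairing ((0, lpart \<theta>) \<star> a) b))))"
    by simp
  then show ?thesis
    unfolding sum_XX[OF trilinear_form_linear(1,2)]
    by (simp add: trilinear_form_cases trilinear_form_dual_isotropic del: cd_app_parts)
qed

text \<open>The equivariance of \<open>\<sigma>\<close>: as the cobracket of \<open>\<ll>\<close> is in \<open>\<ll> \<otimes> \<ll>\<close>, it does not contribute.\<close>

lemma dress_contraction:
  "(\<Sum>i\<in>cbasis. \<Sum>j\<in>cbasis. (cd_app \<beta> (iu i) * cd_app \<gamma> (iu j)) *\<^sub>C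
      extend_derivation (dress br\<^sub>l \<delta>\<^sub>l a) (\<sigma> i j)) =
    Y \<gamma> (\<lambda>v. scalar (cd_app \<beta> (br (il a) v))) - Y \<beta> (\<lambda>v. scalar (cd_app \<gamma> (br (il a) v)))"
proof -
  have "(\<Sum>i\<in>cbasis. \<Sum>j\<in>cbasis. (cd_app \<beta> (iu i) * cd_app \<gamma> (iu j)) *\<^sub>C
      extend_derivation (dress br\<^sub>l \<delta>\<^sub>l a) (\<sigma> i j)) =
    (\<Sum>i\<in>cbasis. \<Sum>j\<in>cbasis. (cd_app \<beta> (iu i) * cd_app \<gamma> (iu j)) *\<^sub>C
      X i (\<lambda>z. X j (\<lambda>z'. scalar (double_pairing ((il a, 0) \<star> z) z'))))"
    by (simp add: dress_\<sigma>)
  also have "\<dots> = scalar (cd_app (dual_bracket \<delta> (upart \<beta>) (upart \<gamma>)) (il a))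
      - Y \<gamma> (\<lambda>v. scalar (cd_app (upart \<beta>) (br v (il a)))) - Y \<beta> (\<lambda>v. scalar (cd_app (upart \<gamma>) (br (il a) v)))"
    unfolding sum_XX[OF trilinear_form_linear(1,2)]
    by (simp add: trilinear_form_cases Y_zero del: cd_app_parts)
  also have "cd_app (dual_bracket \<delta> (upart \<beta>) (upart \<gamma>)) (il a) = 0"
  proof -
    have "precomp il (upart \<beta>) = 0" by (rule cd_eqI) (simp add: cd_app_linear clinear_zero[OF clinear_iu])
    then show ?thesis
      unfolding dual_bracket_il
      using clinear_zero[OF dual_bracket_l_linear] by simp
  qed
  also have "Y \<gamma> (\<lambda>v. scalar (cd_app (upart \<beta>) (br v (il a)))) = - Y \<gamma> (\<lambda>v. scalar (cd_app \<beta> (br (il a) v)))"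
    unfolding Y_neg[symmetric]
  proof (rule Y_cong)
    fix q
    obtain u where "br (il a) (iu q) = iu u" using br_il_iu by blast
    then show "scalar (cd_app (upart \<beta>) (br (iu q) (il a))) = - scalar (cd_app \<beta> (br (il a) (iu q)))"
      by (subst br_skew) (simp add: clinear_neg[OF clinear_cd_app])
  qed
  also have "Y \<beta> (\<lambda>v. scalar (cd_app (upart \<gamma>) (br (il a) v))) = Y \<beta> (\<lambda>v. scalar (cd_app \<gamma> (br (il a) v)))"
  proof (rule Y_cong)
    fix q
    obtain u where "br (il a) (iu q) = iu u" using br_il_iu by blast
    then show "scalar (cd_app (upart \<gamma>) (br (il a) (iu q))) = scalar (cd_app \<gamma> (br (il a) (iu q)))" by simp
  qed
  finally show ?thesis by simp
qed

end


section \<open>Localizations\<close>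

lemma localization_extend:
  assumes "q \<in> localization (formal_functions br) P" "P \<noteq> 0" "P' \<noteq> 0" "P' \<in> formal_functions br"
  shows "q \<in> localization (formal_functions br) (P * P')"
proof -
  obtain f n where q: "q = to_fract f / to_fract P ^ n" "f \<in> formal_functions br"
    using assms(1) by (auto simp: localization_def)
  have "to_fract P' \<noteq> 0" using assms(3) by simp
  have pow: "to_fract (x ^ n) = to_fract x ^ n" for x :: "'a wfun"
    by (induction n) simp_all
  have "q = to_fract (f * P' ^ n) / to_fract (P * P') ^ n"
    unfolding q(1) to_fract_mult power_mult_distrib pow using assms(3) by simp
  moreover have "f * P' ^ n \<in> formal_functions br"
    by (intro formal_functions_mult formal_functions_power q assms)
  ultimately show ?thesis unfolding localization_def by blast
qed

lemma localization_add:
  assumes "p \<in> localization (formal_functions br) P" "q \<in> localization (formal_functions br) P"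
    and P: "P \<noteq> 0" "P \<in> formal_functions br"
  shows "p + q \<in> localization (formal_functions br) P"
proof -
  have pow: "to_fract (x ^ n) = to_fract x ^ n" for x :: "'a wfun" and n
    by (induction n) simp_all
  obtain f m where p: "p = to_fract f / to_fract P ^ m" "f \<in> formal_functions br"
    using assms(1) by (auto simp: localization_def)
  obtain g n where q: "q = to_fract g / to_fract P ^ n" "g \<in> formal_functions br"
    using assms(2) by (auto simp: localization_def)
  have "to_fract P \<noteq> 0" using P by simp
  then have "p + q = to_fract (f * P ^ n + g * P ^ m) / to_fract P ^ (m + n)"
    unfolding p(1) q(1) to_fract_add to_fract_mult pow power_add by (simp add: field_simps)
  moreover have "f * P ^ n + g * P ^ m \<in> formal_functions br"
    by (intro formal_functions_mult formal_functions_add formal_functions_power p q P)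
  ultimately show ?thesis unfolding localization_def by blast
qed

lemma localization_cscale:
  assumes "p \<in> localization (formal_functions br) P"
  shows "c *\<^sub>C p \<in> localization (formal_functions br) P"
proof -
  obtain f m where p: "p = to_fract f / to_fract P ^ m" "f \<in> formal_functions br"
    using assms(1) by (auto simp: localization_def)
  have "c *\<^sub>C p = to_fract (c *\<^sub>C f) / to_fract P ^ m"
    by (simp add: p(1) to_fract_cscale cscale_mult_left divide_inverse)
  then show ?thesis unfolding localization_def using formal_functions_cscale[OF p(2)] by blast
qed

lemma localization_zero: "0 \<in> localization (formal_functions br) P"
proof -
  have "0 = to_fract 0 / to_fract P ^ 0" by simp
  then show ?thesis unfolding localization_def using formal_functions_zero by blast
qed

lemma localization_sum:
  assumes "P \<noteq> 0" "P \<in> formal_functions br"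
    and "\<And>a. a \<in> A \<Longrightarrow> q a \<in> localization (formal_functions br) P"
  shows "(\<Sum>a\<in>A. q a) \<in> localization (formal_functions br) P"
  using assms(3)
  by (induction A rule: infinite_finite_induct)
     (simp_all add: localization_zero localization_add assms(1,2))

lemma cyb_add:
  "cyb br (s + s') t b c d = cyb br s t b c d + cyb br s' t b c d"
  "cyb br s (t + t') b c d = cyb br s t b c d + cyb br s t' b c d"
  by (simp_all add: cyb_def distrib_left distrib_right cscale_add_right sum.distrib)

section \<open>Poisson-Lie dynamical r-matrices with values in an ambient Lie bialgebra\<close>

locale ambient_splitting = nondegenerate_splitting_data br \<delta> br\<^sub>l \<delta>\<^sub>l il iu i
  for br :: "'g::fd_complex_space \<Rightarrow> 'g \<Rightarrow> 'g" and \<delta> and br\<^sub>l :: "'l::fd_complex_space \<Rightarrow> 'l \<Rightarrow> 'l"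
    and \<delta>\<^sub>l and il and iu :: "'u::fd_complex_space \<Rightarrow> 'g" and i :: "'u \<Rightarrow> 'u cdual" +
  fixes br\<^sub>a :: "'a::fd_complex_space \<Rightarrow> 'a \<Rightarrow> 'a" and \<delta>\<^sub>a :: "'a \<Rightarrow> 'a \<Rightarrow> 'a \<Rightarrow> complex" and \<iota> :: "'g \<Rightarrow> 'a"
  assumes inclusion: "lie_bialgebra_inclusion br \<delta> br\<^sub>a \<delta>\<^sub>a \<iota>"
begin

lemma clinear_\<iota>: "clinear \<iota>" and \<iota>_br: "\<iota> (br x y) = br\<^sub>a (\<iota> x) (\<iota> y)"
  and \<delta>_\<iota>: "\<delta>\<^sub>a (\<iota> x) = tmap2 \<iota> (\<delta> x)" and lie_bialgebra_a: "lie_bialgebra br\<^sub>a \<delta>\<^sub>a"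
  using inclusion unfolding lie_bialgebra_inclusion_def by blast+

lemmas lie_bialg_a = lie_bialg.intro[OF lie_bialgebra_a]

lemma clinear_\<delta>a: "clinear \<delta>\<^sub>a"
  and clinear_bra: "clinear (br\<^sub>a x)" "clinear (\<lambda>x. br\<^sub>a x y)" and bra_skew: "br\<^sub>a x y = - br\<^sub>a y x"
  using lie_bialg.clinear_\<delta>[OF lie_bialg_a] lie_bialg.clinear_br[OF lie_bialg_a]
    lie_bialg.clinear_br_left[OF lie_bialg_a] lie_bialg.br_skew[OF lie_bialg_a] by blast+

text \<open>The coordinate form of \<open>b\<close> on the ambient Lie bialgebra, pulled back to \<open>\<gg>\<close>: the components of
  a tensor in \<open>\<gg>\<close> with respect to the basis of the ambient space are its contractions with these.\<close>

definition pb :: "'a \<Rightarrow> 'g cdual" where "pb b = precomp \<iota> (dual_basis b)"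

lemma cd_app_pb: "cd_app (pb b) x = coord b (\<iota> x)"
  by (simp add: pb_def cd_app_precomp[OF clinear_\<iota>])

definition \<tau> :: "'a \<Rightarrow> 'a \<Rightarrow> 'l cdual wfun fract" where "\<tau> = tmap2 (\<iota> \<circ> iu) \<sigma>"

lemma \<tau>_eq:
  "\<tau> b c = (\<Sum>x\<in>cbasis. \<Sum>y\<in>cbasis. (cd_app (pb b) (iu x) * cd_app (pb c) (iu y)) *\<^sub>C \<sigma> x y)"
  by (simp add: \<tau>_def tmap2_apply cd_app_pb)

lemma \<tau>_skew: "\<tau> b c = - \<tau> c b"
proof -
  have "\<tau> b c = (\<Sum>x\<in>cbasis. \<Sum>y\<in>cbasis. - ((cd_app (pb c) (iu y) * cd_app (pb b) (iu x)) *\<^sub>C \<sigma> y x))"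
    unfolding \<tau>_eq by (intro sum.cong refl) (subst \<sigma>_skew, simp add: mult.commute)
  also have "\<dots> = - \<tau> c b"
    unfolding \<tau>_eq by (subst sum.swap) (simp add: sum_negf)
  finally show ?thesis .
qed

lemma \<tau>_contract_right:
  assumes "clinear f" shows "(\<Sum>x\<in>cbasis. \<tau> c x * f x) = Y (pb c) (\<lambda>v. f (\<iota> v))"
proof -
  let ?f = "\<lambda>x p q. cd_app (pb c) (iu p) *\<^sub>C (\<sigma> p q * (coord x (\<iota> (iu q)) *\<^sub>C f x))"
  have "(\<Sum>x\<in>cbasis. \<tau> c x * f x) = (\<Sum>x\<in>cbasis. \<Sum>p\<in>cbasis. \<Sum>q\<in>cbasis. ?f x p q)"
    by (simp add: \<tau>_eq cd_app_pb sum_distrib_right cscale_mult_left cscale_mult_right cscale_cscale)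
  also have "\<dots> = (\<Sum>p\<in>cbasis. \<Sum>x\<in>cbasis. \<Sum>q\<in>cbasis. ?f x p q)"
    by (rule sum.swap)
  also have "\<dots> = (\<Sum>p\<in>cbasis. \<Sum>q\<in>cbasis. \<Sum>x\<in>cbasis. ?f x p q)"
    by (rule sum_swap_inner)
  also have "\<dots> = (\<Sum>p\<in>cbasis. cd_app (pb c) (iu p) *\<^sub>C (\<Sum>q\<in>cbasis. \<sigma> p q * (\<Sum>x\<in>cbasis. coord x (\<iota> (iu q)) *\<^sub>C f x)))"
    by (simp only: cvec.scale_sum_right sum_distrib_left)
  also have "\<dots> = Y (pb c) (\<lambda>v. f (\<iota> v))"
    by (simp only: Y_def clinear_expand[OF assms, symmetric])
  finally show ?thesis .
qed

lemma \<tau>_contract_left: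
  assumes "clinear f" shows "(\<Sum>x\<in>cbasis. \<tau> x c * f x) = - Y (pb c) (\<lambda>v. f (\<iota> v))"
proof -
  have "(\<Sum>x\<in>cbasis. \<tau> x c * f x) = (\<Sum>x\<in>cbasis. - (\<tau> c x * f x))"
    by (intro sum.cong refl) (subst \<tau>_skew, simp)
  then show ?thesis by (simp add: sum_negf \<tau>_contract_right[OF assms])
qed

lemma scalar_linear:
  "clinear f \<Longrightarrow> clinear (\<lambda>x. scalar (f x))"
  by (simp add: clinear_iff cscale_add_left cscale_cscale)

lemma clinear_coord_bra: "clinear (\<lambda>x. coord b (br\<^sub>a x y))" "clinear (\<lambda>y. coord b (br\<^sub>a x y))"
  by (rule clinear_compose[OF clinear_coord clinear_bra(2)]) (rule clinear_compose[OF clinear_coord clinear_bra(1)])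

lemma cyb_\<tau>_\<tau>:
  "cyb br\<^sub>a \<tau> \<tau> b c d =
     Y (pb c) (\<lambda>v. Y (pb d) (\<lambda>w. scalar (cd_app (pb b) (br v w))))
   - Y (pb b) (\<lambda>v. Y (pb d) (\<lambda>w. scalar (cd_app (pb c) (br v w))))
   + Y (pb b) (\<lambda>v. Y (pb c) (\<lambda>w. scalar (cd_app (pb d) (br v w))))"
proof -
  have lin: "clinear (\<lambda>x. Y \<phi> (\<lambda>w. scalar (coord e (br\<^sub>a x (\<iota> w)))))" for \<phi> e
    by (intro clinear_Y scalar_linear clinear_coord_bra)
  note lin' = scalar_linear[OF clinear_coord_bra(2)]
  have expand: "(\<Sum>x\<in>cbasis. \<Sum>y\<in>cbasis. coord e (br\<^sub>a x y) *\<^sub>C (s x * t y)) =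
      (\<Sum>x\<in>cbasis. s x * (\<Sum>y\<in>cbasis. t y * scalar (coord e (br\<^sub>a x y))))"
    for s t :: "'a \<Rightarrow> 'l cdual wfun fract" and e
    by (simp add: sum_distrib_left cscale_mult_right)
  have lneg: "clinear (\<lambda>x. - f x)" if "clinear f" for f :: "'a \<Rightarrow> 'l cdual wfun fract"
    using that by (simp add: clinear_iff)
  show ?thesis
    unfolding cyb_def expand \<tau>_contract_left[OF lin'] \<tau>_contract_right[OF lin']
      \<tau>_contract_left[OF lneg[OF lin]] \<tau>_contract_right[OF lneg[OF lin]] \<tau>_contract_left[OF lin] \<tau>_contract_right[OF lin]
    by (simp add: cd_app_pb \<iota>_br Y_neg)
qed

lemma cob2_\<tau>:
  assumes "b \<in> cbasis" "c \<in> cbasis" "d \<in> cbasis"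
  shows "cob2 \<delta>\<^sub>a \<tau> b c d = - Y (pb d) (\<lambda>v. scalar (cd_app (dual_bracket \<delta> (pb b) (pb c)) v))"
proof -
  have "clinear (\<lambda>x. \<delta>\<^sub>a x b c)" using clinear_\<delta>a by (simp add: clinear_iff)
  note lin = scalar_linear[OF this]
  have "\<delta>\<^sub>a (\<iota> v) b c = cd_app (dual_bracket \<delta> (pb b) (pb c)) v" for v
    by (simp add: \<delta>_\<iota> tmap2_apply cd_app_dual_bracket cd_app_pb mult.commute mult.left_commute)
  moreover have "cob2 \<delta>\<^sub>a \<tau> b c d = (\<Sum>x\<in>cbasis. \<tau> x d * scalar (\<delta>\<^sub>a x b c))"
    by (simp add: cob2_apply[OF assms] cscale_mult_right)
  ultimately show ?thesis by (simp add: \<tau>_contract_left[OF lin])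
qed

lemma derivation_\<tau>:
  assumes "derivation D"
  shows "D (\<tau> b c) = (\<Sum>x\<in>cbasis. \<Sum>y\<in>cbasis. (cd_app (pb b) (iu x) * cd_app (pb c) (iu y)) *\<^sub>C D (\<sigma> x y))"
  by (simp only: \<tau>_eq clinear_sum[OF derivation_linear[OF assms]] clinear_scale[OF derivation_linear[OF assms]])

lemma dL_\<tau>:
  assumes "b \<in> cbasis" "c \<in> cbasis"
  shows "dL (\<iota> \<circ> il) \<tau> b c d =
    Y (pb c) (\<lambda>v. scalar (cd_app (dual_bracket \<delta> (lpart (pb d)) (upart (pb b))) v))
    + Y (pb b) (\<lambda>v. scalar (cd_app (dual_bracket \<delta> (upart (pb c)) (lpart (pb d))) v))
    - Y (pb b) (\<lambda>v. Y (pb c) (\<lambda>w. scalar (cd_app (lpart (pb d)) (br v w))))"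
proof -
  let ?f = "\<lambda>x y e. (cd_app (pb b) (iu x) * cd_app (pb c) (iu y)) *\<^sub>C
      (cd_app (pb d) (il e) *\<^sub>C extend_derivation (Lop (dual_basis e)) (\<sigma> x y))"
  have "dL (\<iota> \<circ> il) \<tau> b c d = - (\<Sum>e\<in>cbasis. \<Sum>x\<in>cbasis. \<Sum>y\<in>cbasis. ?f x y e)"
    unfolding dL_apply[OF assms] derivation_\<tau>[OF derivation_extend[OF derivation_Lop]]
    by (simp add: cd_app_pb cvec.scale_sum_right cscale_cscale ac_simps)
  also have "\<dots> = - (\<Sum>x\<in>cbasis. \<Sum>e\<in>cbasis. \<Sum>y\<in>cbasis. ?f x y e)"
    by (subst sum.swap) (rule refl)
  also have "\<dots> = - (\<Sum>x\<in>cbasis. \<Sum>y\<in>cbasis. \<Sum>e\<in>cbasis. ?f x y e)"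
    by (subst sum_swap_inner) (rule refl)
  also have "\<dots> = - (\<Sum>x\<in>cbasis. \<Sum>y\<in>cbasis. (cd_app (pb b) (iu x) * cd_app (pb c) (iu y)) *\<^sub>C
      (\<Sum>e\<in>cbasis. cd_app (pb d) (il e) *\<^sub>C extend_derivation (Lop (dual_basis e)) (\<sigma> x y)))"
    by (simp only: cvec.scale_sum_right)
  finally show ?thesis unfolding Lop_contraction by simp
qed

text \<open>The dynamical Yang-Baxter equation of \<open>\<sigma>\<close>, with right hand side 0.  Decomposing the coordinate
  forms according to \<open>\<gg>\<^sup>* = \<uu>\<^sup>* \<oplus> \<ll>\<^sup>*\<close>, the terms with at least one part in \<open>\<ll>\<^sup>*\<close> cancel against the
  derivatives of \<open>\<sigma>\<close>, and the others are those of the invariant trilinear form on the graph.\<close>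

lemma dynamical_yang_baxter_\<tau>:
  assumes b: "b \<in> cbasis" and c: "c \<in> cbasis" and d: "d \<in> cbasis"
  shows "cyb br\<^sub>a \<tau> \<tau> b c d + Alt3 (dL (\<iota> \<circ> il) \<tau>) b c d + Alt3 (cob2 \<delta>\<^sub>a \<tau>) b c d = 0"
proof -
  have br: "Y \<phi> (\<lambda>v. Y \<psi> (\<lambda>w. scalar (cd_app \<xi> (br v w)))) =
      Y \<phi> (\<lambda>v. Y \<psi> (\<lambda>w. scalar (cd_app (upart \<xi>) (br v w)))) + Y \<phi> (\<lambda>v. Y \<psi> (\<lambda>w. scalar (cd_app (lpart \<xi>) (br v w))))"
    for \<phi> \<psi> \<xi>
    by (subst parts[of \<xi>]) (simp only: cd_app_add cscale_add_left Y_add)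
  have \<delta>: "Y \<phi> (\<lambda>v. scalar (cd_app (dual_bracket \<delta> \<psi> \<xi>) v)) =
      Y \<phi> (\<lambda>v. scalar (cd_app (dual_bracket \<delta> (upart \<psi>) (upart \<xi>)) v))
    + Y \<phi> (\<lambda>v. scalar (cd_app (dual_bracket \<delta> (upart \<psi>) (lpart \<xi>)) v))
    + Y \<phi> (\<lambda>v. scalar (cd_app (dual_bracket \<delta> (lpart \<psi>) (upart \<xi>)) v))" for \<phi> \<psi> \<xi>
  proof -
    have "cd_app (dual_bracket \<delta> (lpart \<psi>) (lpart \<xi>)) (iu q) = 0" for q
      by (simp add: lpart_def dual_bracket_incl cd_app_linear)
    then have "Y \<phi> (\<lambda>v. scalar (cd_app (dual_bracket \<delta> (lpart \<psi>) (lpart \<xi>)) v)) = 0"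
      by (simp add: Y_def)
    moreover have "dual_bracket \<delta> \<psi> \<xi> = dual_bracket \<delta> (upart \<psi>) (upart \<xi>) + dual_bracket \<delta> (upart \<psi>) (lpart \<xi>)
        + (dual_bracket \<delta> (lpart \<psi>) (upart \<xi>) + dual_bracket \<delta> (lpart \<psi>) (lpart \<xi>))"
      by (subst parts[of \<psi>], subst parts[of \<xi>])
         (simp only: clinear_add[OF clinear_dual_bracket(1)] clinear_add[OF clinear_dual_bracket(2)] ac_simps)
    ultimately show ?thesis by (simp only: cd_app_add cscale_add_left Y_add) simp
  qed
  have swap: "Y (pb d) (\<lambda>v. Y (pb b) (\<lambda>w. scalar (cd_app (lpart (pb c)) (br v w)))) =
      - Y (pb b) (\<lambda>v. Y (pb d) (\<lambda>w. scalar (cd_app (lpart (pb c)) (br v w))))"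
    by (subst Y_swap) (rule Y_br_skew)
  show ?thesis
    using Y_trilinear[of "pb b" "pb c" "pb d"]
    unfolding Alt3_def cyb_\<tau>_\<tau> dL_\<tau>[OF b c] dL_\<tau>[OF c d] dL_\<tau>[OF d b]
      cob2_\<tau>[OF b c d] cob2_\<tau>[OF c d b] cob2_\<tau>[OF d b c]
      br[of "pb c" "pb d" "pb b"] br[of "pb b" "pb d" "pb c"] br[of "pb b" "pb c" "pb d"]
      \<delta>[of "pb d" "pb b" "pb c"] \<delta>[of "pb b" "pb c" "pb d"] \<delta>[of "pb c" "pb d" "pb b"] swap
    by (simp add: algebra_simps del: cd_app_parts)
qed

lemma equivariant_\<tau>:
  assumes b: "b \<in> cbasis" and c: "c \<in> cbasis"
  shows "extend_derivation (dress br\<^sub>l \<delta>\<^sub>l a) (\<tau> b c) + ad2 br\<^sub>a (\<iota> (il a)) \<tau> b c = 0"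
proof -
  note lin = scalar_linear[OF clinear_coord_bra(2)]
  have "ad2 br\<^sub>a (\<iota> (il a)) \<tau> b c = (\<Sum>x\<in>cbasis. \<tau> x c * scalar (coord b (br\<^sub>a (\<iota> (il a)) x)))
      + (\<Sum>x\<in>cbasis. \<tau> b x * scalar (coord c (br\<^sub>a (\<iota> (il a)) x)))"
    by (simp add: ad2_apply[OF b c] cscale_mult_right)
  then show ?thesis
    unfolding derivation_\<tau>[OF derivation_extend[OF derivation_dress]] dress_contraction
      \<tau>_contract_left[OF lin] \<tau>_contract_right[OF lin]
    by (simp add: cd_app_pb \<iota>_br)
qed

text \<open>For skew-symmetric \<open>r\<close> the bracket terms of \<open>r\<close> with \<open>\<sigma>\<close> combine to the actions on \<open>r\<close> of
  one leg of \<open>\<sigma>\<close>.\<close>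

lemma cyb_cross_terms:
  fixes r :: "'a \<Rightarrow> 'a \<Rightarrow> 'l cdual wfun fract"
  assumes skew: "\<And>x y. r x y = - r y x" and b: "b \<in> cbasis" and c: "c \<in> cbasis" and d: "d \<in> cbasis"
  shows "cyb br\<^sub>a r \<tau> b c d + cyb br\<^sub>a \<tau> r b c d =
    Y (pb d) (\<lambda>v. ad2 br\<^sub>a (\<iota> v) r b c) + Y (pb b) (\<lambda>v. ad2 br\<^sub>a (\<iota> v) r c d) + Y (pb c) (\<lambda>v. ad2 br\<^sub>a (\<iota> v) r d b)"
proof -
  define S where "S e v s = (\<Sum>x\<in>cbasis. coord e (br\<^sub>a v x) *\<^sub>C s x)" for e v and s :: "'a \<Rightarrow> 'l cdual wfun fract"
  have linS: "clinear (\<lambda>v. S e v s)" for e s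
    unfolding S_def
    by (intro clinearI)
       (simp_all add: clinear_add[OF clinear_coord_bra(1)] clinear_scale[OF clinear_coord_bra(1)]
         cscale_add_left sum.distrib cvec.scale_sum_right cscale_cscale)
  have first: "(\<Sum>x\<in>cbasis. \<Sum>y\<in>cbasis. coord e (br\<^sub>a x y) *\<^sub>C (t x * s y)) = (\<Sum>x\<in>cbasis. t x * S e x s)"
    for e and t s :: "'a \<Rightarrow> 'l cdual wfun fract"
    by (simp add: S_def sum_distrib_left cscale_mult_right)
  have second: "(\<Sum>x\<in>cbasis. \<Sum>y\<in>cbasis. coord e (br\<^sub>a x y) *\<^sub>C (s x * t y)) = - (\<Sum>y\<in>cbasis. t y * S e y s)"
    for e and t s :: "'a \<Rightarrow> 'l cdual wfun fract"
  proof -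
    have "coord e (br\<^sub>a x y) *\<^sub>C (s x * t y) = - (coord e (br\<^sub>a y x) *\<^sub>C (t y * s x))" for x y
      by (subst bra_skew) (simp add: clinear_neg[OF clinear_coord] mult.commute)
    then show ?thesis
      unfolding first[symmetric] by (subst sum.swap) (simp add: sum_negf)
  qed
  have neg: "S e v (\<lambda>x. r x f) = - S e v (r f)" for e f v
  proof -
    have "coord e (br\<^sub>a v x) *\<^sub>C r x f = - (coord e (br\<^sub>a v x) *\<^sub>C r f x)" for x
      by (subst skew) simp
    then show ?thesis by (simp add: S_def sum_negf)
  qed
  have ad: "ad2 br\<^sub>a v r e f = S e v (\<lambda>x. r x f) + S f v (r e)" if "e \<in> cbasis" "f \<in> cbasis" for v e f
    by (simp add: ad2_apply[OF that] S_def)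
  show ?thesis
    unfolding cyb_def first[of _ "\<lambda>x. \<tau> x _"] first[of _ "\<tau> _"] second[of _ _ "\<lambda>x. \<tau> x _"] second[of _ _ "\<tau> _"]
      \<tau>_contract_left[OF linS] \<tau>_contract_right[OF linS] ad[OF b c] ad[OF c d] ad[OF d b] Y_add
    by (simp add: neg Y_neg)
qed

end


section \<open>Restriction of dynamical r-matrices\<close>

context ambient_splitting
begin

context
  fixes Z :: "'a \<Rightarrow> 'a \<Rightarrow> 'a \<Rightarrow> complex" and \<rho> :: "'a \<Rightarrow> 'a \<Rightarrow> 'g cdual wfun fract"
  assumes Z: "Z \<in> wedge3 UNIV"
    and r_matrix: "pl_dynamical_r_matrix br \<delta> br\<^sub>a \<delta>\<^sub>a \<iota> Z \<rho>"
    and restr_defined: "restriction_defined \<delta> il iu \<rho>"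
begin

abbreviation \<rho>L :: "'a \<Rightarrow> 'a \<Rightarrow> 'l cdual wfun fract" where "\<rho>L \<equiv> restrict_L il iu \<rho>"

lemma \<rho>L_eq: "\<rho>L b c = frestrict (\<rho> b c)"
  by (simp add: restrict_L_def cmap2_def)

lemma \<rho>_cases:
  obtains P0 where "P0 \<in> FG" "restrict P0 \<noteq> 0"
    "\<rho> \<in> wedge2 (localization FG P0)"
  using restr_defined unfolding restriction_defined_def by blast

lemma \<rho>_skew: "\<rho> b c = - \<rho> c b" and \<rho>_outside: "b \<notin> cbasis \<or> c \<notin> cbasis \<Longrightarrow> \<rho> b c = 0"
  using \<rho>_cases wedge2_skew wedge2_outside by metis+

lemma localization_restrict:
  assumes "q \<in> localization FG P0" "restrict P0 \<noteq> 0"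
    "P0 \<in> FG"
  shows "q \<in> restrictable" and "frestrict q \<in> localization FL (restrict P0)"
proof -
  obtain f n where q: "q = to_fract f / to_fract P0 ^ n" "f \<in> FG"
    using assms(1) by (auto simp: localization_def)
  have pow: "to_fract x ^ n = to_fract (x ^ n)" for x :: "'x wfun"
    by (induction n) simp_all
  have nz: "restrict (P0 ^ n) \<noteq> 0"
    using assms(2) by (simp add: algebra_hom_power[OF algebra_hom_pullback])
  show "q \<in> restrictable"
    unfolding restrictable_def q(1) pow using q(2) nz formal_functions_power[OF assms(3)] by blast
  have "frestrict q = to_fract (restrict f) / to_fract (restrict P0) ^ n"
    unfolding q(1) pow extend_hom_fraction[OF algebra_hom_pullback nz]
    by (simp add: algebra_hom_power[OF algebra_hom_pullback])
  then show "frestrict q \<in> localization FL (restrict P0)"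
    unfolding localization_def using formal_functions_restrict[OF q(2)] by blast
qed

lemma \<rho>_restrictable:
  assumes "b \<in> cbasis" "c \<in> cbasis" shows "\<rho> b c \<in> restrictable"
proof -
  obtain P0 where P0: "P0 \<in> FG" "restrict P0 \<noteq> 0"
    "\<rho> \<in> wedge2 (localization FG P0)" by (rule \<rho>_cases)
  show ?thesis by (rule localization_restrict(1)[OF wedge2_mem[OF P0(3) assms] P0(2,1)])
qed

lemma \<rho>_domain: "\<rho> b c \<in> hom_domain restrict"
  using \<rho>_restrictable[of b c] \<rho>_outside[of b c] restrictable_domain hom_domain_zero[OF algebra_hom_pullback]
  by fastforce

lemma \<rho>L_skew: "\<rho>L b c = - \<rho>L c b"
  unfolding \<rho>L_eq by (subst \<rho>_skew) (rule extend_hom_uminus[OF algebra_hom_pullback \<rho>_domain])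

lemma \<rho>L_outside: "b \<notin> cbasis \<or> c \<notin> cbasis \<Longrightarrow> \<rho>L b c = 0"
  by (simp add: \<rho>L_eq \<rho>_outside extend_hom_zero[OF algebra_hom_pullback])

lemmas restrict_simps =
  extend_hom_add[OF algebra_hom_pullback] extend_hom_mult[OF algebra_hom_pullback]
  extend_hom_cscale[OF algebra_hom_pullback] extend_hom_sum[OF algebra_hom_pullback]
  extend_hom_uminus[OF algebra_hom_pullback]
  hom_domain_add[OF algebra_hom_pullback] hom_domain_mult[OF algebra_hom_pullback]
  hom_domain_cscale[OF algebra_hom_pullback] hom_domain_sum[OF algebra_hom_pullback]
  hom_domain_uminus[OF algebra_hom_pullback]

lemma frestrict_ad2:
  assumes "b \<in> cbasis" "c \<in> cbasis"
  shows "frestrict (ad2 br\<^sub>a x \<rho> b c) = ad2 br\<^sub>a x \<rho>L b c" and "ad2 br\<^sub>a x \<rho> b c \<in> hom_domain restrict"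
  by (simp_all add: ad2_apply[OF assms] restrict_simps \<rho>_domain \<rho>L_eq)

lemma dress_\<rho>:
  "extend_derivation (dress br \<delta> x) (\<rho> b c) = - ad2 br\<^sub>a (\<iota> x) \<rho> b c"
proof -
  have "cmap2 (extend_derivation (dress br \<delta> x)) \<rho> + ad2 br\<^sub>a (\<iota> x) \<rho> = 0"
    using r_matrix unfolding pl_dynamical_r_matrix_def by blast
  then have "(cmap2 (extend_derivation (dress br \<delta> x)) \<rho> + ad2 br\<^sub>a (\<iota> x) \<rho>) b c = 0"
    by simp
  then show ?thesis by (simp add: cmap2_def eq_neg_iff_add_eq_0)
qed

text \<open>The part of the differential that is transversal to \<open>L\<^sup>*\<close> is determined by the equivariance of
  \<open>\<rho>\<close> under \<open>\<uu>\<close>: it is the action of one leg of \<open>\<sigma>\<close> on the restriction.\<close>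

lemma frestrict_dL:
  assumes b: "b \<in> cbasis" and c: "c \<in> cbasis"
  shows "frestrict (dL \<iota> \<rho> b c d) = dL (\<iota> \<circ> il) \<rho>L b c d + Y (pb d) (\<lambda>v. ad2 br\<^sub>a (\<iota> v) \<rho>L b c)"
    and "dL \<iota> \<rho> b c d \<in> hom_domain restrict"
proof -
  note r = \<rho>_restrictable[OF b c]
  have dom: "extend_derivation (Lop (dual_basis e)) (\<rho> b c) \<in> hom_domain restrict" for e
    by (rule restrictable_derivation[OF r derivation_Lop])
  show "dL \<iota> \<rho> b c d \<in> hom_domain restrict"
    by (simp add: dL_apply[OF b c] restrict_simps dom)
  have "frestrict (dL \<iota> \<rho> b c d) =
      - (\<Sum>e\<in>cbasis. cd_app (pb d) e *\<^sub>C frestrict (extend_derivation (Lop (dual_basis e)) (\<rho> b c)))"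
    by (simp add: dL_apply[OF b c] restrict_simps dom cd_app_pb)
  also have "\<dots> = dL (\<iota> \<circ> il) \<rho>L b c d - (\<Sum>p\<in>cbasis. cd_app (pb d) (iu p) *\<^sub>C
      (\<Sum>q\<in>cbasis. \<sigma> p q * frestrict (extend_derivation (dress br \<delta> (iu q)) (\<rho> b c))))"
    unfolding frestrict_Lop[OF r] by (simp add: dL_apply[OF b c] \<rho>L_eq cd_app_pb)
  also have "\<dots> = dL (\<iota> \<circ> il) \<rho>L b c d + Y (pb d) (\<lambda>v. ad2 br\<^sub>a (\<iota> v) \<rho>L b c)"
    by (simp add: dress_\<rho> restrict_simps frestrict_ad2[OF b c] Y_def sum_negf)
  finally show "frestrict (dL \<iota> \<rho> b c d) = dL (\<iota> \<circ> il) \<rho>L b c d + Y (pb d) (\<lambda>v. ad2 br\<^sub>a (\<iota> v) \<rho>L b c)" .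
qed

lemma frestrict_cyb:
  shows "frestrict (cyb br\<^sub>a \<rho> \<rho> b c d) = cyb br\<^sub>a \<rho>L \<rho>L b c d" and "cyb br\<^sub>a \<rho> \<rho> b c d \<in> hom_domain restrict"
  by (simp_all add: cyb_def restrict_simps \<rho>_domain \<rho>L_eq)

lemma frestrict_cob2:
  assumes "b \<in> cbasis" "c \<in> cbasis" "d \<in> cbasis"
  shows "frestrict (cob2 \<delta>\<^sub>a \<rho> b c d) = cob2 \<delta>\<^sub>a \<rho>L b c d" and "cob2 \<delta>\<^sub>a \<rho> b c d \<in> hom_domain restrict"
  by (simp_all add: cob2_apply[OF assms] restrict_simps \<rho>_domain \<rho>L_eq)

text \<open>The terms lost in the differential by restricting to \<open>L\<^sup>*\<close> are exactly the cross terms with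
  \<open>\<sigma>\<close>.\<close>

lemma restricted_yang_baxter:
  assumes b: "b \<in> cbasis" and c: "c \<in> cbasis" and d: "d \<in> cbasis"
  shows "cyb br\<^sub>a \<rho>L \<rho>L b c d + Alt3 (dL (\<iota> \<circ> il) \<rho>L) b c d + Alt3 (cob2 \<delta>\<^sub>a \<rho>L) b c d
    + (cyb br\<^sub>a \<rho>L \<tau> b c d + cyb br\<^sub>a \<tau> \<rho>L b c d) = scalar (Z b c d)"
proof -
  have "CYB br\<^sub>a \<rho> + Alt3 (dL \<iota> \<rho>) + Alt3 (cob2 \<delta>\<^sub>a \<rho>) = (\<lambda>b c d. Z b c d *\<^sub>C 1)"
    using r_matrix unfolding pl_dynamical_r_matrix_def by blast
  then have "(CYB br\<^sub>a \<rho> + Alt3 (dL \<iota> \<rho>) + Alt3 (cob2 \<delta>\<^sub>a \<rho>)) b c d = Z b c d *\<^sub>C 1" by simp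
  then have "frestrict (cyb br\<^sub>a \<rho> \<rho> b c d + (dL \<iota> \<rho> b c d + dL \<iota> \<rho> c d b + dL \<iota> \<rho> d b c)
      + (cob2 \<delta>\<^sub>a \<rho> b c d + cob2 \<delta>\<^sub>a \<rho> c d b + cob2 \<delta>\<^sub>a \<rho> d b c)) = scalar (Z b c d)"
    by (simp add: CYB_apply[OF b c d] Alt3_def extend_hom_const[OF algebra_hom_pullback])
  then show ?thesis
    unfolding cyb_cross_terms[OF \<rho>L_skew b c d] Alt3_def
    by (simp add: restrict_simps frestrict_cyb frestrict_dL b c d frestrict_cob2 algebra_simps)
qed

lemma wedge2_sum_r_matrix:
  "\<exists>Q\<in>FL. Q \<noteq> 0 \<and>
     \<rho>L + \<tau> \<in> wedge2 (localization FL Q)"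
proof -
  obtain P0 where P0: "P0 \<in> FG" "restrict P0 \<noteq> 0"
    "\<rho> \<in> wedge2 (localization FG P0)" by (rule \<rho>_cases)
  note FP0 = formal_functions_restrict[OF P0(1)]
  \<comment> \<open>a common denominator of the restriction and of \<open>\<sigma>\<close>\<close>
  define Q where "Q = restrict P0 * P"
  have Q: "Q \<in> FL" "Q \<noteq> 0"
    using P0(2) P_nonzero by (simp_all add: Q_def formal_functions_mult FP0 formal_functions_P)
  have \<sigma>_loc: "\<sigma> x y \<in> localization FL Q"
    if "x \<in> cbasis" "y \<in> cbasis" for x y
  proof -
    have "\<sigma> x y \<in> localization FL P"
      using is_sigma that wedge2_mem unfolding is_sigma_def by blast
    from localization_extend[OF this P_nonzero P0(2) FP0] show ?thesis
      by (simp add: Q_def mult.commute)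
  qed
  have \<tau>_loc: "\<tau> b c \<in> localization FL Q" for b c
    unfolding \<tau>_eq by (intro localization_sum localization_cscale \<sigma>_loc Q)
  have \<rho>_loc: "\<rho>L b c \<in> localization FL Q"
    if "b \<in> cbasis" "c \<in> cbasis" for b c
    unfolding \<rho>L_eq Q_def
    by (rule localization_extend[OF localization_restrict(2)[OF wedge2_mem[OF P0(3) that] P0(2,1)] P0(2) P_nonzero formal_functions_P])
  have outside: "(\<rho>L + \<tau>) b c = 0" if "b \<notin> cbasis \<or> c \<notin> cbasis" for b c
    using that \<rho>L_outside[OF that] by (auto simp: \<tau>_def tmap2_apply coord_outside)
  have "(\<rho>L + \<tau>) b c = - (\<rho>L + \<tau>) c b" for b c
    using \<rho>L_skew[of b c] \<tau>_skew[of b c] by simp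
  then have "\<rho>L + \<tau> \<in> wedge2 (localization FL Q)"
    unfolding wedge2_def mem_Collect_eq
  proof (intro conjI ballI allI)
    show "(\<rho>L + \<tau>) b c \<in> localization FL Q"
      if "b \<in> cbasis" "c \<in> cbasis" for b c
      unfolding plus_fun_apply by (rule localization_add[OF \<rho>_loc[OF that] \<tau>_loc Q(2,1)])
  qed (use outside in blast)+
  with Q show ?thesis by blast
qed

lemma dL_add: "b \<in> cbasis \<Longrightarrow> c \<in> cbasis \<Longrightarrow> dL (\<iota> \<circ> il) (s + t) b c d = dL (\<iota> \<circ> il) s b c d + dL (\<iota> \<circ> il) t b c d"
  by (simp add: dL_apply clinear_add[OF derivation_linear[OF derivation_extend[OF derivation_Lop]]]
      cscale_add_right sum.distrib)

lemma pl_dynamical_r_matrix_sum: "pl_dynamical_r_matrix br\<^sub>l \<delta>\<^sub>l br\<^sub>a \<delta>\<^sub>a (\<iota> \<circ> il) Z (\<rho>L + \<tau>)"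
  unfolding pl_dynamical_r_matrix_def
proof (intro conjI allI wedge2_sum_r_matrix)
  fix a
  let ?D = "extend_derivation (dress br\<^sub>l \<delta>\<^sub>l a)"
  note lin = derivation_linear[OF derivation_extend[OF derivation_dress]]
  show "cmap2 ?D (\<rho>L + \<tau>) + ad2 br\<^sub>a ((\<iota> \<circ> il) a) (\<rho>L + \<tau>) = 0"
  proof (intro ext)
    fix b c
    show "(cmap2 ?D (\<rho>L + \<tau>) + ad2 br\<^sub>a ((\<iota> \<circ> il) a) (\<rho>L + \<tau>)) b c = 0 b c"
    proof (cases "b \<in> cbasis \<and> c \<in> cbasis")
      case True
      then have b: "b \<in> cbasis" and c: "c \<in> cbasis" by auto
      have "?D (\<rho>L b c) = frestrict (extend_derivation (dress br \<delta> (il a)) (\<rho> b c))"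
        by (simp only: \<rho>L_eq frestrict_dress[OF \<rho>_restrictable[OF b c]])
      also have "\<dots> = - ad2 br\<^sub>a (\<iota> (il a)) \<rho>L b c"
        by (simp add: dress_\<rho> restrict_simps frestrict_ad2[OF b c])
      finally have "?D (\<rho>L b c) = - ad2 br\<^sub>a (\<iota> (il a)) \<rho>L b c" .
      moreover have "ad2 br\<^sub>a (\<iota> (il a)) (\<rho>L + \<tau>) b c = ad2 br\<^sub>a (\<iota> (il a)) \<rho>L b c + ad2 br\<^sub>a (\<iota> (il a)) \<tau> b c"
        by (simp add: ad2_apply[OF b c] cscale_add_right sum.distrib)
      ultimately show ?thesis
        using equivariant_\<tau>[OF b c, of a] by (simp add: cmap2_def clinear_add[OF lin])
    next
      case False
      then have "\<rho>L b c = 0" "\<tau> b c = 0"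
        using \<rho>L_outside[of b c] by (auto simp: \<tau>_def tmap2_apply coord_outside)
      then show ?thesis
        using False by (auto simp: cmap2_def ad2_outside clinear_zero[OF lin])
    qed
  qed
next
  show "CYB br\<^sub>a (\<rho>L + \<tau>) + Alt3 (dL (\<iota> \<circ> il) (\<rho>L + \<tau>)) + Alt3 (cob2 \<delta>\<^sub>a (\<rho>L + \<tau>)) = (\<lambda>b c d. Z b c d *\<^sub>C 1)"
  proof (intro ext)
    fix b c d
    show "(CYB br\<^sub>a (\<rho>L + \<tau>) + Alt3 (dL (\<iota> \<circ> il) (\<rho>L + \<tau>)) + Alt3 (cob2 \<delta>\<^sub>a (\<rho>L + \<tau>))) b c d = Z b c d *\<^sub>C 1"
    proof (cases "b \<in> cbasis \<and> c \<in> cbasis \<and> d \<in> cbasis")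
      case True
      then have b: "b \<in> cbasis" and c: "c \<in> cbasis" and d: "d \<in> cbasis" by auto
      have cob: "cob2 \<delta>\<^sub>a (\<rho>L + \<tau>) b c d = cob2 \<delta>\<^sub>a \<rho>L b c d + cob2 \<delta>\<^sub>a \<tau> b c d"
        if "b \<in> cbasis" "c \<in> cbasis" "d \<in> cbasis" for b c d
        by (simp add: cob2_apply[OF that] cscale_add_right sum.distrib)
      have "(CYB br\<^sub>a (\<rho>L + \<tau>) + Alt3 (dL (\<iota> \<circ> il) (\<rho>L + \<tau>)) + Alt3 (cob2 \<delta>\<^sub>a (\<rho>L + \<tau>))) b c d =
        (cyb br\<^sub>a \<rho>L \<rho>L b c d + Alt3 (dL (\<iota> \<circ> il) \<rho>L) b c d + Alt3 (cob2 \<delta>\<^sub>a \<rho>L) b c d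
          + (cyb br\<^sub>a \<rho>L \<tau> b c d + cyb br\<^sub>a \<tau> \<rho>L b c d))
        + (cyb br\<^sub>a \<tau> \<tau> b c d + Alt3 (dL (\<iota> \<circ> il) \<tau>) b c d + Alt3 (cob2 \<delta>\<^sub>a \<tau>) b c d)"
        by (simp add: CYB_apply[OF b c d] Alt3_def cyb_add dL_add b c d cob)
      then show ?thesis
        by (simp only: restricted_yang_baxter[OF b c d] dynamical_yang_baxter_\<tau>[OF b c d] add_0_right)
    next
      case False
      then have "Z b c d = 0" using Z unfolding wedge3_def mem_Collect_eq by blast
      with False show ?thesis
        by (auto simp: CYB_outside Alt3_def dL_outside cob2_outside)
    qed
  qed
qed

end

end

theorem theorem2p7:
  fixes br\<^sub>g :: "'g::fd_complex_space \<Rightarrow> 'g \<Rightarrow> 'g" and \<delta>\<^sub>g :: "'g \<Rightarrow> 'g \<Rightarrow> 'g \<Rightarrow> complex"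
    and br\<^sub>l :: "'l::fd_complex_space \<Rightarrow> 'l \<Rightarrow> 'l" and \<delta>\<^sub>l :: "'l \<Rightarrow> 'l \<Rightarrow> 'l \<Rightarrow> complex"
    and br\<^sub>a :: "'a::fd_complex_space \<Rightarrow> 'a \<Rightarrow> 'a" and \<delta>\<^sub>a :: "'a \<Rightarrow> 'a \<Rightarrow> 'a \<Rightarrow> complex"
    and il :: "'l \<Rightarrow> 'g" and iu :: "'u::fd_complex_space \<Rightarrow> 'g" and \<iota> :: "'g \<Rightarrow> 'a"
    and i :: "'u \<Rightarrow> 'u cdual"
    and Z :: "'a \<Rightarrow> 'a \<Rightarrow> 'a \<Rightarrow> complex"
    and \<rho> :: "'a \<Rightarrow> 'a \<Rightarrow> 'g cdual wfun fract"
  assumes "lie_bialgebra_splitting br\<^sub>g \<delta>\<^sub>g br\<^sub>l \<delta>\<^sub>l il iu"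
    and "nondegenerate_splitting br\<^sub>g il iu"
    and "lie_bialgebra_inclusion br\<^sub>g \<delta>\<^sub>g br\<^sub>a \<delta>\<^sub>a \<iota>"
    and "Z \<in> wedge3 UNIV" and "\<And>a. ad3 br\<^sub>a a Z = 0" and "Alt4 (cob3 \<delta>\<^sub>a Z) = 0"
    and "clinear i" and "bij i"
    and "pl_dynamical_r_matrix br\<^sub>g \<delta>\<^sub>g br\<^sub>a \<delta>\<^sub>a \<iota> Z \<rho>"
    and "restriction_defined \<delta>\<^sub>g il iu \<rho>"
  shows "pl_dynamical_r_matrix br\<^sub>l \<delta>\<^sub>l br\<^sub>a \<delta>\<^sub>a (\<iota> \<circ> il) Z
    (restrict_L il iu \<rho> + tmap2 (\<iota> \<circ> iu) (sigma br\<^sub>g \<delta>\<^sub>g \<delta>\<^sub>l il iu i))"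
proof -
  interpret ambient_splitting br\<^sub>g \<delta>\<^sub>g br\<^sub>l \<delta>\<^sub>l il iu i br\<^sub>a \<delta>\<^sub>a \<iota>
    by (intro ambient_splitting.intro ambient_splitting_axioms.intro nondegenerate_splitting_data.intro
        nondegenerate_splitting_data_axioms.intro splitting.intro) fact+
  show ?thesis
    using pl_dynamical_r_matrix_sum[OF assms(4,9,10)] by (simp only: \<tau>_def)
qed

end
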